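(* Let $(R,\mathbf{m})$ be a one-dimensional Cohen-Macaulay local ring and let $I$ be an $\mathbf{m}$-primary ideal of $R$. Define $$\beta(I)=\begin{cases}0 & \text{if } e_0(I)=\lambda(I),\\ 1 & \text{if } e_0(I)=b(I) \text{ (and } e_0(I)\ne\lambda(I)),\\ e_1(I)-2e_0(I)+\lambda(I)+b(I)+2 & \text{if } e_0(I)>b(I).\end{cases}$$ Then $$P^1_I=\frac{\lambda(I)}{(1-T)^2}\ \text{ if } \beta(I)=0,\qquad P^1_I=\frac{\lambda(I)+(b(I)-\lambda(I))T}{(1-T)^2}\ \text{ if } \beta(I)=1,$$ and if $\beta(I)\ge 2$ then, coefficientwise, $$P^1_I\le\frac{\lambda(I)+(b(I)-\lambda(I))T+(e_0(I)-b(I)-1)T^2+T^{\beta(I)}}{(1-T)^2}.$$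
   Context: For an $\mathbf{m}$-primary ideal $I$ of a one-dimensional Cohen-Macaulay local ring $(R,\mathbf{m})$, put $H^0_I(n)=\mathrm{Length}_R(I^n/I^{n+1})$ and $H^1_I(n)=\sum_{j=0}^n H^0_I(j)=\mathrm{Length}_R(R/I^{n+1})$ for $n\ge 0$. The normalized Hilbert coefficients $e_0(I),e_1(I)$ are the integers with $H^0_I(n)=e_0(I)$ and $H^1_I(n)=e_0(I)(n+1)-e_1(I)$ for $n\gg 0$. It is known that $H^0_I(n)\le e_0(I)$ for all $n\ge 0$. One sets $\lambda(I)=\mathrm{Length}_R(R/I)$ and $b(I)=\mathrm{Length}_R(I/I^2)$. The series $P^1_I=\sum_{n\ge 0}H^1_I(n)T^n\in\mathbb{Z}[[T]]$ is the generating function of $H^1_I$. Inequalities between power series in $\mathbb{Z}[[T]]$ are termwise inequalities of coefficients. *)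

theory Defs
  imports
    "HOL-Library.Extended_Nat"
    "HOL-Computational_Algebra.Formal_Power_Series"
    "HOL-Algebra.Module"
    "HOL-Algebra.QuotRing"
    "HOL-Algebra.Ideal_Product"
    "HOL-Algebra.Ring_Divisibility"
begin

section \<open>Local rings, dimension, depth\<close>

definition local_ring :: "('a, 'b) ring_scheme \<Rightarrow> 'a set \<Rightarrow> bool" where
  "local_ring R \<mm> \<longleftrightarrow> cring R \<and> maximalideal \<mm> R \<and> (\<forall>J. maximalideal J R \<longrightarrow> J = \<mm>)"

definition krull_dim :: "('a, 'b) ring_scheme \<Rightarrow> enat" where
  "krull_dim R = Sup {enat k |k. \<exists>P :: nat \<Rightarrow> 'a set.
     (\<forall>i\<le>k. primeideal (P i) R) \<and> (\<forall>i<k. P i \<subset> P (Suc i))}"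

text \<open>The middle conjunct says that \<open>xs ! i\<close> is a nonzerodivisor on
  \<open>R / (xs ! 0, \<dots>, xs ! (i - 1))\<close>.\<close>

definition regular_sequence :: "('a, 'b) ring_scheme \<Rightarrow> 'a list \<Rightarrow> bool" where
  "regular_sequence R xs \<longleftrightarrow> set xs \<subseteq> carrier R
     \<and> (\<forall>i<length xs. \<forall>y\<in>carrier R.
          xs ! i \<otimes>\<^bsub>R\<^esub> y \<in> Idl\<^bsub>R\<^esub> (set (take i xs)) \<longrightarrow> y \<in> Idl\<^bsub>R\<^esub> (set (take i xs)))
     \<and> Idl\<^bsub>R\<^esub> (set xs) \<noteq> carrier R"

definition ring_depth :: "('a, 'b) ring_scheme \<Rightarrow> 'a set \<Rightarrow> enat" where
  "ring_depth R \<mm> = Sup {enat (length xs) |xs. set xs \<subseteq> \<mm> \<and> regular_sequence R xs}"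

definition cohen_macaulay_local :: "('a, 'b) ring_scheme \<Rightarrow> 'a set \<Rightarrow> bool" where
  "cohen_macaulay_local R \<mm> \<longleftrightarrow>
     local_ring R \<mm> \<and> noetherian_ring R \<and> ring_depth R \<mm> = krull_dim R"

definition ideal_radical :: "('a, 'b) ring_scheme \<Rightarrow> 'a set \<Rightarrow> 'a set" where
  "ideal_radical R I = {a \<in> carrier R. \<exists>n::nat. a [^]\<^bsub>R\<^esub> n \<in> I}"

definition primary_ideal :: "('a, 'b) ring_scheme \<Rightarrow> 'a set \<Rightarrow> bool" where
  "primary_ideal R Q \<longleftrightarrow> ideal Q R \<and> Q \<noteq> carrier R
     \<and> (\<forall>a\<in>carrier R. \<forall>b\<in>carrier R. a \<otimes>\<^bsub>R\<^esub> b \<in> Q \<longrightarrow> a \<in> Q \<or> b \<in> ideal_radical R Q)"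

definition primary_to :: "('a, 'b) ring_scheme \<Rightarrow> 'a set \<Rightarrow> 'a set \<Rightarrow> bool" where
  "primary_to R \<mm> Q \<longleftrightarrow> primary_ideal R Q \<and> ideal_radical R Q = \<mm>"


section \<open>Length of modules\<close>

definition regular_module :: "('a, 'b) ring_scheme \<Rightarrow> ('a, 'a) module" where
  "regular_module R = \<lparr>carrier = carrier R, mult = mult R, one = one R,
     zero = zero R, add = add R, smult = mult R\<rparr>"

text \<open>The fields \<open>mult\<close> and \<open>one\<close> are inherited from the ring record;
  they play no role for modules.\<close>

definition quot_module :: "('a, 'b, 'c) module_scheme \<Rightarrow> 'b set \<Rightarrow> ('a, 'b set) module" where
  "quot_module M N = \<lparr>carrier = a_rcosets\<^bsub>M\<^esub> N, mult = undefined, one = undefined,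
     zero = N, add = set_add M, smult = (\<lambda>a X. \<Union>x\<in>X. N +>\<^bsub>M\<^esub> (a \<odot>\<^bsub>M\<^esub> x))\<rparr>"

definition module_length :: "('a, 'b) ring_scheme \<Rightarrow> ('a, 'c, 'd) module_scheme \<Rightarrow> enat" where
  "module_length R M = Sup {enat k |k. \<exists>N :: nat \<Rightarrow> 'c set.
     (\<forall>i\<le>k. submodule (N i) R M) \<and> (\<forall>i<k. N i \<subset> N (Suc i))}"

text \<open>The \<open>R\<close>-module \<open>J / K\<close> for ideals \<open>K \<subseteq> J\<close>.\<close>

definition ideal_quot :: "('a, 'b) ring_scheme \<Rightarrow> 'a set \<Rightarrow> 'a set \<Rightarrow> ('a, 'a set) module" where
  "ideal_quot R J K = quot_module ((regular_module R)\<lparr>carrier := J\<rparr>) K"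

text \<open>Length as a natural number; all lengths to which this is applied are finite.\<close>

definition ideal_quot_length :: "('a, 'b) ring_scheme \<Rightarrow> 'a set \<Rightarrow> 'a set \<Rightarrow> nat" where
  "ideal_quot_length R J K = the_enat (module_length R (ideal_quot R J K))"


section \<open>Hilbert functions and normalized Hilbert coefficients\<close>

text \<open>In \<^const>\<open>ideals_set\<close> the product is the product of ideals and the unit is
  \<open>carrier R\<close>, so \<open>I [^]\<^bsub>ideals_set R\<^esub> n\<close> is the usual power of the ideal \<open>I\<close>.\<close>

definition hilb0 :: "('a, 'b) ring_scheme \<Rightarrow> 'a set \<Rightarrow> nat \<Rightarrow> nat" where
  "hilb0 R I n =
     ideal_quot_length R (I [^]\<^bsub>ideals_set R\<^esub> n) (I [^]\<^bsub>ideals_set R\<^esub> (n + 1))"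

definition hilb1 :: "('a, 'b) ring_scheme \<Rightarrow> 'a set \<Rightarrow> nat \<Rightarrow> nat" where
  "hilb1 R I n = (\<Sum>j=0..n. hilb0 R I j)"

definition hilb_e0 :: "('a, 'b) ring_scheme \<Rightarrow> 'a set \<Rightarrow> int" where
  "hilb_e0 R I = (THE e. \<forall>\<^sub>F n in sequentially. int (hilb0 R I n) = e)"

definition hilb_e1 :: "('a, 'b) ring_scheme \<Rightarrow> 'a set \<Rightarrow> int" where
  "hilb_e1 R I =
     (THE e. \<forall>\<^sub>F n in sequentially. int (hilb1 R I n) = hilb_e0 R I * (int n + 1) - e)"

definition colength :: "('a, 'b) ring_scheme \<Rightarrow> 'a set \<Rightarrow> int" where
  "colength R I = int (ideal_quot_length R (carrier R) I)"

definition hilb_b :: "('a, 'b) ring_scheme \<Rightarrow> 'a set \<Rightarrow> int" where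
  "hilb_b R I = int (ideal_quot_length R I (I [^]\<^bsub>ideals_set R\<^esub> (2::nat)))"

text \<open>The last branch is vacuous in the setting of interest, because
  \<open>hilb0 R I n \<le> hilb_e0 R I\<close> for all \<open>n\<close>.\<close>

definition hilb_beta :: "('a, 'b) ring_scheme \<Rightarrow> 'a set \<Rightarrow> int" where
  "hilb_beta R I =
     (if hilb_e0 R I = colength R I then 0
      else if hilb_e0 R I = hilb_b R I then 1
      else if hilb_e0 R I > hilb_b R I
        then hilb_e1 R I - 2 * hilb_e0 R I + colength R I + hilb_b R I + 2
      else undefined)"

definition hilb1_series :: "('a, 'b) ring_scheme \<Rightarrow> 'a set \<Rightarrow> int fps" where
  "hilb1_series R I = Abs_fps (\<lambda>n. int (hilb1 R I n))"


section \<open>Integer power series\<close>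

definition fps_coeff_le :: "int fps \<Rightarrow> int fps \<Rightarrow> bool" (infix \<open>\<le>\<^sub>c\<close> 50) where
  "f \<le>\<^sub>c g \<longleftrightarrow> (\<forall>n. fps_nth f n \<le> fps_nth g n)"

text \<open>\<open>1 / (1 - T)\<^sup>2\<close>: the type \<^typ>\<open>int fps\<close> has no division, but the constant
  coefficient of \<open>(1 - T)\<^sup>2\<close> is a unit.\<close>

definition inv_one_minus_T_sq :: "int fps" where
  "inv_one_minus_T_sq = fps_right_inverse ((1 - fps_X) ^ 2) 1"

lemma one_minus_T_sq_inverse: "(1 - fps_X) ^ 2 * inv_one_minus_T_sq = 1"
  unfolding inv_one_minus_T_sq_def by (rule fps_right_inverse) (simp add: power2_eq_square)

end

theory Submission
  imports Defs
begin

text \<open>Write \<open>H(n)\<close> for the length of \<open>I\<^sup>n / I\<^sup>n\<^sup>+\<^sup>1\<close>. If \<open>x I\<^sup>p = I\<^sup>p\<^sup>+\<^sup>1\<close> for some regular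
  \<open>x \<in> I\<close> and \<open>e\<close> is the length of \<open>R / x R\<close>, then \<open>e\<close> is also the length of \<open>I\<^sup>n / x I\<^sup>n\<close>, so
  \<open>H(n) \<le> e\<close>, with equality iff \<open>x I\<^sup>n = I\<^sup>n\<^sup>+\<^sup>1\<close>, a condition inherited by \<open>n + 1\<close>. Hence \<open>e = e\<^sub>0\<close>, and
  once \<open>H\<close> reaches the value \<open>e\<^sub>0\<close> it stays there. As \<open>e\<^sub>1 = \<Sum>\<^sub>j (e\<^sub>0 - H(j))\<close>, in the third case
  \<open>\<beta> - 2 = \<Sum>\<^sub>j\<^sub>\<ge>\<^sub>2 (e\<^sub>0 - H(j))\<close>, where the summands are positive up to some point and zero afterwards;
  this is the asserted bound.

  The element \<open>x\<close> exists when the residue field has enough elements compared with the number of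
  generators of \<open>I\<close> and the (bounded) values of \<open>H\<close>. A residue field that is too small is finite, and is
  enlarged by repeatedly adjoining a root of an irreducible polynomial \<open>t\<^sup>2 + t - c\<close>, which does not
  change \<open>H\<close>.\<close>

section \<open>Length of intervals of ideals\<close>

text \<open>The regular element \<open>y\<close> of \<open>I\<close> supplied by depth one need not
  satisfy y I^p = I^(p+1); it only bounds every H(n) by L, the length of R / yR. This bound replaces
  an asymptotic choice of a general element: among L r + 1 elements with distinct residues, r being
  the number of generators, some e makes x = a_0 + a_1 e + ... + a_(r-1) e^(r-1) satisfy x I^L =
  I^(L+1). One-parameter combinations are used because a Vandermonde argument then only asks for
  differences that are units. The extension is free of rank two and its maximal ideal is generated
  by that of R, so factors of length one keep length one; L and r do not change, and the number of
  residues needed is known in advance. The polynomial t^2 + t - c is chosen because t^2 + t vanishes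
  at 0 and -1, distinct in every characteristic, whereas t^2 - c fails in characteristic two. Since
  the element type cannot change during an induction, pairs are coded back into it. This is possible
  because the type is infinite: multiplication by a regular element of the maximal ideal is
  injective but not onto.\<close>

definition ideal_chain :: "('a, 'b) ring_scheme \<Rightarrow> 'a set \<Rightarrow> 'a set \<Rightarrow> nat \<Rightarrow> (nat \<Rightarrow> 'a set) \<Rightarrow> bool" where
  "ideal_chain R K J k N \<longleftrightarrow>
     (\<forall>i\<le>k. ideal (N i) R \<and> K \<subseteq> N i \<and> N i \<subseteq> J) \<and> (\<forall>i<k. N i \<subset> N (Suc i))"

text \<open>This is the length of the module J / K. It is written through the ideals between K and
  J, so that quotient modules enter only in the final translation
  \<open>module_length_ideal_quot\<close>.\<close>

definition ideal_length :: "('a, 'b) ring_scheme \<Rightarrow> 'a set \<Rightarrow> 'a set \<Rightarrow> enat" where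
  "ideal_length R K J = Sup {enat k |k. \<exists>N. ideal_chain R K J k N}"

lemma enat_leI: "(\<And>k. enat k \<le> x \<Longrightarrow> enat k \<le> y) \<Longrightarrow> x \<le> y"
proof (cases x)
  case infinity
  assume *: "\<And>k. enat k \<le> x \<Longrightarrow> enat k \<le> y"
  show ?thesis
  proof (cases y)
    case (enat m)
    then show ?thesis using *[of "Suc m"] infinity by simp
  qed simp
qed simp

lemma ideal_length_geI: "ideal_chain R K J k N \<Longrightarrow> enat k \<le> ideal_length R K J"
  unfolding ideal_length_def by (rule Sup_upper, rule CollectI, intro exI conjI, rule refl)

lemma ideal_chain_take: "ideal_chain R K J k N \<Longrightarrow> j \<le> k \<Longrightarrow> ideal_chain R K J j N"
  unfolding ideal_chain_def by (meson order_trans order_less_le_trans)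

text \<open>Chains can be truncated, so if none has length k then all are shorter and the supremum
  is at most k - 1. The constant chain K settles k = 0.\<close>

lemma le_ideal_length_iff:
  assumes "ideal K R" "K \<subseteq> J"
  shows "enat k \<le> ideal_length R K J \<longleftrightarrow> (\<exists>N. ideal_chain R K J k N)"
proof
  assume le: "enat k \<le> ideal_length R K J"
  show "\<exists>N. ideal_chain R K J k N"
  proof (rule ccontr)
    assume none: "\<nexists>N. ideal_chain R K J k N"
    moreover have "ideal_chain R K J 0 (\<lambda>_. K)" using assms by (auto simp: ideal_chain_def)
    ultimately obtain j where j: "k = Suc j" by (metis not0_implies_Suc)
    have "ideal_length R K J \<le> enat j"
      unfolding ideal_length_def
    proof (rule Sup_least, clarify)
      fix i N assume "ideal_chain R K J i N"
      then have "i < k" using none ideal_chain_take by (metis leI)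
      then show "enat i \<le> enat j" using j by simp
    qed
    then show False using le j by (meson Suc_n_not_le_n enat_ord_simps(1) order_trans)
  qed
qed (auto dest: ideal_length_geI)

lemma ideal_length_mono:
  assumes "K \<subseteq> K'" "J' \<subseteq> J"
  shows "ideal_length R K' J' \<le> ideal_length R K J"
proof -
  have "ideal_chain R K J k N" if "ideal_chain R K' J' k N" for k N
    using that assms unfolding ideal_chain_def by (meson subset_trans)
  then show ?thesis unfolding ideal_length_def by (intro Sup_subset_mono) blast
qed

lemma ideal_length_self [simp]: "ideal_length R K K = 0"
proof -
  have "ideal_length R K K \<le> 0" unfolding ideal_length_def
  proof (rule Sup_least, clarify)
    fix i N assume c: "ideal_chain R K K i N"
    then have "i = 0" unfolding ideal_chain_def
      by (metis Suc_leI bot_nat_0.not_eq_extremum order_antisym psubset_eq zero_le)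
    then show "enat i \<le> 0" by (simp add: zero_enat_def)
  qed
  then show ?thesis by simp
qed

text \<open>A chain below A can be continued by B, since its top lies inside A.\<close>

lemma add_le_ideal_length_psubset:
  assumes "ideal K R" "ideal B R" "K \<subseteq> A" "A \<subset> B"
  shows "ideal_length R K A + 1 \<le> ideal_length R K B"
proof (rule enat_leI)
  fix k assume k: "enat k \<le> ideal_length R K A + 1"
  show "enat k \<le> ideal_length R K B"
  proof (cases k)
    case (Suc j)
    then have "enat j \<le> ideal_length R K A"
      using k by (metis add.commute eSuc_enat eSuc_ile_mono plus_1_eSuc(1))
    then obtain N where N: "ideal_chain R K A j N"
      using le_ideal_length_iff assms by blast
    have "ideal_chain R K B j N"
      using N assms(4) unfolding ideal_chain_def by (meson psubset_imp_subset subset_trans)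
    moreover have "N j \<subseteq> A" using N by (simp add: ideal_chain_def)
    with assms(3,4) have "N j \<subset> B" "K \<subseteq> B" by auto
    ultimately have "ideal_chain R K B k (N(k := B))"
      using assms(2) Suc by (simp add: ideal_chain_def le_Suc_eq less_Suc_eq)
    then show ?thesis by (rule ideal_length_geI)
  qed (simp add: zero_enat_def[symmetric])
qed

lemma ideal_length_eq_0_iff:
  assumes "ideal K R" "ideal J R" "K \<subseteq> J"
  shows "ideal_length R K J = 0 \<longleftrightarrow> K = J"
proof
  assume "ideal_length R K J = 0"
  moreover have "ideal_length R K K + 1 \<le> ideal_length R K J" if "K \<noteq> J"
    using add_le_ideal_length_psubset[of K R J K] assms that by blast
  ultimately show "K = J" by (auto simp: one_enat_def zero_enat_def)
qed simp

context cring
begin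

lemma mem_set_addI: "a \<in> A \<Longrightarrow> b \<in> B \<Longrightarrow> a \<oplus> b \<in> A <+>\<^bsub>R\<^esub> B"
  by (auto simp: set_add_def')

lemma subset_ideal_sum:
  assumes "ideal A R" "ideal B R"
  shows "A \<subseteq> A <+>\<^bsub>R\<^esub> B" "B \<subseteq> A <+>\<^bsub>R\<^esub> B"
proof -
  have z: "\<zero> \<in> A" "\<zero> \<in> B"
    using assms by (auto intro: additive_subgroup.zero_closed ideal.axioms(1))
  show "A \<subseteq> A <+>\<^bsub>R\<^esub> B"
  proof
    fix a assume "a \<in> A"
    then have "a \<oplus> \<zero> \<in> A <+>\<^bsub>R\<^esub> B" using z mem_set_addI by blast
    then show "a \<in> A <+>\<^bsub>R\<^esub> B" using \<open>a \<in> A\<close> assms ideal.Icarr by fastforce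
  qed
  show "B \<subseteq> A <+>\<^bsub>R\<^esub> B"
  proof
    fix b assume "b \<in> B"
    then have "\<zero> \<oplus> b \<in> A <+>\<^bsub>R\<^esub> B" using z mem_set_addI by blast
    then show "b \<in> A <+>\<^bsub>R\<^esub> B" using \<open>b \<in> B\<close> assms ideal.Icarr by fastforce
  qed
qed

lemma ideal_sum_least:
  assumes "ideal C R" "A \<subseteq> C" "B \<subseteq> C"
  shows "A <+>\<^bsub>R\<^esub> B \<subseteq> C"
proof
  fix c assume "c \<in> A <+>\<^bsub>R\<^esub> B"
  then obtain a b where "a \<in> A" "b \<in> B" "c = a \<oplus> b" unfolding set_add_def' by blast
  then show "c \<in> C" using assms by (metis additive_subgroup.a_closed ideal.axioms(1) subsetD)
qed

lemma ideal_sum_mono: "A \<subseteq> A' \<Longrightarrow> B \<subseteq> B' \<Longrightarrow> A <+>\<^bsub>R\<^esub> B \<subseteq> A' <+>\<^bsub>R\<^esub> B'"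
  unfolding set_add_def' by blast

lemma ideal_diff_closed:
  assumes "ideal A R" "a \<in> A" "b \<in> A" shows "a \<ominus> b \<in> A"
  using assms by (simp add: a_minus_def additive_subgroup.a_closed additive_subgroup.a_inv_closed ideal.axioms(1))

text \<open>This is the modular law: in b = a + l the summand l = b - a lies in both B and L, hence
  in A.\<close>

lemma ideal_eq_if_inter_sum:
  assumes A: "ideal A R" and B: "ideal B R" and L: "ideal L R" and sub: "A \<subseteq> B"
    and int: "B \<inter> L \<subseteq> A" and sum: "B \<subseteq> A <+>\<^bsub>R\<^esub> L"
  shows "A = B"
proof (rule antisym[OF sub], rule subsetI)
  fix b assume b: "b \<in> B"
  then obtain a l where al: "a \<in> A" "l \<in> L" "b = a \<oplus> l" using sum by (auto simp: set_add_def')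
  then have c: "a \<in> carrier R" "l \<in> carrier R" using A L ideal.Icarr by metis+
  have "b \<ominus> a \<in> B" using ideal_diff_closed[OF B b] al sub by blast
  then have "l \<in> B" using al c by (simp add: a_minus_def a_comm a_assoc r_neg1 r_neg2)
  then have "l \<in> A" using al int by blast
  then show "b \<in> A" using al A by (simp add: additive_subgroup.a_closed ideal.axioms(1))
qed

text \<open>For the upper bound, each strict step of a chain stays strict after intersecting with L
  or after adding L, so the steps are shared between the two intervals. For the lower bound, a chain
  above L adds its steps to the length of L over K.\<close>

lemma ideal_length_add:
  assumes K: "ideal K R" and L: "ideal L R" and J: "ideal J R" and KL: "K \<subseteq> L" and LJ: "L \<subseteq> J"
  shows "ideal_length R K J = ideal_length R K L + ideal_length R L J"
proof (rule antisym)
  show "ideal_length R K J \<le> ideal_length R K L + ideal_length R L J"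
  proof (rule enat_leI)
    fix k assume "enat k \<le> ideal_length R K J"
    then obtain N where N: "ideal_chain R K J k N"
      using le_ideal_length_iff K KL LJ by (metis order_trans)
    have "enat i \<le> ideal_length R K (N i \<inter> L) + ideal_length R L (N i <+>\<^bsub>R\<^esub> L)" if "i \<le> k" for i
      using that
    proof (induction i)
      case (Suc i)
      let ?A = "N i" and ?B = "N (Suc i)"
      have AB: "ideal ?A R" "ideal ?B R" "K \<subseteq> ?A" "?A \<subset> ?B"
        using N Suc.prems unfolding ideal_chain_def by auto
      have le: "ideal_length R K (?A \<inter> L) \<le> ideal_length R K (?B \<inter> L)"
        "ideal_length R L (?A <+>\<^bsub>R\<^esub> L) \<le> ideal_length R L (?B <+>\<^bsub>R\<^esub> L)"
        using AB ideal_sum_mono[of ?A ?B L L] by (auto intro!: ideal_length_mono)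
      have "?A \<inter> L \<subset> ?B \<inter> L \<or> ?A <+>\<^bsub>R\<^esub> L \<subset> ?B <+>\<^bsub>R\<^esub> L"
      proof (rule ccontr)
        assume "\<not> ?thesis"
        moreover have "?A \<inter> L \<subseteq> ?B \<inter> L" "?A <+>\<^bsub>R\<^esub> L \<subseteq> ?B <+>\<^bsub>R\<^esub> L"
          using AB ideal_sum_mono[of ?A ?B L L] by auto
        ultimately have "?B \<inter> L \<subseteq> ?A" "?B \<subseteq> ?A <+>\<^bsub>R\<^esub> L"
          using subset_ideal_sum(1)[OF AB(2) L] by auto
        then have "?A = ?B" using ideal_eq_if_inter_sum[OF AB(1,2) L] AB by blast
        then show False using AB by blast
      qed
      then have "ideal_length R K (?A \<inter> L) + ideal_length R L (?A <+>\<^bsub>R\<^esub> L) + 1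
          \<le> ideal_length R K (?B \<inter> L) + ideal_length R L (?B <+>\<^bsub>R\<^esub> L)"
      proof
        assume s: "?A \<inter> L \<subset> ?B \<inter> L"
        have "ideal_length R K (?A \<inter> L) + 1 \<le> ideal_length R K (?B \<inter> L)"
          by (rule add_le_ideal_length_psubset[OF K i_intersect[OF AB(2) L] _ s]) (use AB KL in blast)
        then have "(ideal_length R K (?A \<inter> L) + 1) + ideal_length R L (?A <+>\<^bsub>R\<^esub> L)
          \<le> ideal_length R K (?B \<inter> L) + ideal_length R L (?B <+>\<^bsub>R\<^esub> L)"
          using le(2) by (rule add_mono)
        then show ?thesis by (simp add: ac_simps)
      next
        assume s: "?A <+>\<^bsub>R\<^esub> L \<subset> ?B <+>\<^bsub>R\<^esub> L"
        have "ideal_length R L (?A <+>\<^bsub>R\<^esub> L) + 1 \<le> ideal_length R L (?B <+>\<^bsub>R\<^esub> L)"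
          by (rule add_le_ideal_length_psubset[OF L add_ideals[OF AB(2) L] _ s])
            (rule subset_ideal_sum(2)[OF AB(1) L])
        with le(1) have "ideal_length R K (?A \<inter> L) + (ideal_length R L (?A <+>\<^bsub>R\<^esub> L) + 1)
          \<le> ideal_length R K (?B \<inter> L) + ideal_length R L (?B <+>\<^bsub>R\<^esub> L)"
          by (rule add_mono)
        then show ?thesis by (simp add: ac_simps)
      qed
      moreover have "enat i \<le> ideal_length R K (?A \<inter> L) + ideal_length R L (?A <+>\<^bsub>R\<^esub> L)"
        using Suc by simp
      moreover have "enat (Suc i) = enat i + 1" by (simp add: one_enat_def)
      ultimately show ?case by (metis add_right_mono order_trans)
    qed (simp add: zero_enat_def[symmetric])
    from this[OF order_refl] have "enat k \<le> ideal_length R K (N k \<inter> L) + ideal_length R L (N k <+>\<^bsub>R\<^esub> L)" .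
    also have "\<dots> \<le> ideal_length R K L + ideal_length R L J"
    proof (rule add_mono; rule ideal_length_mono)
      show "N k <+>\<^bsub>R\<^esub> L \<subseteq> J" using N LJ by (intro ideal_sum_least[OF J]) (auto simp: ideal_chain_def)
    qed auto
    finally show "enat k \<le> ideal_length R K L + ideal_length R L J" .
  qed
next
  have step: "ideal_length R K L + enat k \<le> ideal_length R K J" if k: "enat k \<le> ideal_length R L J" for k
  proof -
    obtain N where N: "ideal_chain R L J k N" using k le_ideal_length_iff L LJ by blast
    have "ideal_length R K L + enat i \<le> ideal_length R K (N i)" if "i \<le> k" for i
      using that
    proof (induction i)
      case 0
      show ?case using N by (auto simp: zero_enat_def[symmetric] ideal_chain_def intro: ideal_length_mono)
    next
      case (Suc i)
      have "ideal_length R K (N i) + 1 \<le> ideal_length R K (N (Suc i))"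
      proof (rule add_le_ideal_length_psubset[OF K])
        have "L \<subseteq> N i" using N Suc.prems by (simp add: ideal_chain_def)
        then show "K \<subseteq> N i" using KL by (rule subset_trans[rotated])
      qed (use N Suc.prems in \<open>auto simp: ideal_chain_def\<close>)
      moreover have "ideal_length R K L + enat i + 1 \<le> ideal_length R K (N i) + 1"
        using Suc by (intro add_right_mono) simp
      moreover have "enat (Suc i) = enat i + 1" by (simp add: one_enat_def)
      ultimately show ?case by (metis add.assoc order_trans)
    qed
    from this[OF order_refl] have "ideal_length R K L + enat k \<le> ideal_length R K (N k)" .
    also have "\<dots> \<le> ideal_length R K J"
      using N by (intro ideal_length_mono) (auto simp: ideal_chain_def)
    finally show ?thesis .
  qed
  show "ideal_length R K L + ideal_length R L J \<le> ideal_length R K J"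
  proof (cases "ideal_length R L J")
    case (enat k)
    then show ?thesis using step[of k] by simp
  next
    case infinity
    have "enat k \<le> ideal_length R K J" for k
    proof -
      have "enat k \<le> ideal_length R K L + enat k" by simp
      also have "\<dots> \<le> ideal_length R K J" using step[of k] infinity by simp
      finally show ?thesis .
    qed
    then show ?thesis by (rule enat_leI)
  qed
qed

section \<open>Nonzerodivisors and multiplication of ideals by an element\<close>

definition regular :: "'a \<Rightarrow> bool" where
  "regular x \<longleftrightarrow> x \<in> carrier R \<and> (\<forall>z\<in>carrier R. x \<otimes> z = \<zero> \<longrightarrow> z = \<zero>)"

lemma regular_cancel:
  assumes "regular x" "a \<in> carrier R" "b \<in> carrier R" "x \<otimes> a = x \<otimes> b"
  shows "a = b"
proof -
  have "x \<otimes> (a \<ominus> b) = \<zero>"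
    using assms by (simp add: regular_def a_minus_def r_distr r_minus r_neg)
  then have "a \<ominus> b = \<zero>" using assms by (simp add: regular_def)
  then show ?thesis using assms by (simp add: r_right_minus_eq)
qed

lemma ideal_image_mult:
  assumes K: "ideal K R" and x: "x \<in> carrier R"
  shows "ideal ((\<otimes>) x ` K) R"
proof (rule idealI)
  show "ring R" by (rule ring_axioms)
  have Kc: "k \<in> carrier R" if "k \<in> K" for k using K that by (rule ideal.Icarr)
  show "subgroup ((\<otimes>) x ` K) (add_monoid R)"
  proof (rule group.subgroupI[OF add.is_group], goal_cases)
    case 1 show ?case using Kc x by auto
  next
    case 2 show ?case using additive_subgroup.zero_closed[OF ideal.axioms(1)[OF K]] by blast
  next
    case (3 a)
    then obtain k where k: "k \<in> K" "a = x \<otimes> k" by blast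
    then have "\<ominus> a = x \<otimes> \<ominus> k" using Kc x by (simp add: r_minus)
    moreover have "\<ominus> k \<in> K" using K k by (simp add: additive_subgroup.a_inv_closed ideal.axioms(1))
    ultimately show ?case by (simp flip: a_inv_def)
  next
    case (4 a b)
    then obtain k l where k: "k \<in> K" "a = x \<otimes> k" and l: "l \<in> K" "b = x \<otimes> l" by blast
    then have "a \<oplus> b = x \<otimes> (k \<oplus> l)" using Kc x by (simp add: r_distr)
    moreover have "k \<oplus> l \<in> K" using K k l by (simp add: additive_subgroup.a_closed ideal.axioms(1))
    ultimately show ?case by simp
  qed
next
  fix a r assume "a \<in> (\<otimes>) x ` K" and r: "r \<in> carrier R"
  then obtain k where k: "k \<in> K" "a = x \<otimes> k" by blast
  then have kc: "k \<in> carrier R" using ideal.Icarr[OF K] by blast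
  have "r \<otimes> a = x \<otimes> (r \<otimes> k)" using k kc x r by (simp add: m_lcomm)
  then show "r \<otimes> a \<in> (\<otimes>) x ` K" using ideal.I_l_closed[OF K k(1) r] by blast
  moreover have "a \<otimes> r = r \<otimes> a" using k kc x r by (simp add: m_comm)
  ultimately show "a \<otimes> r \<in> (\<otimes>) x ` K" by simp
qed

lemma ideal_vimage_mult:
  assumes K: "ideal K R" and x: "x \<in> carrier R"
  shows "ideal {z \<in> carrier R. x \<otimes> z \<in> K} R"
proof (rule idealI)
  show "ring R" by (rule ring_axioms)
  interpret K: ideal K R by (rule K)
  show "subgroup {z \<in> carrier R. x \<otimes> z \<in> K} (add_monoid R)"
    by (rule group.subgroupI[OF add.is_group])
      (use x in \<open>auto simp: r_distr r_minus simp flip: a_inv_def\<close>)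
  show "a \<otimes> r \<in> {z \<in> carrier R. x \<otimes> z \<in> K}" "r \<otimes> a \<in> {z \<in> carrier R. x \<otimes> z \<in> K}"
    if "a \<in> {z \<in> carrier R. x \<otimes> z \<in> K}" "r \<in> carrier R" for a r
    using that x K.I_r_closed[of "x \<otimes> a" r] K.I_l_closed[of "x \<otimes> a" r] 
    by (auto simp: m_assoc m_lcomm)
qed

text \<open>Multiplication by a nonzerodivisor is an isomorphism from J onto xJ which carries K to
  xK, so chains can be moved in both directions.\<close>

lemma ideal_length_image_mult:
  assumes x: "regular x" and K: "ideal K R" and J: "ideal J R" and KJ: "K \<subseteq> J"
  shows "ideal_length R ((\<otimes>) x ` K) ((\<otimes>) x ` J) = ideal_length R K J"
proof (rule antisym; rule enat_leI)
  have xc: "x \<in> carrier R" using x by (simp add: regular_def)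
  have inj: "inj_on ((\<otimes>) x) (carrier R)" using regular_cancel[OF x] by (auto intro: inj_onI)
  have sc: "A \<subseteq> carrier R" if "ideal A R" for A using ideal.Icarr[OF that] by blast
  {
    fix k assume "enat k \<le> ideal_length R K J"
    then obtain N where N: "ideal_chain R K J k N" using le_ideal_length_iff K KJ by blast
    have "ideal_chain R ((\<otimes>) x ` K) ((\<otimes>) x ` J) k (\<lambda>i. (\<otimes>) x ` N i)"
      unfolding ideal_chain_def
    proof (intro conjI allI impI)
      fix i assume i: "i < k"
      then have N': "ideal (N i) R" "ideal (N (Suc i)) R" "N i \<subset> N (Suc i)"
        using N by (auto simp: ideal_chain_def)
      show "(\<otimes>) x ` N i \<subset> (\<otimes>) x ` N (Suc i)"
        using N' sc inj by (metis image_mono inj_on_image_eq_iff psubset_eq)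
    qed (use N xc in \<open>auto simp: ideal_chain_def intro: ideal_image_mult\<close>)
    then show "enat k \<le> ideal_length R ((\<otimes>) x ` K) ((\<otimes>) x ` J)" by (rule ideal_length_geI)
  }
  fix k assume k: "enat k \<le> ideal_length R ((\<otimes>) x ` K) ((\<otimes>) x ` J)"
  obtain N where N: "ideal_chain R ((\<otimes>) x ` K) ((\<otimes>) x ` J) k N"
    using le_ideal_length_iff[OF ideal_image_mult[OF K xc], of "(\<otimes>) x ` J"] KJ k by blast
  let ?M = "\<lambda>i. {z \<in> carrier R. x \<otimes> z \<in> N i}"
  have NM: "N i = (\<otimes>) x ` ?M i" if "i \<le> k" for i
  proof -
    have "N i \<subseteq> (\<otimes>) x ` J" using N that by (simp add: ideal_chain_def)
    then show ?thesis using sc[OF J] by blast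
  qed
  have "ideal_chain R K J k ?M"
    unfolding ideal_chain_def
  proof (intro conjI allI impI)
    fix i assume i: "i \<le> k"
    then have Ni: "ideal (N i) R" "(\<otimes>) x ` K \<subseteq> N i" "N i \<subseteq> (\<otimes>) x ` J"
      using N by (auto simp: ideal_chain_def)
    show "ideal (?M i) R" using ideal_vimage_mult[OF Ni(1) xc] .
    show "K \<subseteq> ?M i" using Ni sc[OF K] by blast
    show "?M i \<subseteq> J"
    proof
      fix z assume z: "z \<in> ?M i"
      then obtain j where "j \<in> J" "x \<otimes> z = x \<otimes> j" using Ni by blast
      then show "z \<in> J" using inj_onD[OF inj, of z j] z sc[OF J] by blast
    qed
  next
    fix i assume i: "i < k"
    then have "N i \<subset> N (Suc i)" using N by (auto simp: ideal_chain_def)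
    moreover from this have "?M i \<noteq> ?M (Suc i)"
      using NM[of i] NM[of "Suc i"] i by (metis Suc_leI less_imp_le psubset_eq)
    ultimately show "?M i \<subset> ?M (Suc i)" by blast
  qed
  then show "enat k \<le> ideal_length R K J" by (rule ideal_length_geI)
qed

end

section \<open>Powers of ideals and regular elements\<close>

abbreviation ideal_pow :: "('a, 'b) ring_scheme \<Rightarrow> 'a set \<Rightarrow> nat \<Rightarrow> 'a set" where
  "ideal_pow R I n \<equiv> I [^]\<^bsub>ideals_set R\<^esub> n"

lemma ideals_set_simps [simp]:
  "\<one>\<^bsub>ideals_set R\<^esub> = carrier R" "A \<otimes>\<^bsub>ideals_set R\<^esub> B = A \<cdot>\<^bsub>R\<^esub> B"
  by (simp_all add: ideals_set_def)

context cring
begin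

lemma ideal_pow_0: "ideal_pow R I 0 = carrier R"
  by simp

lemma ideal_pow_Suc: "ideal_pow R I (Suc n) = ideal_pow R I n \<cdot> I"
  by simp

lemma ideal_pow_ideal: "ideal I R \<Longrightarrow> ideal (ideal_pow R I n) R"
  by (induction n) (simp_all add: oneideal ideal_prod_is_ideal)

lemma ideal_pow_1: "ideal I R \<Longrightarrow> ideal_pow R I (Suc 0) = I"
  by (simp add: ideal_prod_commute[OF oneideal] ideal_prod_one)

lemma ideal_pow_Suc_subset: "ideal I R \<Longrightarrow> ideal_pow R I (Suc n) \<subseteq> ideal_pow R I n"
  using ideal_prod_inter[OF ideal_pow_ideal[of I n], of I] by (simp add: le_infI1)

lemma ideal_subset_carrier: "ideal J R \<Longrightarrow> J \<subseteq> carrier R"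
  by (rule subsetI) (rule ideal.Icarr)

lemma mult_mem_ideal_pow_Suc:
  assumes "a \<in> I" "b \<in> ideal_pow R I n" "ideal I R"
  shows "a \<otimes> b \<in> ideal_pow R I (Suc n)"
proof -
  have "b \<otimes> a \<in> ideal_pow R I (Suc n)" using assms ideal_prod.prod ideal_pow_Suc by metis
  moreover have "a \<in> carrier R" "b \<in> carrier R"
    using assms ideal_subset_carrier ideal_pow_ideal by blast+
  ultimately show ?thesis by (simp add: m_comm)
qed

lemma pow_mem_ideal_pow: "a \<in> I \<Longrightarrow> ideal I R \<Longrightarrow> a [^] n \<in> ideal_pow R I n"
proof (induction n)
  case (Suc n)
  then show ?case using ideal_prod.prod ideal_pow_Suc by (metis nat_pow_Suc)
qed simp

lemma ideal_prod_least:
  assumes "ideal C R" "\<And>i j. i \<in> I \<Longrightarrow> j \<in> J \<Longrightarrow> i \<otimes> j \<in> C"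
  shows "I \<cdot> J \<subseteq> C"
proof
  fix s assume "s \<in> I \<cdot> J"
  then show "s \<in> C"
    by (induction rule: ideal_prod.induct)
      (use assms in \<open>auto intro: additive_subgroup.a_closed[OF ideal.axioms(1)]\<close>)
qed

lemma ideal_prod_mono: "I \<subseteq> I' \<Longrightarrow> J \<subseteq> J' \<Longrightarrow> I \<cdot> J \<subseteq> I' \<cdot> J'"
proof
  fix s assume "I \<subseteq> I'" "J \<subseteq> J'" "s \<in> I \<cdot> J"
  from this(3) this(1,2) show "s \<in> I' \<cdot> J'"
    by (induction rule: ideal_prod.induct) (auto intro: ideal_prod.intros)
qed

text \<open>The two factors are treated one at a time: the elements whose multiple by a fixed t lies
  in the right-hand ideal form an ideal, so it suffices that they include the generators.\<close>

lemma genideal_prod: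
  assumes S: "S \<subseteq> carrier R" and T: "T \<subseteq> carrier R"
  shows "(Idl S) \<cdot> (Idl T) = Idl ((\<lambda>(s, t). s \<otimes> t) ` (S \<times> T))" (is "_ = Idl ?P")
proof
  have P: "?P \<subseteq> carrier R" using S T by auto
  have X: "ideal (Idl ?P) R" using P by (rule genideal_ideal)
  have ST: "Idl S \<subseteq> carrier R" "Idl T \<subseteq> carrier R"
    using S T genideal_ideal ideal_subset_carrier by blast+
  have 1: "s \<otimes> t \<in> Idl ?P" if s: "s \<in> Idl S" and t: "t \<in> T" for s t
  proof -
    have "S \<subseteq> {z \<in> carrier R. t \<otimes> z \<in> Idl ?P}"
    proof
      fix z assume z: "z \<in> S"
      then have "z \<otimes> t \<in> Idl ?P" using t genideal_self[OF P] by auto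
      moreover have "z \<otimes> t = t \<otimes> z" using z t S T by (intro m_comm) auto
      ultimately show "z \<in> {z \<in> carrier R. t \<otimes> z \<in> Idl ?P}" using z S by auto
    qed
    then have "Idl S \<subseteq> {z \<in> carrier R. t \<otimes> z \<in> Idl ?P}"
      using t T by (intro genideal_minimal ideal_vimage_mult[OF X]) auto
    then have "t \<otimes> s \<in> Idl ?P" using s by blast
    moreover have "s \<otimes> t = t \<otimes> s" using s t ST T by (intro m_comm) auto
    ultimately show ?thesis by simp
  qed
  show "(Idl S) \<cdot> (Idl T) \<subseteq> Idl ?P"
  proof (rule ideal_prod_least[OF X])
    fix s t assume st: "s \<in> Idl S" "t \<in> Idl T"
    have "Idl T \<subseteq> {z \<in> carrier R. s \<otimes> z \<in> Idl ?P}"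
      using st 1 T ST by (intro genideal_minimal ideal_vimage_mult[OF X]) auto
    then show "s \<otimes> t \<in> Idl ?P" using st by blast
  qed
  show "Idl ?P \<subseteq> (Idl S) \<cdot> (Idl T)"
    using S T genideal_self[OF S] genideal_self[OF T]
    by (intro genideal_minimal ideal_prod_is_ideal genideal_ideal) (auto intro!: ideal_prod.prod)
qed

text \<open>This supplies the finite generating set of I^(L+1) to which \<open>nakayama\<close> is
  applied.\<close>

lemma ideal_pow_fin_gen:
  assumes "set as \<subseteq> carrier R"
  shows "\<exists>A \<subseteq> carrier R. finite A \<and> ideal_pow R (Idl (set as)) n = Idl A"
proof (induction n)
  case 0
  show ?case using genideal_one ideal_pow_0 by (metis empty_subsetI finite.simps insert_subset one_closed)
next
  case (Suc n)
  then obtain A where A: "A \<subseteq> carrier R" "finite A" "ideal_pow R (Idl (set as)) n = Idl A" by blast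
  then have "ideal_pow R (Idl (set as)) (Suc n) = Idl ((\<lambda>(s, t). s \<otimes> t) ` (A \<times> set as))"
    using assms genideal_prod ideal_pow_Suc by metis
  then show ?case using A assms by (intro exI[of _ "(\<lambda>(s, t). s \<otimes> t) ` (A \<times> set as)"]) auto
qed

lemma regularI:
  "x \<in> carrier R \<Longrightarrow> (\<And>z. z \<in> carrier R \<Longrightarrow> x \<otimes> z = \<zero> \<Longrightarrow> z = \<zero>) \<Longrightarrow> regular x"
  unfolding regular_def by blast

lemma regular_closed: "regular x \<Longrightarrow> x \<in> carrier R"
  unfolding regular_def by blast

lemma regularD: "regular x \<Longrightarrow> z \<in> carrier R \<Longrightarrow> x \<otimes> z = \<zero> \<Longrightarrow> z = \<zero>"
  unfolding regular_def by blast

lemma regular_pow: "regular y \<Longrightarrow> regular (y [^] (n::nat))"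
proof (induction n)
  case (Suc n)
  then have y: "y \<in> carrier R" by (simp add: regular_closed)
  have "z = \<zero>" if z: "z \<in> carrier R" "y [^] Suc n \<otimes> z = \<zero>" for z
  proof -
    have "y [^] n \<otimes> (y \<otimes> z) = \<zero>" using z y by (simp add: m_assoc)
    then have "y \<otimes> z = \<zero>" using regularD[OF Suc.IH[OF Suc.prems]] y z(1) by blast
    then show ?thesis using regularD[OF Suc.prems] z(1) by blast
  qed
  then show ?case using y by (intro regularI) auto
qed (auto intro: regularI)

lemma regular_factor:
  assumes "regular (x \<otimes> z)" "x \<in> carrier R" "z \<in> carrier R"
  shows "regular x"
proof -
  have "u = \<zero>" if u: "u \<in> carrier R" "x \<otimes> u = \<zero>" for u
  proof -
    have "(x \<otimes> z) \<otimes> u = z \<otimes> (x \<otimes> u)" using u assms by (simp add: m_assoc m_lcomm[of x z u])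
    then have "(x \<otimes> z) \<otimes> u = \<zero>" using u assms by simp
    then show ?thesis using regularD[OF assms(1)] u by blast
  qed
  then show ?thesis using assms(2) by (rule regularI[rotated])
qed

lemma ideal_image_mult_subset: "ideal K R \<Longrightarrow> x \<in> carrier R \<Longrightarrow> (\<otimes>) x ` K \<subseteq> K"
  by (rule image_subsetI) (rule ideal.I_l_closed)

text \<open>The length of R / xM is computed along xM <= M <= R and along xM <= xR <= R. Since xR /
  xM has the same length as R / M, and this length is finite, it can be cancelled.\<close>

lemma ideal_length_mult_self:
  assumes x: "regular x" and M: "ideal M R" and fin: "ideal_length R M (carrier R) \<noteq> \<infinity>"
  shows "ideal_length R ((\<otimes>) x ` M) M = ideal_length R ((\<otimes>) x ` carrier R) (carrier R)"
proof -
  have xc: "x \<in> carrier R" using x by (simp add: regular_def)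
  have ideals: "ideal ((\<otimes>) x ` M) R" "ideal ((\<otimes>) x ` carrier R) R"
    using M xc by (simp_all add: ideal_image_mult oneideal)
  note Mc = ideal_subset_carrier[OF M]
  have "ideal_length R ((\<otimes>) x ` M) (carrier R)
      = ideal_length R ((\<otimes>) x ` M) M + ideal_length R M (carrier R)"
    using M ideals Mc ideal_image_mult_subset[OF M xc] by (intro ideal_length_add oneideal)
  moreover have "ideal_length R ((\<otimes>) x ` M) (carrier R)
      = ideal_length R ((\<otimes>) x ` M) ((\<otimes>) x ` carrier R) + ideal_length R ((\<otimes>) x ` carrier R) (carrier R)"
    using ideals Mc ideal_image_mult_subset[OF oneideal xc] by (intro ideal_length_add oneideal) auto
  moreover have "ideal_length R ((\<otimes>) x ` M) ((\<otimes>) x ` carrier R) = ideal_length R M (carrier R)"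
    using x M Mc by (intro ideal_length_image_mult oneideal)
  ultimately show ?thesis using fin by (metis add.commute enat_add_left_cancel)
qed

text \<open>Each factor y^n R / y^(n+1) R has the length of R / yR, by
  \<open>ideal_length_mult_self\<close> for M = y^n R.\<close>

lemma ideal_length_pow_finite:
  assumes y: "regular y" and fin: "ideal_length R ((\<otimes>) y ` carrier R) (carrier R) \<noteq> \<infinity>"
  shows "ideal_length R ((\<otimes>) (y [^] (n::nat)) ` carrier R) (carrier R) \<noteq> \<infinity>"
proof (induction n)
  case 0
  have "(\<otimes>) \<one> ` carrier R = carrier R" by force
  then show ?case by simp
next
  case (Suc n)
  let ?M = "(\<otimes>) (y [^] n) ` carrier R"
  have yc: "y \<in> carrier R" using y by (simp add: regular_def)
  have M: "ideal ?M R" using yc by (simp add: ideal_image_mult oneideal)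
  have yM: "(\<otimes>) y ` ?M = (\<otimes>) (y [^] Suc n) ` carrier R"
    using yc by (simp add: image_image m_assoc[symmetric] m_comm cong: image_cong_simp)
  have "ideal_length R ((\<otimes>) y ` ?M) (carrier R) = ideal_length R ((\<otimes>) y ` ?M) ?M + ideal_length R ?M (carrier R)"
    by (intro ideal_length_add ideal_image_mult[OF M yc] ideal_image_mult_subset[OF M yc] M oneideal
        ideal_subset_carrier[OF M])
  also have "\<dots> = ideal_length R ((\<otimes>) y ` carrier R) (carrier R) + ideal_length R ?M (carrier R)"
    using ideal_length_mult_self[OF y M Suc.IH] by simp
  finally show ?case using Suc.IH fin unfolding yM by (metis plus_eq_infty_iff_enat)
qed

lemma ideal_length_ideal_pow_finite:
  assumes y: "regular y" "y \<in> I" and I: "ideal I R"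
    and fin: "ideal_length R ((\<otimes>) y ` carrier R) (carrier R) \<noteq> \<infinity>"
  shows "ideal_length R (ideal_pow R I n) (carrier R) \<noteq> \<infinity>"
proof -
  have "(\<otimes>) (y [^] n) ` carrier R \<subseteq> ideal_pow R I n"
    using pow_mem_ideal_pow[OF y(2) I] ideal.I_r_closed[OF ideal_pow_ideal[OF I]] by blast
  then have "ideal_length R (ideal_pow R I n) (carrier R)
      \<le> ideal_length R ((\<otimes>) (y [^] n) ` carrier R) (carrier R)"
    by (intro ideal_length_mono) auto
  then show ?thesis using ideal_length_pow_finite[OF y(1) fin] by (metis enat_ord_simps(5))
qed

text \<open>The polynomial with coefficient list \<open>as\<close>, constant term first. Its values
  play the part of general linear combinations of the generators \<open>as\<close>.\<close>

primrec horner :: "'a list \<Rightarrow> 'a \<Rightarrow> 'a" where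
  "horner [] x = \<zero>"
| "horner (a # as) x = a \<oplus> x \<otimes> horner as x"

text \<open>Coefficients of the quotient of \<^term>\<open>horner as\<close> by the monic linear polynomial with root
  \<^term>\<open>e\<close>.\<close>

fun horner_quot :: "'a list \<Rightarrow> 'a \<Rightarrow> 'a list" where
  "horner_quot [] e = []"
| "horner_quot [a] e = []"
| "horner_quot (a # b # as) e = horner (b # as) e # horner_quot (b # as) e"

lemma horner_closed [simp]: "set as \<subseteq> carrier R \<Longrightarrow> x \<in> carrier R \<Longrightarrow> horner as x \<in> carrier R"
  by (induction as) auto

lemma horner_quot_closed: "set as \<subseteq> carrier R \<Longrightarrow> e \<in> carrier R \<Longrightarrow> set (horner_quot as e) \<subseteq> carrier R"
  by (induction as e rule: horner_quot.induct) auto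

lemma length_horner_quot [simp]: "length (horner_quot as e) = length as - 1"
  by (induction as e rule: horner_quot.induct) auto

lemma horner_diff:
  assumes "set as \<subseteq> carrier R" "x \<in> carrier R" "e \<in> carrier R"
  shows "horner as x = horner as e \<oplus> (x \<ominus> e) \<otimes> horner (horner_quot as e) x"
  using assms
proof (induction as e rule: horner_quot.induct)
  case (3 a b as e)
  let ?h = "horner (b # as)" and ?q = "horner (horner_quot (b # as) e) x"
  have IH: "?h x = ?h e \<oplus> (x \<ominus> e) \<otimes> ?q" using 3 by auto
  have c: "?h e \<in> carrier R" "?q \<in> carrier R" "a \<in> carrier R"
    using "3.prems" horner_quot_closed[of "b # as" e] by (auto simp del: horner.simps)
  have "horner (a # b # as) x = a \<oplus> x \<otimes> (?h e \<oplus> (x \<ominus> e) \<otimes> ?q)"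
    by (simp only: horner.simps(2)[of a] IH)
  also have "\<dots> = (a \<oplus> e \<otimes> ?h e) \<oplus> (x \<ominus> e) \<otimes> (?h e \<oplus> x \<otimes> ?q)"
    using c "3.prems" by algebra
  finally show ?case by simp
qed auto

text \<open>Synthetic division is read backwards: the head of the quotient is h =
  \<open>horner (b # as) e\<close>, so induction covers \<open>b # as\<close>, and then a = (a + e
  h) - e h.\<close>

lemma horner_quot_generate:
  assumes "set as \<subseteq> carrier R" "e \<in> carrier R" "ideal J R"
    and "horner as e \<in> J" "set (horner_quot as e) \<subseteq> J"
  shows "set as \<subseteq> J"
  using assms
proof (induction as e rule: horner_quot.induct)
  case (3 a b as e)
  let ?h = "horner (b # as) e"
  have hJ: "?h \<in> J" and bas: "set (b # as) \<subseteq> J" using 3 by auto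
  have c: "?h \<in> carrier R" "a \<in> carrier R" "e \<otimes> ?h \<in> carrier R"
    using "3.prems" by (auto simp del: horner.simps)
  have "(a \<oplus> e \<otimes> ?h) \<ominus> e \<otimes> ?h \<in> J"
    using "3.prems" ideal.I_l_closed[OF "3.prems"(3) hJ] by (intro ideal_diff_closed) simp_all
  moreover have "(a \<oplus> e \<otimes> ?h) \<ominus> e \<otimes> ?h = a" using c by algebra
  ultimately show ?case using bas by simp
qed auto

text \<open>A coordinate-free form of the invertibility of the Vandermonde matrix.\<close>

lemma horner_values_generate:
  assumes "set as \<subseteq> carrier R" "finite T" "T \<subseteq> carrier R" "length as \<le> card T" "ideal J R"
    and "\<And>u v. u \<in> T \<Longrightarrow> v \<in> T \<Longrightarrow> u \<noteq> v \<Longrightarrow> u \<ominus> v \<in> Units R"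
    and "\<And>u. u \<in> T \<Longrightarrow> horner as u \<in> J"
  shows "set as \<subseteq> J"
  using assms
proof (induction "length as" arbitrary: as T)
  case (Suc k)
  then obtain e where e: "e \<in> T" by (metis card.empty equals0I le_zero_eq nat.distinct(1))
  then have ec: "e \<in> carrier R" using Suc.prems by blast
  \<comment> \<open>The quotient has one coefficient less and is tested on one point less. At u its
    value is the difference of the values at u and e, divided by the unit u - e, so it lies in
    J.\<close>
  have "set (horner_quot as e) \<subseteq> J"
  proof (rule Suc.hyps(1)[of _ "T - {e}"])
    show "k = length (horner_quot as e)" using Suc.hyps(2) by simp
    show "set (horner_quot as e) \<subseteq> carrier R" using Suc.prems ec by (intro horner_quot_closed)
    show "length (horner_quot as e) \<le> card (T - {e})" using Suc.prems e by simp
    fix u assume u: "u \<in> T - {e}"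
    then have uc: "u \<in> carrier R" using Suc.prems by blast
    let ?q = "horner (horner_quot as e) u"
    have qc: "?q \<in> carrier R" using horner_quot_closed Suc.prems ec uc by simp
    have unit: "u \<ominus> e \<in> Units R" using Suc.prems u e by blast
    have "horner as u \<ominus> horner as e \<in> J" using Suc.prems u e by (intro ideal_diff_closed) auto
    moreover have "horner as u \<ominus> horner as e = (u \<ominus> e) \<otimes> ?q"
    proof -
      have "horner as e \<in> carrier R" using Suc.prems ec by simp
      then show ?thesis
        unfolding horner_diff[OF Suc.prems(1) uc ec] using uc ec qc by algebra
    qed
    ultimately have "inv (u \<ominus> e) \<otimes> ((u \<ominus> e) \<otimes> ?q) \<in> J"
      using Suc.prems(5) unit by (simp add: ideal.I_l_closed)
    then show "?q \<in> J" using unit qc by (metis Units_closed Units_inv_closed Units_l_inv l_one m_assoc)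
  qed (use Suc.prems in auto)
  from horner_quot_generate[OF Suc.prems(1) ec Suc.prems(5) Suc.prems(7)[OF e] this] show ?case .
qed simp

end

section \<open>Existence of a principal reduction\<close>

text \<open>Locality is phrased as "every element outside \<open>\<mm>\<close> is a unit", the form
  in which it is used and in which it can be checked by a norm computation for the quadratic
  extension.\<close>

locale local_cring = cring R for R (structure) +
  fixes \<mm> :: "'a set"
  assumes max_ideal: "ideal \<mm> R"
    and one_notin: "\<one> \<notin> \<mm>"
    and Units_if_notin: "a \<in> carrier R \<Longrightarrow> a \<notin> \<mm> \<Longrightarrow> a \<in> Units R"
begin

text \<open>Nakayama for one generator: a (1 - u) lies in N and 1 - u is a unit.\<close>

lemma mem_if_diff_mult_mem:
  assumes N: "ideal N R" and a: "a \<in> carrier R" and u: "u \<in> \<mm>" and au: "a \<ominus> a \<otimes> u \<in> N"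
  shows "a \<in> N"
proof -
  have uc: "u \<in> carrier R" using u max_ideal by (rule ideal.Icarr[rotated])
  have "\<one> \<ominus> u \<notin> \<mm>"
  proof
    assume "\<one> \<ominus> u \<in> \<mm>"
    then have "(\<one> \<ominus> u) \<oplus> u \<in> \<mm>"
      using u by (rule additive_subgroup.a_closed[OF ideal.axioms(1)[OF max_ideal]])
    moreover have "(\<one> \<ominus> u) \<oplus> u = \<one>" using uc by algebra
    ultimately show False using one_notin by simp
  qed
  then have unit: "\<one> \<ominus> u \<in> Units R" using uc by (simp add: Units_if_notin)
  have "inv (\<one> \<ominus> u) \<otimes> (a \<ominus> a \<otimes> u) \<in> N" using N au unit by (simp add: ideal.I_l_closed)
  moreover have "inv (\<one> \<ominus> u) \<otimes> (a \<ominus> a \<otimes> u) = inv (\<one> \<ominus> u) \<otimes> (\<one> \<ominus> u) \<otimes> a"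
  proof -
    have "inv (\<one> \<ominus> u) \<in> carrier R" using unit by simp
    then show ?thesis using uc a by algebra
  qed
  ultimately show ?thesis using unit a by simp
qed

text \<open>Induction on the generators, for all N at once. With N + aR in place of N the hypothesis
  holds for B, so B lies in N + aR; feeding this back puts a into N + a \<open>\<mm>\<close>, and
  the one-generator case applies.\<close>

lemma nakayama:
  assumes "finite A" "A \<subseteq> carrier R" "ideal N R" "A \<subseteq> N <+>\<^bsub>R\<^esub> \<mm> \<cdot> (Idl A)"
  shows "A \<subseteq> N"
  using assms
proof (induction A arbitrary: N rule: finite_induct)
  case (insert a B)
  let ?P = "(\<otimes>) a ` carrier R" and ?X = "\<mm> \<cdot> (Idl B)"
  have ac: "a \<in> carrier R" and B: "B \<subseteq> carrier R" and N: "ideal N R" using insert.prems by auto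
  have P: "ideal ?P R" using ac by (simp add: ideal_image_mult oneideal)
  have IB: "ideal (Idl B) R" using B by (rule genideal_ideal)
  have X: "ideal ?X R" using max_ideal IB by (rule ideal_prod_is_ideal)
  have NP: "ideal (N <+>\<^bsub>R\<^esub> ?P) R" using N P by (rule add_ideals)
  have PX: "ideal (?P <+>\<^bsub>R\<^esub> ?X) R" using P X by (rule add_ideals)
  have aP: "a \<in> ?P" using ac by (metis image_eqI one_closed r_one)
  have sub: "\<mm> \<cdot> (Idl (insert a B)) \<subseteq> ?P <+>\<^bsub>R\<^esub> ?X"
  proof (rule ideal_prod_least[OF PX])
    fix i j assume i: "i \<in> \<mm>" and j: "j \<in> Idl (insert a B)"
    have ic: "i \<in> carrier R" using max_ideal i by (rule ideal.Icarr)
    have "insert a B \<subseteq> {z \<in> carrier R. i \<otimes> z \<in> ?P <+>\<^bsub>R\<^esub> ?X}"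
    proof (intro subsetI CollectI conjI)
      fix z assume z: "z \<in> insert a B"
      then show "z \<in> carrier R" using ac B by auto
      show "i \<otimes> z \<in> ?P <+>\<^bsub>R\<^esub> ?X"
      proof (cases "z = a")
        case True
        then have "i \<otimes> z \<in> ?P" using ac ic by (metis imageI m_comm)
        then show ?thesis using subset_ideal_sum(1)[OF P X] by blast
      next
        case False
        then have "z \<in> Idl B" using z genideal_self[OF B] by blast
        then have "i \<otimes> z \<in> ?X" using i by (intro ideal_prod.prod)
        then show ?thesis using subset_ideal_sum(2)[OF P X] by blast
      qed
    qed
    then have "Idl (insert a B) \<subseteq> {z \<in> carrier R. i \<otimes> z \<in> ?P <+>\<^bsub>R\<^esub> ?X}"
      by (intro genideal_minimal ideal_vimage_mult[OF PX ic])
    then show "i \<otimes> j \<in> ?P <+>\<^bsub>R\<^esub> ?X" using j by blast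
  qed
  have "B \<subseteq> N <+>\<^bsub>R\<^esub> \<mm> \<cdot> (Idl (insert a B))" using insert.prems by simp
  also have "\<dots> \<subseteq> N <+>\<^bsub>R\<^esub> (?P <+>\<^bsub>R\<^esub> ?X)" using sub by (intro ideal_sum_mono order_refl)
  also have "\<dots> \<subseteq> (N <+>\<^bsub>R\<^esub> ?P) <+>\<^bsub>R\<^esub> ?X"
    using subset_ideal_sum[OF N P] subset_ideal_sum[OF NP X]
    by (intro ideal_sum_least add_ideals[OF NP X]) auto
  finally have "B \<subseteq> N <+>\<^bsub>R\<^esub> ?P" by (rule insert.IH[OF B NP])
  then have gen: "Idl (insert a B) \<subseteq> N <+>\<^bsub>R\<^esub> ?P"
    using aP subset_ideal_sum[OF N P] by (intro genideal_minimal NP) auto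
  have am: "ideal ((\<otimes>) a ` \<mm>) R" using max_ideal ac by (rule ideal_image_mult)
  \<comment> \<open>Now that every generator has the form n + a r, multiplying by an element of
    \<open>\<mm>\<close> leaves only multiples of a by elements of \<open>\<mm>\<close>.\<close>
  have "\<mm> \<cdot> (Idl (insert a B)) \<subseteq> N <+>\<^bsub>R\<^esub> (\<otimes>) a ` \<mm>"
  proof (rule ideal_prod_least[OF add_ideals[OF N am]])
    fix i j assume i: "i \<in> \<mm>" and j: "j \<in> Idl (insert a B)"
    have "j \<in> N <+>\<^bsub>R\<^esub> ?P" using gen j by blast
    then obtain n r where n: "n \<in> N" and r: "r \<in> carrier R" and j: "j = n \<oplus> a \<otimes> r"
      unfolding set_add_def' by blast
    have ic: "i \<in> carrier R" using max_ideal i by (rule ideal.Icarr)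
    have nc: "n \<in> carrier R" using N n by (rule ideal.Icarr)
    have "i \<otimes> j = i \<otimes> n \<oplus> a \<otimes> (i \<otimes> r)" unfolding j using ic nc r ac by algebra
    moreover have "i \<otimes> n \<in> N" using N n ic by (rule ideal.I_l_closed)
    moreover have "i \<otimes> r \<in> \<mm>" using max_ideal i r by (rule ideal.I_r_closed)
    ultimately show "i \<otimes> j \<in> N <+>\<^bsub>R\<^esub> (\<otimes>) a ` \<mm>" by (auto intro!: mem_set_addI)
  qed
  then have "N <+>\<^bsub>R\<^esub> \<mm> \<cdot> (Idl (insert a B)) \<subseteq> N <+>\<^bsub>R\<^esub> (\<otimes>) a ` \<mm>"
    using subset_ideal_sum[OF N am] by (intro ideal_sum_least add_ideals[OF N am])
  then have "a \<in> N <+>\<^bsub>R\<^esub> (\<otimes>) a ` \<mm>" using insert.prems by blast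
  then obtain n u where n: "n \<in> N" and u: "u \<in> \<mm>" and a: "a = n \<oplus> a \<otimes> u"
    unfolding set_add_def' by blast
  have "n \<in> carrier R" "u \<in> carrier R" using ideal.Icarr[OF N n] ideal.Icarr[OF max_ideal u] by simp_all
  then have "(n \<oplus> a \<otimes> u) \<ominus> a \<otimes> u = n" using ac by algebra
  moreover have "a \<ominus> a \<otimes> u = (n \<oplus> a \<otimes> u) \<ominus> a \<otimes> u"
    using a by (rule arg_cong[where f = "\<lambda>b. b \<ominus> a \<otimes> u"])
  ultimately have "a \<in> N" using n by (intro mem_if_diff_mult_mem[OF N ac u]) simp
  then have "?P \<subseteq> N" using ideal.I_r_closed[OF N] by blast
  then have "N <+>\<^bsub>R\<^esub> ?P \<subseteq> N" by (intro ideal_sum_least N order_refl)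
  then show ?case using \<open>a \<in> N\<close> \<open>B \<subseteq> N <+>\<^bsub>R\<^esub> ?P\<close> by blast
qed simp

text \<open>The argument of Eakin and Sathaye, for values of a polynomial in place of general linear
  combinations. If no value \<open>horner as e\<close> works, choose \<open>e\<close> such that
  \<open>w (horner as e) I\<^sup>k + J\<close> has maximal length. By induction, for all but few \<open>f\<close> this ideal is
  contained in, hence equal to, \<open>w (horner as f) I\<^sup>k + J\<close>; but these \<open>f\<close> suffice to generate
  \<open>w I\<^sup>k\<^sup>+\<^sup>1 + J\<close>.\<close>

lemma horner_value_stable:
  fixes c k :: nat and as :: "'a list" and J :: "'a set"
  defines "I \<equiv> Idl (set as)"
  defines "W \<equiv> \<lambda>w k. (\<otimes>) w ` ideal_pow R I k <+>\<^bsub>R\<^esub> J"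
  assumes as: "set as \<subseteq> carrier R" and J: "ideal J R"
  assumes "c \<le> k" "w \<in> carrier R" "finite T" "T \<subseteq> carrier R" "c * length as + 1 \<le> card T"
    and "\<And>u v. u \<in> T \<Longrightarrow> v \<in> T \<Longrightarrow> u \<noteq> v \<Longrightarrow> u \<ominus> v \<notin> \<mm>"
    and "ideal_length R J (W w (Suc k)) \<le> enat c"
  shows "\<exists>e\<in>T. W (w \<otimes> horner as e) k = W w (Suc k)"
proof -
  have I: "ideal I R" unfolding I_def using as by (rule genideal_ideal)
  have Ic: "ideal_pow R I k \<subseteq> carrier R" for k using ideal_pow_ideal[OF I] by (rule ideal_subset_carrier)
  have asI: "set as \<subseteq> I" unfolding I_def using as by (rule genideal_self)
  have W: "ideal (W w k) R" if "w \<in> carrier R" for w k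
    unfolding W_def using that by (intro add_ideals ideal_image_mult ideal_pow_ideal I J)
  have JW: "J \<subseteq> W w k" if "w \<in> carrier R" for w k
    unfolding W_def using that by (intro subset_ideal_sum ideal_image_mult ideal_pow_ideal I J)
  have wW: "(\<otimes>) w ` ideal_pow R I k \<subseteq> W w k" if "w \<in> carrier R" for w k
    unfolding W_def using that by (intro subset_ideal_sum ideal_image_mult ideal_pow_ideal I J)
  have W_least: "W w k \<subseteq> C" if "ideal C R" "(\<otimes>) w ` ideal_pow R I k \<subseteq> C" "J \<subseteq> C" for w k C
    unfolding W_def using that by (rule ideal_sum_least)
  have hI: "horner as e \<in> I" if "e \<in> carrier R" for e
  proof -
    have "set bs \<subseteq> I \<Longrightarrow> horner bs e \<in> I" for bs
    proof (induction bs)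
      case Nil
      show ?case using I by (simp add: additive_subgroup.zero_closed ideal.axioms(1))
    next
      case (Cons b bs)
      then show ?case using I that
        by (simp add: additive_subgroup.a_closed ideal.axioms(1) ideal.I_l_closed)
    qed
    then show ?thesis using asI .
  qed
  have hc: "horner as e \<in> carrier R" if "e \<in> carrier R" for e using as that by simp
  have mono: "W (w \<otimes> horner as e) k \<subseteq> W w (Suc k)" if "w \<in> carrier R" "e \<in> carrier R" for w e k
  proof -
    have "w \<otimes> horner as e \<otimes> z \<in> (\<otimes>) w ` ideal_pow R I (Suc k)" if "z \<in> ideal_pow R I k" for z
    proof -
      have "z \<in> carrier R" using that Ic by blast
      then have "w \<otimes> horner as e \<otimes> z = w \<otimes> (horner as e \<otimes> z)"
        using \<open>w \<in> carrier R\<close> hc[OF \<open>e \<in> carrier R\<close>] by (simp add: m_assoc)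
      then show ?thesis using mult_mem_ideal_pow_Suc[OF hI[OF \<open>e \<in> carrier R\<close>] that I] by blast
    qed
    then show ?thesis unfolding W_def by (intro ideal_sum_mono) auto
  qed
  from assms(5-) show ?thesis
  proof (induction c arbitrary: k w T)
    case 0
    then obtain e where e: "e \<in> T" by fastforce
    then have ec: "e \<in> carrier R" using 0 by blast
    have "ideal_length R J (W w (Suc k)) = 0" using 0(7) by (simp flip: zero_enat_def)
    \<comment> \<open>With length 0 there is no room between J and \<open>W w (Suc k)\<close>, so
      every point of T works.\<close>
    then have "J = W w (Suc k)"
      using ideal_length_eq_0_iff[OF J W[OF \<open>w \<in> carrier R\<close>] JW[OF \<open>w \<in> carrier R\<close>]] by simp
    moreover have "J \<subseteq> W (w \<otimes> horner as e) k" using 0 ec hc by (intro JW) simp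
    ultimately have "W (w \<otimes> horner as e) k = W w (Suc k)" using mono[of w e k] ec 0 by blast
    then show ?case using e by blast
  next
    case (Suc c)
    show ?case
    proof (rule ccontr)
      assume none: "\<not> ?case"
      note w = \<open>w \<in> carrier R\<close>
      \<comment> \<open>The hypothesis \<open>c \<le> k\<close> guarantees that an exponent is left
        to lower in each of the c induction steps.\<close>
      obtain k' where k: "k = Suc k'" and ck': "c \<le> k'" using Suc.prems(1) by (metis Suc_le_D Suc_le_mono)
      let ?V = "\<lambda>e. W (w \<otimes> horner as e) k"
      have Tc: "e \<in> carrier R" if "e \<in> T" for e using Suc.prems that by blast
      have whc: "w \<otimes> horner as e \<in> carrier R" if "e \<in> T" for e using w hc Tc that by simp
      have V: "ideal (?V e) R" "J \<subseteq> ?V e" if "e \<in> T" for e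
        using W JW whc that by blast+
      \<comment> \<open>Since e does not work, the inclusion of \<open>?V e\<close> is strict and
        costs one unit of length; this is what lowers the bound to c.\<close>
      have len: "ideal_length R J (?V e) \<le> enat c" if e: "e \<in> T" for e
      proof -
        have "?V e \<subset> W w (Suc k)" using mono[OF w Tc[OF e], of k] none e by blast
        then have "ideal_length R J (?V e) + 1 \<le> ideal_length R J (W w (Suc k))"
          using V[OF e] W[OF w] by (intro add_le_ideal_length_psubset J)
        also have "\<dots> \<le> enat (Suc c)" using Suc.prems by simp
        finally show ?thesis by (metis eSuc_enat eSuc_ile_mono plus_1_eSuc(2))
      qed
      have T: "finite T" "T \<noteq> {}" using Suc.prems by auto
      let ?M = "Max ((\<lambda>e. ideal_length R J (?V e)) ` T)"
      have "?M \<in> (\<lambda>e. ideal_length R J (?V e)) ` T" using T by (intro Max_in) auto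
      then obtain i where i: "i \<in> T" "ideal_length R J (?V i) = ?M" by auto
      have max: "ideal_length R J (?V e) \<le> ideal_length R J (?V i)" if "e \<in> T" for e
        unfolding i(2) using T that by (intro Max_ge) auto
      \<comment> \<open>B collects the exceptional points. If it had at least
        \<open>c * length as + 1\<close> elements, the induction hypothesis with
        \<open>w \<otimes> horner as i\<close> and exponent k' would find one that is not
        exceptional.\<close>
      define B where "B = {j \<in> T. W (w \<otimes> horner as i \<otimes> horner as j) k' \<noteq> ?V i}"
      have "card B < c * length as + 1"
      proof (rule ccontr)
        assume "\<not> ?thesis"
        then have "\<exists>e\<in>B. W (w \<otimes> horner as i \<otimes> horner as e) k' = W (w \<otimes> horner as i) (Suc k')"
          using Suc.prems ck' whc[OF i(1)] len[OF i(1)] k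
          by (intro Suc.IH) (auto simp: B_def)
        then show False unfolding B_def k by blast
      qed
      moreover have "card (T - B) = card T - card B"
        using T by (intro card_Diff_subset) (auto simp: B_def)
      \<comment> \<open>T has at least c r + r + 1 points, where r = \<open>length as\<close>, and B
        at most c r. So at least r points remain, one for each coefficient.\<close>
      ultimately have card: "length as \<le> card (T - B)" using Suc.prems(5) by simp
      have sub: "W (w \<otimes> horner as j) k \<subseteq> ?V i" if j: "j \<in> T - B" for j
      proof -
        have jT: "j \<in> T" and eq: "W (w \<otimes> horner as i \<otimes> horner as j) k' = ?V i"
          using j by (auto simp: B_def)
        \<comment> \<open>Exchanging the two factors shows that \<open>?V i\<close> is also
          contained in \<open>?V j\<close>; maximality of the length at i then forces
          equality.\<close>
        have "w \<otimes> horner as i \<otimes> horner as j = w \<otimes> horner as j \<otimes> horner as i"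
          using w hc[OF Tc[OF jT]] hc[OF Tc[OF i(1)]] by (simp add: m_ac)
        then have "?V i \<subseteq> ?V j"
          using mono[OF whc[OF jT] Tc[OF i(1)], of k'] eq k by simp
        moreover have False if "?V i \<subset> ?V j"
        proof -
          have "ideal_length R J (?V i) + 1 \<le> ideal_length R J (?V j)"
            using V[OF i(1)] V[OF jT] that by (intro add_le_ideal_length_psubset J)
          also have "\<dots> \<le> ideal_length R J (?V i)" using max jT by simp
          finally show False using len[OF i(1)]
            by (metis dual_order.refl eSuc_enat eSuc_ile_mono enat_ile not_less_eq_eq plus_1_eSuc(2) enat_ord_simps(1))
        qed
        ultimately show ?thesis by blast
      qed
      have "(\<otimes>) w ` (ideal_pow R I (Suc k)) \<subseteq> ?V i"
      proof -
        have Vi: "ideal (?V i) R" using V i by blast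
        have "w \<otimes> (u \<otimes> z) \<in> ?V i" if u: "u \<in> ideal_pow R I k" and z: "z \<in> I" for u z
        proof -
          have uc: "u \<in> carrier R" using u Ic by blast
          have wu: "w \<otimes> u \<in> carrier R" using w uc by simp
          \<comment> \<open>For fixed u in I^k the ideal \<open>?Q\<close> contains all values
            \<open>horner as e\<close> with e in T - B, hence by
            \<open>horner_values_generate\<close> all generators of I.\<close>
          let ?Q = "{z \<in> carrier R. (w \<otimes> u) \<otimes> z \<in> ?V i}"
          have Q: "ideal ?Q R" using Vi wu by (rule ideal_vimage_mult)
          have "set as \<subseteq> ?Q"
          proof (rule horner_values_generate[OF as _ _ card Q])
            show "finite (T - B)" "T - B \<subseteq> carrier R" using T Tc by auto
            show "a \<ominus> b \<in> Units R" if "a \<in> T - B" "b \<in> T - B" "a \<noteq> b" for a b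
              using that Suc.prems(6) Tc by (intro Units_if_notin) auto
            show "horner as e \<in> ?Q" if e: "e \<in> T - B" for e
            proof -
              have eT: "e \<in> T" using e by blast
              have "w \<otimes> horner as e \<otimes> u \<in> ?V i"
                using sub[OF e] wW[OF whc[OF eT], of k] u by blast
              moreover have "w \<otimes> horner as e \<otimes> u = w \<otimes> u \<otimes> horner as e"
                using w hc[OF Tc[OF eT]] uc by (simp add: m_ac)
              ultimately show ?thesis using hc[OF Tc[OF eT]] by simp
            qed
          qed
          then have "I \<subseteq> ?Q" unfolding I_def by (intro genideal_minimal Q)
          then have "w \<otimes> u \<otimes> z \<in> ?V i" "z \<in> carrier R" using z by auto
          then show ?thesis using w uc by (simp add: m_assoc)
        qed
        moreover have "u \<otimes> z \<in> carrier R" if "u \<in> ideal_pow R I k" "z \<in> I" for u z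
          using that Ic[of k] ideal_subset_carrier[OF I] by blast
        ultimately have "ideal_pow R I (Suc k) \<subseteq> {z \<in> carrier R. w \<otimes> z \<in> ?V i}"
          unfolding ideal_pow_Suc by (intro ideal_prod_least ideal_vimage_mult Vi w) auto
        then show ?thesis by blast
      qed
      then have "W w (Suc k) \<subseteq> ?V i"
        using V[OF i(1)] by (intro W_least)
      then show False using mono[OF w Tc[OF i(1)], of k] none i by blast
    qed
  qed
qed

end

text \<open>What is retained of the one-dimensional Cohen-Macaulay hypothesis, in a form that passes
  to the quadratic extension. The generators form a list because they serve as the coefficients of a
  polynomial.\<close>

locale hilbert_data = local_cring R \<mm> for R (structure) and \<mm> +
  fixes as :: "'a list" and y :: 'a
  assumes gens: "set as \<subseteq> \<mm>"
    and y_mem: "y \<in> Idl (set as)"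
    and y_regular: "regular y"
    and y_finite: "ideal_length R ((\<otimes>) y ` carrier R) (carrier R) \<noteq> \<infinity>"
begin

abbreviation "I \<equiv> Idl (set as)"

abbreviation "hilbert n \<equiv> ideal_length R (ideal_pow R I (Suc n)) (ideal_pow R I n)"

lemma gens_carrier: "set as \<subseteq> carrier R"
  using gens ideal_subset_carrier[OF max_ideal] by blast

lemma I_ideal: "ideal I R"
  using gens_carrier by (rule genideal_ideal)

lemma I_subset: "I \<subseteq> \<mm>"
  using max_ideal gens by (rule genideal_minimal)

lemma pow_finite: "ideal_length R (ideal_pow R I n) (carrier R) \<noteq> \<infinity>"
  using ideal_length_ideal_pow_finite[OF y_regular y_mem I_ideal y_finite] .

lemma image_mult_pow_subset: "x \<in> I \<Longrightarrow> (\<otimes>) x ` ideal_pow R I n \<subseteq> ideal_pow R I (Suc n)"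
  using mult_mem_ideal_pow_Suc[OF _ _ I_ideal] by blast

lemma length_mult_pow:
  "regular x \<Longrightarrow> ideal_length R ((\<otimes>) x ` ideal_pow R I n) (ideal_pow R I n)
    = ideal_length R ((\<otimes>) x ` carrier R) (carrier R)"
  using ideal_length_mult_self[OF _ ideal_pow_ideal[OF I_ideal] pow_finite] .

lemma hilbert_le_length:
  assumes "x \<in> I" "regular x"
  shows "hilbert n \<le> ideal_length R ((\<otimes>) x ` carrier R) (carrier R)"
  unfolding length_mult_pow[OF assms(2), of n, symmetric]
  using image_mult_pow_subset[OF assms(1)] by (intro ideal_length_mono) auto

text \<open>\<open>horner_value_stable\<close> is used with w = 1, c = k = L and J = I^(L+2). The
  factor I^(L+1) / I^(L+2) has length at most L because of y, and the outcome x I^L + I^(L+2) =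
  I^(L+1) loses its second summand by Nakayama.\<close>

lemma principal_reduction:
  assumes L: "ideal_length R ((\<otimes>) y ` carrier R) (carrier R) \<le> enat L"
    and T: "finite T" "T \<subseteq> carrier R" "L * length as + 1 \<le> card T"
    and diff: "\<And>u v. u \<in> T \<Longrightarrow> v \<in> T \<Longrightarrow> u \<noteq> v \<Longrightarrow> u \<ominus> v \<notin> \<mm>"
  shows "\<exists>x\<in>I. (\<otimes>) x ` ideal_pow R I L = ideal_pow R I (Suc L)"
proof -
  let ?J = "ideal_pow R I (Suc (Suc L))"
  have J: "ideal ?J R" using I_ideal by (rule ideal_pow_ideal)
  have P: "ideal (ideal_pow R I n) R" for n using I_ideal by (rule ideal_pow_ideal)
  have one: "(\<otimes>) \<one> ` ideal_pow R I n = ideal_pow R I n" for n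
    using ideal_subset_carrier[OF P[of n]] by (force simp: image_iff)
  have sum: "ideal_pow R I (Suc L) <+>\<^bsub>R\<^esub> ?J = ideal_pow R I (Suc L)"
    using ideal_pow_Suc_subset[OF I_ideal, of "Suc L"]
    by (intro antisym ideal_sum_least subset_ideal_sum(1) P J order_refl)
  have "hilbert (Suc L) \<le> enat L"
    using hilbert_le_length[OF y_mem y_regular] L by (rule order_trans)
  then have "ideal_length R ?J ((\<otimes>) \<one> ` ideal_pow R I (Suc L) <+>\<^bsub>R\<^esub> ?J) \<le> enat L"
    unfolding one sum .
  from horner_value_stable[OF gens_carrier J order_refl one_closed T diff this]
  obtain e where e: "e \<in> T" and eq: "(\<otimes>) (\<one> \<otimes> horner as e) ` ideal_pow R I L <+>\<^bsub>R\<^esub> ?J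
      = (\<otimes>) \<one> ` ideal_pow R I (Suc L) <+>\<^bsub>R\<^esub> ?J" by blast
  define x where "x = horner as e"
  have ec: "e \<in> carrier R" using e T by blast
  have xc: "x \<in> carrier R" using gens_carrier ec by (simp add: x_def)
  have xI: "x \<in> I"
  proof -
    have "set bs \<subseteq> I \<Longrightarrow> horner bs e \<in> I" for bs
      by (induction bs) (use I_ideal ec in \<open>simp_all add: additive_subgroup.a_closed
          additive_subgroup.zero_closed ideal.axioms(1) ideal.I_l_closed\<close>)
    then show ?thesis unfolding x_def using genideal_self[OF gens_carrier] .
  qed
  let ?N = "(\<otimes>) x ` ideal_pow R I L"
  have N: "ideal ?N R" using P xc by (rule ideal_image_mult)
  have eq': "?N <+>\<^bsub>R\<^esub> ?J = ideal_pow R I (Suc L)"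
    using eq xc unfolding one sum x_def by simp
  obtain A where A: "A \<subseteq> carrier R" "finite A" "ideal_pow R I (Suc L) = Idl A"
    using ideal_pow_fin_gen[OF gens_carrier] by blast
  have "?J \<subseteq> \<mm> \<cdot> (Idl A)"
    unfolding ideal_pow_Suc[of I "Suc L"] A(3)
    using ideal_prod_commute[OF I_ideal P[of "Suc L"]] ideal_prod_mono[OF I_subset order_refl]
    unfolding A(3) by metis
  then have "A \<subseteq> ?N <+>\<^bsub>R\<^esub> \<mm> \<cdot> (Idl A)"
    using genideal_self[OF A(1)] eq' ideal_sum_mono[OF order_refl, of ?J "\<mm> \<cdot> (Idl A)" ?N]
    unfolding A(3) by blast
  then have "A \<subseteq> ?N" by (rule nakayama[OF A(2,1) N])
  then have "ideal_pow R I (Suc L) \<subseteq> ?N" unfolding A(3) by (intro genideal_minimal N)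
  then show ?thesis using image_mult_pow_subset[OF xI] xI by blast
qed

lemma hilbert_of_reduction:
  assumes xI: "x \<in> I" and p: "(\<otimes>) x ` ideal_pow R I p = ideal_pow R I (Suc p)"
  shows "\<exists>e. (\<forall>n. hilbert n \<le> enat e) \<and> (\<forall>n\<ge>p. hilbert n = enat e)
    \<and> (\<forall>n. hilbert n = enat e \<longrightarrow> hilbert (Suc n) = enat e)"
proof -
  have P: "ideal (ideal_pow R I n) R" for n using I_ideal by (rule ideal_pow_ideal)
  have xc: "x \<in> carrier R" using I_ideal xI by (rule ideal.Icarr)
  \<comment> \<open>Regularity of x comes from y: the power y^(p+1) lies in I^(p+1) = x I^p, and a
    factor of a regular element is regular.\<close>
  have "y [^] Suc p \<in> ideal_pow R I (Suc p)" using y_mem I_ideal by (rule pow_mem_ideal_pow)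
  then obtain z where z: "z \<in> ideal_pow R I p" "y [^] Suc p = x \<otimes> z" unfolding p[symmetric] by blast
  have x: "regular x"
    using regular_pow[OF y_regular, of "Suc p"] xc ideal.Icarr[OF P z(1)] unfolding z(2) by (rule regular_factor)
  \<comment> \<open>The ideal xR contains x I^p = I^(p+1), which has finite colength, so R / xR has
    a finite length e.\<close>
  have "ideal_length R ((\<otimes>) x ` carrier R) (carrier R) \<le> ideal_length R (ideal_pow R I (Suc p)) (carrier R)"
    unfolding p[symmetric] using ideal_subset_carrier[OF P] by (intro ideal_length_mono image_mono order_refl)
  then obtain e where e: "ideal_length R ((\<otimes>) x ` carrier R) (carrier R) = enat e"
    using pow_finite[of "Suc p"] by (metis enat_ord_simps(5) not_infinity_eq)
  have le: "hilbert n \<le> enat e" for n using hilbert_le_length[OF xI x] e by simp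
  have eq: "hilbert n = enat e \<longleftrightarrow> (\<otimes>) x ` ideal_pow R I n = ideal_pow R I (Suc n)" for n
  proof -
    have "ideal_length R ((\<otimes>) x ` ideal_pow R I n) (ideal_pow R I n)
       = ideal_length R ((\<otimes>) x ` ideal_pow R I n) (ideal_pow R I (Suc n)) + hilbert n"
      using image_mult_pow_subset[OF xI] ideal_pow_Suc_subset[OF I_ideal]
      by (intro ideal_length_add ideal_image_mult P xc)
    then have s: "enat e = ideal_length R ((\<otimes>) x ` ideal_pow R I n) (ideal_pow R I (Suc n)) + hilbert n"
      unfolding length_mult_pow[OF x] e .
    have "hilbert n = enat e \<longleftrightarrow> ideal_length R ((\<otimes>) x ` ideal_pow R I n) (ideal_pow R I (Suc n)) = 0"
      using s by (cases "hilbert n"; cases "ideal_length R ((\<otimes>) x ` ideal_pow R I n) (ideal_pow R I (Suc n))")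
        (auto simp: zero_enat_def)
    then show ?thesis
      using ideal_length_eq_0_iff[OF ideal_image_mult[OF P xc] P image_mult_pow_subset[OF xI]] by simp
  qed
  have step: "(\<otimes>) x ` ideal_pow R I (Suc n) = ideal_pow R I (Suc (Suc n))"
    if n: "(\<otimes>) x ` ideal_pow R I n = ideal_pow R I (Suc n)" for n
  proof (rule antisym[OF image_mult_pow_subset[OF xI]])
    have "u \<otimes> v \<in> (\<otimes>) x ` ideal_pow R I (Suc n)" if u: "u \<in> ideal_pow R I (Suc n)" and v: "v \<in> I" for u v
    proof -
      obtain t where t: "t \<in> ideal_pow R I n" "u = x \<otimes> t" using u n by blast
      have "u \<otimes> v = x \<otimes> (t \<otimes> v)"
        using t xc ideal.Icarr[OF P t(1)] ideal.Icarr[OF I_ideal v] by (simp add: m_assoc)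
      moreover have "t \<otimes> v \<in> ideal_pow R I (Suc n)"
        unfolding ideal_pow_Suc using t v by (intro ideal_prod.prod)
      ultimately show ?thesis by blast
    qed
    then show "ideal_pow R I (Suc (Suc n)) \<subseteq> (\<otimes>) x ` ideal_pow R I (Suc n)"
      unfolding ideal_pow_Suc[of I "Suc n"] by (intro ideal_prod_least ideal_image_mult P xc)
  qed
  have "(\<otimes>) x ` ideal_pow R I n = ideal_pow R I (Suc n)" if "p \<le> n" for n
    using that
  proof (induction rule: dec_induct)
    case base
    show ?case by (rule p)
  next
    case (step n)
    then show ?case using \<open>\<And>n. (\<otimes>) x ` ideal_pow R I n = ideal_pow R I (Suc n) \<Longrightarrow> _\<close> by blast
  qed
  then have "\<forall>n\<ge>p. hilbert n = enat e" unfolding eq by blast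
  moreover have "\<forall>n. hilbert n = enat e \<longrightarrow> hilbert (Suc n) = enat e" unfolding eq using step by blast
  ultimately show ?thesis using le by blast
qed

end

section \<open>Enlarging the residue field\<close>

context local_cring
begin

lemma max_ideal_carrier: "a \<in> \<mm> \<Longrightarrow> a \<in> carrier R"
  using max_ideal by (rule ideal.Icarr)

lemma max_ideal_closed:
  "a \<in> \<mm> \<Longrightarrow> b \<in> \<mm> \<Longrightarrow> a \<oplus> b \<in> \<mm>"
  "a \<in> \<mm> \<Longrightarrow> b \<in> \<mm> \<Longrightarrow> a \<ominus> b \<in> \<mm>"
  "a \<in> \<mm> \<Longrightarrow> r \<in> carrier R \<Longrightarrow> r \<otimes> a \<in> \<mm>"
  using max_ideal ideal_diff_closed ideal.I_l_closed
  by (auto intro: additive_subgroup.a_closed[OF ideal.axioms(1)])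

lemma max_ideal_prime:
  assumes "a \<in> carrier R" "b \<in> carrier R" "a \<otimes> b \<in> \<mm>" "a \<notin> \<mm>"
  shows "b \<in> \<mm>"
proof -
  have a: "a \<in> Units R" using assms by (simp add: Units_if_notin)
  then have "inv a \<otimes> (a \<otimes> b) \<in> \<mm>" using a by (intro max_ideal_closed(3)[OF assms(3)]) auto
  then show ?thesis using a assms by (metis Units_closed Units_inv_closed Units_l_inv l_one m_assoc)
qed

text \<open>Over a finite residue field the map \<open>t \<mapsto> t\<^sup>2 + t\<close> is not injective, hence not surjective.\<close>

lemma exists_irreducible_quadratic:
  assumes T: "finite T" "T \<subseteq> carrier R"
    and diff: "\<And>u v. u \<in> T \<Longrightarrow> v \<in> T \<Longrightarrow> u \<noteq> v \<Longrightarrow> u \<ominus> v \<notin> \<mm>"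
    and rep: "\<And>z. z \<in> carrier R \<Longrightarrow> \<exists>e\<in>T. z \<ominus> e \<in> \<mm>"
  shows "\<exists>c\<in>carrier R. \<forall>t\<in>carrier R. t \<otimes> t \<oplus> t \<ominus> c \<notin> \<mm>"
proof (rule ccontr)
  assume "\<not> ?thesis"
  then have root: "\<exists>t\<in>carrier R. t \<otimes> t \<oplus> t \<ominus> c \<in> \<mm>" if "c \<in> carrier R" for c using that by blast
  have "\<exists>e\<in>T. e \<otimes> e \<oplus> e \<ominus> c \<in> \<mm>" if "c \<in> T" for c
  proof -
    have c: "c \<in> carrier R" using that T by blast
    then obtain t where t: "t \<in> carrier R" "t \<otimes> t \<oplus> t \<ominus> c \<in> \<mm>" using root by blast
    then obtain e where e: "e \<in> T" "t \<ominus> e \<in> \<mm>" using rep by blast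
    then have ec: "e \<in> carrier R" using T by blast
    \<comment> \<open>The product equals (t^2 + t) - (e^2 + e), so the root t may be replaced by its
      representative e in T.\<close>
    have "(t \<oplus> e \<oplus> \<one>) \<otimes> (t \<ominus> e) \<in> \<mm>" using ec t by (intro max_ideal_closed(3)[OF e(2)]) auto
    then have "(t \<otimes> t \<oplus> t \<ominus> c) \<ominus> (t \<oplus> e \<oplus> \<one>) \<otimes> (t \<ominus> e) \<in> \<mm>"
      by (rule max_ideal_closed(2)[OF t(2)])
    moreover have "(t \<otimes> t \<oplus> t \<ominus> c) \<ominus> (t \<oplus> e \<oplus> \<one>) \<otimes> (t \<ominus> e) = e \<otimes> e \<oplus> e \<ominus> c"
      using t(1) ec c by algebra
    ultimately show ?thesis using e by auto
  qed
  \<comment> \<open>Modulo \<open>\<mm>\<close>, g is a right inverse of t -> t^2 + t on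
    representatives; it is therefore injective on the finite set T, hence onto.\<close>
  then obtain g where g: "\<And>c. c \<in> T \<Longrightarrow> g c \<in> T" "\<And>c. c \<in> T \<Longrightarrow> g c \<otimes> g c \<oplus> g c \<ominus> c \<in> \<mm>" by metis
  have eq: "c = d" if c: "c \<in> T" and d: "d \<in> T" and cd: "c \<ominus> d \<in> \<mm>" for c d using that diff by blast
  have "inj_on g T"
  proof (rule inj_onI)
    fix c d assume c: "c \<in> T" and d: "d \<in> T" and gcd: "g c = g d"
    have cc: "c \<in> carrier R" "d \<in> carrier R" "g d \<in> carrier R" using c d g T by auto
    have "(g d \<otimes> g d \<oplus> g d \<ominus> d) \<ominus> (g d \<otimes> g d \<oplus> g d \<ominus> c) \<in> \<mm>"
      using g(2)[OF c] g(2)[OF d] unfolding gcd by (rule max_ideal_closed(2)[rotated])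
    moreover have "(g d \<otimes> g d \<oplus> g d \<ominus> d) \<ominus> (g d \<otimes> g d \<oplus> g d \<ominus> c) = c \<ominus> d"
      using cc by algebra
    ultimately show "c = d" using eq c d by simp
  qed
  then have surj: "g ` T = T" using T g(1) by (intro endo_inj_surj) auto
  \<comment> \<open>e and f represent 0 and -1, the two zeros of t^2 + t. As values of g they are
    attached to c = e^2 + e = 0 and d = f^2 + f = 0 modulo \<open>\<mm>\<close>; so c = d, e = f,
    and 1 = 0 - (-1) lies in \<open>\<mm>\<close>.\<close>
  obtain e f where e: "e \<in> T" "\<zero> \<ominus> e \<in> \<mm>" and f: "f \<in> T" "\<ominus> \<one> \<ominus> f \<in> \<mm>" using rep by (metis a_inv_closed one_closed zero_closed)
  obtain c where c: "c \<in> T" "g c = e" using e surj by (metis imageE)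
  obtain d where d: "d \<in> T" "g d = f" using f surj by (metis imageE)
  have cc: "c \<in> carrier R" "d \<in> carrier R" "e \<in> carrier R" "f \<in> carrier R" using c d e f T by auto
  have "(e \<otimes> e \<oplus> e \<ominus> c) \<ominus> (f \<otimes> f \<oplus> f \<ominus> d) \<in> \<mm>"
    using g(2)[OF c(1)] g(2)[OF d(1)] unfolding c(2) d(2) by (rule max_ideal_closed(2))
  then have "((e \<otimes> e \<oplus> e \<ominus> c) \<ominus> (f \<otimes> f \<oplus> f \<ominus> d)) \<oplus> ((e \<oplus> \<one>) \<otimes> (\<zero> \<ominus> e) \<ominus> f \<otimes> (\<ominus> \<one> \<ominus> f)) \<in> \<mm>"
    using cc by (intro max_ideal_closed(1) max_ideal_closed(2)[OF max_ideal_closed(3)[OF e(2)] max_ideal_closed(3)[OF f(2)]]) auto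
  moreover have "((e \<otimes> e \<oplus> e \<ominus> c) \<ominus> (f \<otimes> f \<oplus> f \<ominus> d)) \<oplus> ((e \<oplus> \<one>) \<otimes> (\<zero> \<ominus> e) \<ominus> f \<otimes> (\<ominus> \<one> \<ominus> f)) = d \<ominus> c"
    using cc by algebra
  ultimately have "d = c" using eq c d by simp
  then have "e = f" using c d by simp
  then have "(\<zero> \<ominus> e) \<ominus> (\<ominus> \<one> \<ominus> e) \<in> \<mm>" using max_ideal_closed(2)[OF e(2) f(2)] by simp
  moreover have "(\<zero> \<ominus> e) \<ominus> (\<ominus> \<one> \<ominus> e) = \<one>" using cc by algebra
  ultimately show False using one_notin by simp
qed

text \<open>M / N is generated by a and killed by \<open>\<mm>\<close>, so it is a quotient of the
  residue field: an element n + a r outside N has r a unit, and any ideal above N containing it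
  contains a.\<close>

lemma ideal_length_le_1:
  assumes N: "ideal N R" and M: "ideal M R" and NM: "N \<subseteq> M" and a: "a \<in> M"
    and gen: "M \<subseteq> N <+>\<^bsub>R\<^esub> (\<otimes>) a ` carrier R" and ma: "\<And>u. u \<in> \<mm> \<Longrightarrow> a \<otimes> u \<in> N"
  shows "ideal_length R N M \<le> 1"
proof (rule ccontr)
  assume "\<not> ?thesis"
  then have "enat (Suc (Suc 0)) \<le> ideal_length R N M"
    by (metis eSuc_enat ileI1 one_eSuc one_enat_def zero_enat_def not_le)
  then obtain P where P: "ideal_chain R N M (Suc (Suc 0)) P" using le_ideal_length_iff[OF N NM] by blast
  have P1: "ideal (P 1) R" "N \<subseteq> P 0" "P 0 \<subset> P 1" "P 1 \<subset> P 2" "P 1 \<subseteq> M" "P 2 \<subseteq> M"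
    using P by (auto simp: ideal_chain_def numeral_2_eq_2)
  then obtain z where z: "z \<in> P 1" "z \<notin> N" by blast
  then obtain n r where n: "n \<in> N" and r: "r \<in> carrier R" and zn: "z = n \<oplus> a \<otimes> r"
    using P1 gen unfolding set_add_def' by blast
  have c: "a \<in> carrier R" "n \<in> carrier R" using ideal.Icarr[OF M a] ideal.Icarr[OF N n] by auto
  have "r \<notin> \<mm>"
    using z(2) ma n additive_subgroup.a_closed[OF ideal.axioms(1)[OF N]] unfolding zn by blast
  then have ru: "r \<in> Units R" using r by (simp add: Units_if_notin)
  have "z \<ominus> n \<in> P 1" using z n P1 by (intro ideal_diff_closed) auto
  moreover have "z \<ominus> n = a \<otimes> r" unfolding zn using c r by algebra
  ultimately have "a \<otimes> r \<otimes> inv r \<in> P 1" using P1(1) ru by (simp add: ideal.I_r_closed)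
  moreover have "a \<otimes> r \<otimes> inv r = a" using c r ru by (simp add: m_assoc)
  ultimately have "a \<in> P 1" by simp
  then have "N <+>\<^bsub>R\<^esub> (\<otimes>) a ` carrier R \<subseteq> P 1"
    using P1 ideal.I_r_closed[OF P1(1)] by (intro ideal_sum_least) auto
  then show False using gen P1 by blast
qed

text \<open>Any element of M outside N generates M over N. If a u were outside N for some u in
  \<open>\<mm>\<close>, then a would lie in N + a u R, and the one-generator Nakayama argument would
  put a into N.\<close>

lemma ideal_length_eq_1E:
  assumes N: "ideal N R" and M: "ideal M R" and NM: "N \<subseteq> M" and len: "ideal_length R N M = 1"
  obtains a where "a \<in> M" "a \<notin> N" "M \<subseteq> N <+>\<^bsub>R\<^esub> (\<otimes>) a ` carrier R" "\<And>u. u \<in> \<mm> \<Longrightarrow> a \<otimes> u \<in> N"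
proof -
  have simple: "P = M" if P: "ideal P R" "N \<subset> P" "P \<subseteq> M" for P
  proof (rule ccontr)
    assume "P \<noteq> M"
    then have "ideal_length R N P + 1 \<le> ideal_length R N M"
      using P N M by (intro add_le_ideal_length_psubset) auto
    moreover have "ideal_length R N N + 1 \<le> ideal_length R N P"
      using P N by (intro add_le_ideal_length_psubset) auto
    ultimately show False unfolding len by (cases "ideal_length R N P") (auto simp: one_enat_def)
  qed
  have "N \<noteq> M" using len by auto
  then obtain a where a: "a \<in> M" "a \<notin> N" using NM by blast
  have ac: "a \<in> carrier R" using ideal.Icarr[OF M a(1)] .
  let ?P = "\<lambda>b. N <+>\<^bsub>R\<^esub> (\<otimes>) b ` carrier R"
  have P: "ideal (?P b) R" "N \<subseteq> ?P b" "b \<in> ?P b" "?P b \<subseteq> M" if b: "b \<in> M" for b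
  proof -
    have bc: "b \<in> carrier R" using ideal.Icarr[OF M b] .
    have B: "ideal ((\<otimes>) b ` carrier R) R" using bc by (simp add: ideal_image_mult oneideal)
    show "ideal (?P b) R" using N B by (rule add_ideals)
    show "N \<subseteq> ?P b" using N B by (rule subset_ideal_sum(1))
    have "b \<in> (\<otimes>) b ` carrier R" using bc by (metis image_eqI one_closed r_one)
    then show "b \<in> ?P b" using subset_ideal_sum(2)[OF N B] by blast
    show "?P b \<subseteq> M" using ideal.I_r_closed[OF M b] NM by (intro ideal_sum_least M) auto
  qed
  have "M \<subseteq> ?P a" using simple[of "?P a"] P[OF a(1)] a by blast
  moreover have "a \<otimes> u \<in> N" if u: "u \<in> \<mm>" for u
  proof (rule ccontr)
    assume nN: "a \<otimes> u \<notin> N"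
    have uc: "u \<in> carrier R" using u by (rule max_ideal_carrier)
    have au: "a \<otimes> u \<in> M" using M a(1) uc by (rule ideal.I_r_closed)
    have "?P (a \<otimes> u) = M" using simple[of "?P (a \<otimes> u)"] P[OF au] nN by blast
    then obtain n r where n: "n \<in> N" and r: "r \<in> carrier R" and an: "a = n \<oplus> a \<otimes> u \<otimes> r"
      using a(1) unfolding set_add_def' by blast
    have nc: "n \<in> carrier R" using ideal.Icarr[OF N n] .
    have "(n \<oplus> a \<otimes> u \<otimes> r) \<ominus> a \<otimes> (r \<otimes> u) = n" using nc r uc ac by algebra
    moreover have "a \<ominus> a \<otimes> (r \<otimes> u) = (n \<oplus> a \<otimes> u \<otimes> r) \<ominus> a \<otimes> (r \<otimes> u)"
      using an by (rule arg_cong[where f = "\<lambda>b. b \<ominus> a \<otimes> (r \<otimes> u)"])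
    ultimately have "a \<ominus> a \<otimes> (r \<otimes> u) \<in> N" using n by simp
    then show False using mem_if_diff_mult_mem[OF N ac max_ideal_closed(3)[OF u r]] a(2) by blast
  qed
  ultimately show ?thesis using a that by blast
qed

end

text \<open>The extension \<open>R[t] / (t\<^sup>2 + t - c)\<close>, where \<open>\<delta> (a, b)\<close> encodes \<open>a + b t\<close>. The encoding keeps
  the type of the elements fixed, so that the construction can be iterated.\<close>

definition quadratic_extension ::
    "('a, 'b) ring_scheme \<Rightarrow> ('a \<times> 'a \<Rightarrow> 'a) \<Rightarrow> 'a \<Rightarrow> ('a, 'b) ring_scheme" where
  "quadratic_extension R \<delta> c = R\<lparr>
     carrier := \<delta> ` (carrier R \<times> carrier R),
     mult := (\<lambda>p q. case (inv_into UNIV \<delta> p, inv_into UNIV \<delta> q) of ((a, b), (a', b')) \<Rightarrow>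
       \<delta> (a \<otimes>\<^bsub>R\<^esub> a' \<oplus>\<^bsub>R\<^esub> c \<otimes>\<^bsub>R\<^esub> (b \<otimes>\<^bsub>R\<^esub> b'),
          a \<otimes>\<^bsub>R\<^esub> b' \<oplus>\<^bsub>R\<^esub> b \<otimes>\<^bsub>R\<^esub> a' \<ominus>\<^bsub>R\<^esub> b \<otimes>\<^bsub>R\<^esub> b')),
     one := \<delta> (\<one>\<^bsub>R\<^esub>, \<zero>\<^bsub>R\<^esub>),
     zero := \<delta> (\<zero>\<^bsub>R\<^esub>, \<zero>\<^bsub>R\<^esub>),
     add := (\<lambda>p q. case (inv_into UNIV \<delta> p, inv_into UNIV \<delta> q) of ((a, b), (a', b')) \<Rightarrow>
       \<delta> (a \<oplus>\<^bsub>R\<^esub> a', b \<oplus>\<^bsub>R\<^esub> b'))\<rparr>"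

text \<open>\<open>no_root\<close> says that t^2 + t - c has no zero in the residue field. In degree
  two this is irreducibility, and it makes the extension local with maximal ideal generated by
  \<open>\<mm>\<close>.\<close>

locale quadratic_ext = local_cring R \<mm> for R (structure) and \<mm> +
  fixes \<delta> :: "'a \<times> 'a \<Rightarrow> 'a" and c :: 'a
  assumes inj: "inj \<delta>" and c: "c \<in> carrier R"
    and no_root: "t \<in> carrier R \<Longrightarrow> t \<otimes> t \<oplus> t \<ominus> c \<notin> \<mm>"
begin

definition "S = quadratic_extension R \<delta> c"

lemma S_simps:
  "carrier S = \<delta> ` (carrier R \<times> carrier R)"
  "\<one>\<^bsub>S\<^esub> = \<delta> (\<one>, \<zero>)"
  "\<zero>\<^bsub>S\<^esub> = \<delta> (\<zero>, \<zero>)"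
  "\<delta> (a, b) \<oplus>\<^bsub>S\<^esub> \<delta> (a', b') = \<delta> (a \<oplus> a', b \<oplus> b')"
  "\<delta> (a, b) \<otimes>\<^bsub>S\<^esub> \<delta> (a', b') = \<delta> (a \<otimes> a' \<oplus> c \<otimes> (b \<otimes> b'), a \<otimes> b' \<oplus> b \<otimes> a' \<ominus> b \<otimes> b')"
  using inj by (simp_all add: S_def quadratic_extension_def)

lemma \<delta>_eq_iff [simp]: "\<delta> p = \<delta> q \<longleftrightarrow> p = q"
  using inj by (simp add: inj_eq)

lemma \<delta>_mem_image_iff [simp]: "\<delta> p \<in> \<delta> ` A \<longleftrightarrow> p \<in> A"
  using inj by (rule inj_image_mem_iff)

lemma S_cring: "cring S"
proof (rule cringI)
  show "abelian_group S"
  proof (rule abelian_groupI)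
    fix x assume "x \<in> carrier S"
    then obtain a b where x: "x = \<delta> (a, b)" "a \<in> carrier R" "b \<in> carrier R" by (auto simp: S_simps)
    then have "\<delta> (\<ominus> a, \<ominus> b) \<in> carrier S" "\<delta> (\<ominus> a, \<ominus> b) \<oplus>\<^bsub>S\<^esub> x = \<zero>\<^bsub>S\<^esub>"
      by (simp_all add: S_simps l_neg)
    then show "\<exists>y\<in>carrier S. y \<oplus>\<^bsub>S\<^esub> x = \<zero>\<^bsub>S\<^esub>" by blast
  qed (auto simp: S_simps a_ac)
  show "comm_monoid S"
  proof (rule comm_monoidI)
    fix x y assume "x \<in> carrier S" "y \<in> carrier S"
    then obtain a b a' b' where x: "x = \<delta> (a, b)" "a \<in> carrier R" "b \<in> carrier R"
      and y: "y = \<delta> (a', b')" "a' \<in> carrier R" "b' \<in> carrier R" by (auto simp: S_simps)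
    show "x \<otimes>\<^bsub>S\<^esub> y \<in> carrier S" using x y c by (simp add: S_simps)
    have "a \<otimes> b' \<oplus> b \<otimes> a' \<ominus> b \<otimes> b' = a' \<otimes> b \<oplus> b' \<otimes> a \<ominus> b' \<otimes> b"
      "a \<otimes> a' \<oplus> c \<otimes> (b \<otimes> b') = a' \<otimes> a \<oplus> c \<otimes> (b' \<otimes> b)"
      using x(2,3) y(2,3) c by algebra+
    then show "x \<otimes>\<^bsub>S\<^esub> y = y \<otimes>\<^bsub>S\<^esub> x" by (simp add: x y S_simps)
    fix z assume "z \<in> carrier S"
    then obtain a'' b'' where z: "z = \<delta> (a'', b'')" "a'' \<in> carrier R" "b'' \<in> carrier R" by (auto simp: S_simps)
    have "(a \<otimes> a' \<oplus> c \<otimes> (b \<otimes> b')) \<otimes> a'' \<oplus> c \<otimes> ((a \<otimes> b' \<oplus> b \<otimes> a' \<ominus> b \<otimes> b') \<otimes> b'')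
      = a \<otimes> (a' \<otimes> a'' \<oplus> c \<otimes> (b' \<otimes> b'')) \<oplus> c \<otimes> (b \<otimes> (a' \<otimes> b'' \<oplus> b' \<otimes> a'' \<ominus> b' \<otimes> b''))"
      using x(2,3) y(2,3) z(2,3) c by algebra
    moreover have "(a \<otimes> a' \<oplus> c \<otimes> (b \<otimes> b')) \<otimes> b'' \<oplus> (a \<otimes> b' \<oplus> b \<otimes> a' \<ominus> b \<otimes> b') \<otimes> a''
        \<ominus> (a \<otimes> b' \<oplus> b \<otimes> a' \<ominus> b \<otimes> b') \<otimes> b''
      = a \<otimes> (a' \<otimes> b'' \<oplus> b' \<otimes> a'' \<ominus> b' \<otimes> b'') \<oplus> b \<otimes> (a' \<otimes> a'' \<oplus> c \<otimes> (b' \<otimes> b''))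
        \<ominus> b \<otimes> (a' \<otimes> b'' \<oplus> b' \<otimes> a'' \<ominus> b' \<otimes> b'')"
      using x(2,3) y(2,3) z(2,3) c by algebra
    ultimately show "(x \<otimes>\<^bsub>S\<^esub> y) \<otimes>\<^bsub>S\<^esub> z = x \<otimes>\<^bsub>S\<^esub> (y \<otimes>\<^bsub>S\<^esub> z)" by (simp add: x y z S_simps)
  next
    fix x assume "x \<in> carrier S"
    then obtain a b where x: "x = \<delta> (a, b)" "a \<in> carrier R" "b \<in> carrier R" by (auto simp: S_simps)
    have "\<one> \<otimes> a \<oplus> c \<otimes> (\<zero> \<otimes> b) = a" "\<one> \<otimes> b \<oplus> \<zero> \<otimes> a \<ominus> \<zero> \<otimes> b = b"
      using x c by algebra+
    then show "\<one>\<^bsub>S\<^esub> \<otimes>\<^bsub>S\<^esub> x = x" by (simp add: x(1) S_simps)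
  qed (simp add: S_simps)
  fix x y z assume "x \<in> carrier S" "y \<in> carrier S" "z \<in> carrier S"
  then obtain a b a' b' a'' b'' where x: "x = \<delta> (a, b)" "a \<in> carrier R" "b \<in> carrier R"
    and y: "y = \<delta> (a', b')" "a' \<in> carrier R" "b' \<in> carrier R"
    and z: "z = \<delta> (a'', b'')" "a'' \<in> carrier R" "b'' \<in> carrier R" by (auto simp: S_simps)
  have "(a \<oplus> a') \<otimes> a'' \<oplus> c \<otimes> ((b \<oplus> b') \<otimes> b'')
      = (a \<otimes> a'' \<oplus> c \<otimes> (b \<otimes> b'')) \<oplus> (a' \<otimes> a'' \<oplus> c \<otimes> (b' \<otimes> b''))"
    "(a \<oplus> a') \<otimes> b'' \<oplus> (b \<oplus> b') \<otimes> a'' \<ominus> (b \<oplus> b') \<otimes> b''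
      = (a \<otimes> b'' \<oplus> b \<otimes> a'' \<ominus> b \<otimes> b'') \<oplus> (a' \<otimes> b'' \<oplus> b' \<otimes> a'' \<ominus> b' \<otimes> b'')"
    using x(2,3) y(2,3) z(2,3) c by algebra+
  then show "(x \<oplus>\<^bsub>S\<^esub> y) \<otimes>\<^bsub>S\<^esub> z = x \<otimes>\<^bsub>S\<^esub> z \<oplus>\<^bsub>S\<^esub> y \<otimes>\<^bsub>S\<^esub> z" by (simp add: x y z S_simps)
qed

sublocale S: cring S
  by (rule S_cring)

lemma S_uminus: 
  assumes "a \<in> carrier R" "b \<in> carrier R"
  shows "\<ominus>\<^bsub>S\<^esub> \<delta> (a, b) = \<delta> (\<ominus> a, \<ominus> b)"
  by (rule S.minus_equality) (use assms in \<open>simp_all add: S_simps l_neg\<close>)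

lemma S_minus: 
  assumes "a \<in> carrier R" "b \<in> carrier R" "a' \<in> carrier R" "b' \<in> carrier R"
  shows "\<delta> (a, b) \<ominus>\<^bsub>S\<^esub> \<delta> (a', b') = \<delta> (a \<ominus> a', b \<ominus> b')"
  using assms by (simp add: a_minus_def S_uminus S_simps)

text \<open>For an ideal K this is K + K t, the ideal of \<open>S\<close> generated by K.\<close>

definition ext :: "'a set \<Rightarrow> 'a set" where
  "ext K = \<delta> ` (K \<times> K)"

lemma ext_mem_iff [simp]: "\<delta> (a, b) \<in> ext K \<longleftrightarrow> a \<in> K \<and> b \<in> K"
  by (simp add: ext_def)

lemma extE:
  assumes "x \<in> ext K" obtains a b where "x = \<delta> (a, b)" "a \<in> K" "b \<in> K"
  using assms by (auto simp: ext_def)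

lemma ext_carrier: "ext (carrier R) = carrier S"
  by (simp add: ext_def S_simps)

lemma ext_subset_iff: "ext K \<subseteq> ext J \<longleftrightarrow> K \<subseteq> J"
proof
  assume s: "ext K \<subseteq> ext J"
  show "K \<subseteq> J"
  proof
    fix a assume "a \<in> K"
    then have "\<delta> (a, a) \<in> ext K" by simp
    then have "\<delta> (a, a) \<in> ext J" using s by (rule rev_subsetD)
    then show "a \<in> J" by simp
  qed
qed (auto simp: ext_def)

lemma ext_ideal:
  assumes K: "ideal K R" shows "ideal (ext K) S"
proof (rule idealI)
  show "ring S" by (rule S.ring_axioms)
  have Kc: "a \<in> carrier R" if "a \<in> K" for a using ideal.Icarr[OF K that] .
  have K0: "\<zero> \<in> K" using K by (simp add: additive_subgroup.zero_closed ideal.axioms(1))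
  have Ka: "a \<oplus> b \<in> K" if "a \<in> K" "b \<in> K" for a b
    using K that by (simp add: additive_subgroup.a_closed ideal.axioms(1))
  have Kn: "\<ominus> a \<in> K" if "a \<in> K" for a
    using K that by (simp add: additive_subgroup.a_inv_closed ideal.axioms(1))
  have Km: "r \<otimes> a \<in> K" if "a \<in> K" "r \<in> carrier R" for a r
    using K that by (simp add: ideal.I_l_closed)
  show "subgroup (ext K) (add_monoid S)"
  proof (rule group.subgroupI[OF S.add.is_group], goal_cases)
    case 1 show ?case using Kc by (auto simp: ext_def S_simps)
  next
    case 2 show ?case using K0 by (auto simp: ext_def)
  next
    case (3 x)
    then show ?case using Kc Kn by (auto elim!: extE simp: S_uminus simp flip: a_inv_def)
  next
    case (4 x y)
    then show ?case using Ka by (auto elim!: extE simp: S_simps)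
  qed
  fix x r assume x: "x \<in> ext K" and r: "r \<in> carrier S"
  obtain a b where ab: "x = \<delta> (a, b)" "a \<in> K" "b \<in> K" using x by (rule extE)
  obtain u v where uv: "r = \<delta> (u, v)" "u \<in> carrier R" "v \<in> carrier R" using r by (auto simp: S_simps)
  show rx: "r \<otimes>\<^bsub>S\<^esub> x \<in> ext K"
    using ab uv c Ka Kn Km Kc by (simp add: S_simps a_minus_def)
  have "x \<in> carrier S" using ab Kc by (simp add: S_simps)
  then show "x \<otimes>\<^bsub>S\<^esub> r \<in> ext K" using rx r by (simp add: S.m_comm)
qed

text \<open>This is the contraction of X along a -> a + 0 t. Together with
  \<open>ext_subsetI\<close> it reduces inclusions of extended ideals in ideals of \<open>S\<close>
  to inclusions in R.\<close>

lemma vimage_embed_ideal: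
  assumes X: "ideal X S"
  shows "ideal {u \<in> carrier R. \<delta> (u, \<zero>) \<in> X} R"
proof (rule idealI)
  show "ring R" by (rule ring_axioms)
  interpret X: ideal X S by (rule X)
  show "subgroup {u \<in> carrier R. \<delta> (u, \<zero>) \<in> X} (add_monoid R)"
  proof (rule group.subgroupI[OF add.is_group], goal_cases)
    case 2
    have "\<delta> (\<zero>, \<zero>) \<in> X" using X.zero_closed by (simp add: S_simps)
    then show ?case by auto
  next
    case (3 a)
    then have "\<ominus>\<^bsub>S\<^esub> \<delta> (a, \<zero>) \<in> X" by simp
    then show ?case using 3 by (simp add: S_uminus flip: a_inv_def)
  next
    case (4 a b)
    then have "\<delta> (a, \<zero>) \<oplus>\<^bsub>S\<^esub> \<delta> (b, \<zero>) \<in> X" by simp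
    then show ?case using 4 by (simp add: S_simps)
  qed auto
  fix a r assume a: "a \<in> {u \<in> carrier R. \<delta> (u, \<zero>) \<in> X}" and r: "r \<in> carrier R"
  have "\<delta> (r, \<zero>) \<otimes>\<^bsub>S\<^esub> \<delta> (a, \<zero>) \<in> X" using a r by (intro X.I_l_closed) (auto simp: S_simps)
  moreover have "\<delta> (r, \<zero>) \<otimes>\<^bsub>S\<^esub> \<delta> (a, \<zero>) = \<delta> (r \<otimes> a, \<zero>)"
    using a r c by (simp add: S_simps a_minus_def)
  ultimately show "r \<otimes> a \<in> {u \<in> carrier R. \<delta> (u, \<zero>) \<in> X}" using a r by simp
  then show "a \<otimes> r \<in> {u \<in> carrier R. \<delta> (u, \<zero>) \<in> X}" using a r by (simp add: m_comm)
qed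

lemma ext_subsetI:
  assumes X: "ideal X S" and K: "K \<subseteq> {u \<in> carrier R. \<delta> (u, \<zero>) \<in> X}"
  shows "ext K \<subseteq> X"
proof
  interpret X: ideal X S by (rule X)
  fix x assume "x \<in> ext K"
  then obtain a b where x: "x = \<delta> (a, b)" "a \<in> K" "b \<in> K" by (rule extE)
  then have ab: "a \<in> carrier R" "b \<in> carrier R" "\<delta> (a, \<zero>) \<in> X" "\<delta> (b, \<zero>) \<in> X" using K by auto
  have "\<delta> (\<zero>, \<one>) \<otimes>\<^bsub>S\<^esub> \<delta> (b, \<zero>) \<in> X" using ab by (intro X.I_l_closed) (auto simp: S_simps)
  then have "\<delta> (a, \<zero>) \<oplus>\<^bsub>S\<^esub> \<delta> (\<zero>, \<one>) \<otimes>\<^bsub>S\<^esub> \<delta> (b, \<zero>) \<in> X" using ab by (intro X.a_closed)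
  moreover have "\<delta> (a, \<zero>) \<oplus>\<^bsub>S\<^esub> \<delta> (\<zero>, \<one>) \<otimes>\<^bsub>S\<^esub> \<delta> (b, \<zero>) = x"
    using ab c by (simp add: x(1) S_simps a_minus_def)
  ultimately show "x \<in> X" by simp
qed

lemma ext_genideal:
  assumes A: "A \<subseteq> carrier R"
  shows "ext (Idl A) = Idl\<^bsub>S\<^esub> ((\<lambda>a. \<delta> (a, \<zero>)) ` A)"
proof
  let ?G = "(\<lambda>a. \<delta> (a, \<zero>)) ` A"
  have G: "?G \<subseteq> carrier S" using A by (auto simp: S_simps)
  have X: "ideal (Idl\<^bsub>S\<^esub> ?G) S" using G by (rule S.genideal_ideal)
  have "A \<subseteq> {u \<in> carrier R. \<delta> (u, \<zero>) \<in> Idl\<^bsub>S\<^esub> ?G}" using A S.genideal_self[OF G] by auto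
  then have "Idl A \<subseteq> {u \<in> carrier R. \<delta> (u, \<zero>) \<in> Idl\<^bsub>S\<^esub> ?G}"
    by (intro genideal_minimal vimage_embed_ideal[OF X])
  then show "ext (Idl A) \<subseteq> Idl\<^bsub>S\<^esub> ?G" by (rule ext_subsetI[OF X])
  have "\<zero> \<in> Idl A"
    using genideal_ideal[OF A] by (simp add: additive_subgroup.zero_closed ideal.axioms(1))
  then have "?G \<subseteq> ext (Idl A)" using genideal_self[OF A] by auto
  then show "Idl\<^bsub>S\<^esub> ?G \<subseteq> ext (Idl A)" by (intro S.genideal_minimal ext_ideal genideal_ideal A)
qed

lemma ext_prod:
  assumes K: "ideal K R" and J: "ideal J R"
  shows "ext (K \<cdot> J) = ext K \<cdot>\<^bsub>S\<^esub> ext J"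
proof
  have KJ: "ideal (K \<cdot> J) R" using K J by (rule ideal_prod_is_ideal)
  have X: "ideal (ext K \<cdot>\<^bsub>S\<^esub> ext J) S" using K J by (intro S.ideal_prod_is_ideal ext_ideal)
  have 0: "\<zero> \<in> K" "\<zero> \<in> J" using K J by (simp_all add: additive_subgroup.zero_closed ideal.axioms(1))
  note Kc = ideal.Icarr[OF K] and Jc = ideal.Icarr[OF J]
  have "K \<cdot> J \<subseteq> {u \<in> carrier R. \<delta> (u, \<zero>) \<in> ext K \<cdot>\<^bsub>S\<^esub> ext J}"
  proof (rule ideal_prod_least[OF vimage_embed_ideal[OF X]])
    fix i j assume ij: "i \<in> K" "j \<in> J"
    then have "\<delta> (i, \<zero>) \<otimes>\<^bsub>S\<^esub> \<delta> (j, \<zero>) \<in> ext K \<cdot>\<^bsub>S\<^esub> ext J" using 0 by (intro ideal_prod.prod) auto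
    moreover have "\<delta> (i, \<zero>) \<otimes>\<^bsub>S\<^esub> \<delta> (j, \<zero>) = \<delta> (i \<otimes> j, \<zero>)"
      using ij c Kc Jc by (simp add: S_simps a_minus_def)
    ultimately show "i \<otimes> j \<in> {u \<in> carrier R. \<delta> (u, \<zero>) \<in> ext K \<cdot>\<^bsub>S\<^esub> ext J}" using ij Kc Jc by simp
  qed
  then show "ext (K \<cdot> J) \<subseteq> ext K \<cdot>\<^bsub>S\<^esub> ext J" by (rule ext_subsetI[OF X])
  show "ext K \<cdot>\<^bsub>S\<^esub> ext J \<subseteq> ext (K \<cdot> J)"
  proof (rule S.ideal_prod_least[OF ext_ideal[OF KJ]])
    fix x y assume "x \<in> ext K" "y \<in> ext J"
    then obtain a b u v where xy: "x = \<delta> (a, b)" "y = \<delta> (u, v)" "a \<in> K" "b \<in> K" "u \<in> J" "v \<in> J"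
      by (metis extE)
    then have p: "a \<otimes> u \<in> K \<cdot> J" "a \<otimes> v \<in> K \<cdot> J" "b \<otimes> u \<in> K \<cdot> J" "b \<otimes> v \<in> K \<cdot> J"
      by (auto intro: ideal_prod.prod)
    then have "c \<otimes> (b \<otimes> v) \<in> K \<cdot> J" using KJ c by (simp add: ideal.I_l_closed)
    then show "x \<otimes>\<^bsub>S\<^esub> y \<in> ext (K \<cdot> J)"
      unfolding xy(1,2) S_simps ext_mem_iff using p KJ
      by (intro conjI ideal_diff_closed) (auto intro: additive_subgroup.a_closed[OF ideal.axioms(1)])
  qed
qed

lemma ext_pow:
  assumes K: "ideal K R" shows "ext (ideal_pow R K n) = ideal_pow S (ext K) n"
  using ideal_pow_ideal[OF K] by (induction n) (simp_all add: ext_carrier ext_prod K)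

lemma ext_image_mult:
  assumes a: "a \<in> carrier R" and K: "K \<subseteq> carrier R"
  shows "ext ((\<otimes>) a ` K) = (\<otimes>\<^bsub>S\<^esub>) (\<delta> (a, \<zero>)) ` ext K"
proof -
  have "\<delta> (a, \<zero>) \<otimes>\<^bsub>S\<^esub> \<delta> (u, v) = \<delta> (a \<otimes> u, a \<otimes> v)" if "u \<in> K" "v \<in> K" for u v
  proof -
    have "u \<in> carrier R" "v \<in> carrier R" using that K by auto
    then show ?thesis using a c by (simp add: S_simps a_minus_def)
  qed
  then have "(\<otimes>\<^bsub>S\<^esub>) (\<delta> (a, \<zero>)) ` ext K = (\<lambda>(u, v). \<delta> (a \<otimes> u, a \<otimes> v)) ` (K \<times> K)"
    by (force simp: ext_def)
  also have "\<dots> = ext ((\<otimes>) a ` K)" by (force simp: ext_def)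
  finally show ?thesis by simp
qed

lemma S_local: "local_cring S (ext \<mm>)"
proof (intro local_cring.intro local_cring_axioms.intro)
  show "cring S" by (rule S_cring)
  show "ideal (ext \<mm>) S" using max_ideal by (rule ext_ideal)
  show "\<one>\<^bsub>S\<^esub> \<notin> ext \<mm>" using one_notin by (simp add: S_simps)
  fix x assume "x \<in> carrier S" and x_notin: "x \<notin> ext \<mm>"
  then obtain a b where x: "x = \<delta> (a, b)" and ab: "a \<in> carrier R" "b \<in> carrier R" by (auto simp: S_simps)
  \<comment> \<open>The norm of a + b t: the conjugate of t is -1 - t, and a^2 - a b - c b^2 = (a +
    b t) ((a - b) - b t). The inverse \<open>?y\<close> below is the conjugate divided by this
    norm.\<close>
  let ?N = "a \<otimes> a \<ominus> a \<otimes> b \<ominus> c \<otimes> (b \<otimes> b)"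
  have Nc: "?N \<in> carrier R" using ab c by simp
  have "?N \<notin> \<mm>"
  proof
    assume N: "?N \<in> \<mm>"
    show False
    proof (cases "b \<in> \<mm>")
      case True
      then have "?N \<oplus> (a \<oplus> c \<otimes> b) \<otimes> b \<in> \<mm>"
        using ab c by (intro max_ideal_closed(1)[OF N] max_ideal_closed(3)) auto
      moreover have "?N \<oplus> (a \<oplus> c \<otimes> b) \<otimes> b = a \<otimes> a" using ab c by algebra
      ultimately have "a \<in> \<mm>" using max_ideal_prime ab by metis
      then show False using x_notin True by (simp add: x)
    next
      case False
      then have bu: "b \<in> Units R" using ab by (simp add: Units_if_notin)
      \<comment> \<open>Dividing the norm by b^2 gives the value of t^2 + t - c at t = -a / b, which
        \<open>no_root\<close> keeps out of \<open>\<mm>\<close>.\<close>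
      let ?t = "\<ominus> (a \<otimes> inv b)"
      have ib: "inv b \<in> carrier R" "b \<otimes> inv b = \<one>" using bu by simp_all
      have "(inv b \<otimes> inv b) \<otimes> ?N \<in> \<mm>" using ib by (intro max_ideal_closed(3)[OF N]) auto
      moreover have "(inv b \<otimes> inv b) \<otimes> ?N
          = (a \<otimes> inv b) \<otimes> (a \<otimes> inv b) \<ominus> (a \<otimes> inv b) \<otimes> (b \<otimes> inv b) \<ominus> c \<otimes> ((b \<otimes> inv b) \<otimes> (b \<otimes> inv b))"
        using ab c ib(1) by algebra
      moreover have "\<dots> = ?t \<otimes> ?t \<oplus> ?t \<ominus> c" unfolding ib(2) using ab c ib(1) by algebra
      ultimately show False using no_root[of ?t] ab ib by simp
    qed
  qed
  then have Nu: "?N \<in> Units R" using Nc by (simp add: Units_if_notin)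
  let ?i = "inv ?N"
  have i: "?i \<in> carrier R" "?N \<otimes> ?i = \<one>" using Nu by simp_all
  let ?y = "\<delta> (?i \<otimes> (a \<ominus> b), \<ominus> (?i \<otimes> b))"
  have y: "?y \<in> carrier S" using i ab by (simp add: S_simps)
  have "a \<otimes> (?i \<otimes> (a \<ominus> b)) \<oplus> c \<otimes> (b \<otimes> \<ominus> (?i \<otimes> b)) = ?N \<otimes> ?i"
    "a \<otimes> \<ominus> (?i \<otimes> b) \<oplus> b \<otimes> (?i \<otimes> (a \<ominus> b)) \<ominus> b \<otimes> \<ominus> (?i \<otimes> b) = \<zero>"
    using i(1) ab c by algebra+
  then have xy: "x \<otimes>\<^bsub>S\<^esub> ?y = \<one>\<^bsub>S\<^esub>" unfolding x S_simps i(2) by simp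
  moreover have "?y \<otimes>\<^bsub>S\<^esub> x = \<one>\<^bsub>S\<^esub>" using xy y \<open>x \<in> carrier S\<close> by (simp add: S.m_comm)
  ultimately show "x \<in> Units S" using \<open>x \<in> carrier S\<close> y unfolding Units_def by blast
qed

sublocale S: local_cring S "ext \<mm>"
  by (rule S_local)

text \<open>M / K is generated by some a and killed by \<open>\<mm>\<close>. The same a, embedded in
  \<open>S\<close>, generates the extended factor, which is killed by \<open>ext \<mm>\<close>, the
  maximal ideal of \<open>S\<close>.\<close>

lemma ext_ideal_length_1:
  assumes K: "ideal K R" and M: "ideal M R" and KM: "K \<subseteq> M" and len: "ideal_length R K M = 1"
  shows "ideal_length S (ext K) (ext M) = 1"
proof (rule antisym)
  obtain a where a: "a \<in> M" "a \<notin> K" "M \<subseteq> K <+>\<^bsub>R\<^esub> (\<otimes>) a ` carrier R"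
    "\<And>u. u \<in> \<mm> \<Longrightarrow> a \<otimes> u \<in> K" using ideal_length_eq_1E[OF K M KM len] by blast
  have ac: "a \<in> carrier R" using ideal.Icarr[OF M a(1)] .
  have 0: "\<zero> \<in> M" using M by (simp add: additive_subgroup.zero_closed ideal.axioms(1))
  have mult: "\<delta> (a, \<zero>) \<otimes>\<^bsub>S\<^esub> \<delta> (u, v) = \<delta> (a \<otimes> u, a \<otimes> v)" if "u \<in> carrier R" "v \<in> carrier R" for u v
    using that ac c by (simp add: S_simps a_minus_def)
  show "ideal_length S (ext K) (ext M) \<le> 1"
  proof (rule S.ideal_length_le_1)
    show "ideal (ext K) S" "ideal (ext M) S" using K M by (simp_all add: ext_ideal)
    show "ext K \<subseteq> ext M" using KM by (simp add: ext_subset_iff)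
    show "\<delta> (a, \<zero>) \<in> ext M" using a 0 by simp
    show "ext M \<subseteq> ext K <+>\<^bsub>S\<^esub> (\<otimes>\<^bsub>S\<^esub>) (\<delta> (a, \<zero>)) ` carrier S"
    proof
      fix x assume "x \<in> ext M"
      then obtain p q where x: "x = \<delta> (p, q)" and pq: "p \<in> M" "q \<in> M" by (rule extE)
      obtain n r where n: "n \<in> K" "r \<in> carrier R" "p = n \<oplus> a \<otimes> r"
        using a(3) pq(1) unfolding set_add_def' by blast
      obtain n' r' where n': "n' \<in> K" "r' \<in> carrier R" "q = n' \<oplus> a \<otimes> r'"
        using a(3) pq(2) unfolding set_add_def' by blast
      have "x = \<delta> (n, n') \<oplus>\<^bsub>S\<^esub> \<delta> (a, \<zero>) \<otimes>\<^bsub>S\<^esub> \<delta> (r, r')"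
        unfolding mult[OF n(2) n'(2)] by (simp add: x n(3) n'(3) S_simps)
      moreover have "\<delta> (n, n') \<in> ext K" "\<delta> (r, r') \<in> carrier S" using n n' by (simp_all add: S_simps)
      ultimately show "x \<in> ext K <+>\<^bsub>S\<^esub> (\<otimes>\<^bsub>S\<^esub>) (\<delta> (a, \<zero>)) ` carrier S"
        using S.mem_set_addI by blast
    qed
    fix x assume "x \<in> ext \<mm>"
    then obtain u v where x: "x = \<delta> (u, v)" "u \<in> \<mm>" "v \<in> \<mm>" by (rule extE)
    then show "\<delta> (a, \<zero>) \<otimes>\<^bsub>S\<^esub> x \<in> ext K"
      using mult[OF max_ideal_carrier max_ideal_carrier] a(4) by simp
  qed
  have "K \<noteq> M" using a by blast
  then have "ext K \<subset> ext M" using KM by (simp add: psubset_eq ext_subset_iff) (metis ext_subset_iff order_refl antisym)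
  then have "ideal_length S (ext K) (ext K) + 1 \<le> ideal_length S (ext K) (ext M)"
    using K M by (intro add_le_ideal_length_psubset ext_ideal order_refl)
  then show "1 \<le> ideal_length S (ext K) (ext M)" by simp
qed

text \<open>The lowest step of a chain of maximal length is split off; it has length one and is
  handled by \<open>ext_ideal_length_1\<close>.\<close>

lemma ext_ideal_length:
  assumes "ideal K R" "ideal J R" "K \<subseteq> J" "ideal_length R K J = enat k"
  shows "ideal_length S (ext K) (ext J) = enat k"
  using assms
proof (induction k arbitrary: K)
  case 0
  then have "K = J" using ideal_length_eq_0_iff by (metis zero_enat_def)
  then show ?case by (simp add: zero_enat_def)
next
  case (Suc k)
  obtain N where N: "ideal_chain R K J (Suc k) N"
    using le_ideal_length_iff[OF Suc.prems(1,3)] Suc.prems(4) by (metis order_refl)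
  let ?M = "N (Suc 0)"
  have M: "ideal ?M R" "K \<subset> ?M" "?M \<subseteq> J"
    using N unfolding ideal_chain_def by (auto dest: spec[of _ 0])
  have "ideal_chain R ?M J k (\<lambda>i. N (Suc i))"
    unfolding ideal_chain_def
  proof (intro conjI allI impI)
    fix i assume i: "i \<le> k"
    then show "ideal (N (Suc i)) R" "N (Suc i) \<subseteq> J" using N by (simp_all add: ideal_chain_def)
    show "?M \<subseteq> N (Suc i)" using i
    proof (induction i)
      case (Suc i)
      then have "N (Suc i) \<subset> N (Suc (Suc i))" using N by (simp add: ideal_chain_def)
      then show ?case using Suc by simp
    qed simp
  next
    fix i assume "i < k"
    then show "N (Suc i) \<subset> N (Suc (Suc i))" using N by (simp add: ideal_chain_def)
  qed
  then have k: "enat k \<le> ideal_length R ?M J" by (rule ideal_length_geI)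
  have "ideal_length R K K + 1 \<le> ideal_length R K ?M"
    using Suc.prems M by (intro add_le_ideal_length_psubset) auto
  then have one: "1 \<le> ideal_length R K ?M" by simp
  have "ideal_length R K J = ideal_length R K ?M + ideal_length R ?M J"
    using Suc.prems M by (intro ideal_length_add) auto
  then have sum: "enat (Suc k) = ideal_length R K ?M + ideal_length R ?M J" using Suc.prems by simp
  \<comment> \<open>The lower bounds 1 and k already add up to the total Suc k, so both are
    attained.\<close>
  have len: "ideal_length R K ?M = 1" "ideal_length R ?M J = enat k"
    using sum k one
    by (cases "ideal_length R K ?M"; cases "ideal_length R ?M J"; simp add: one_enat_def)+
  have "ideal_length S (ext K) (ext J)
      = ideal_length S (ext K) (ext ?M) + ideal_length S (ext ?M) (ext J)"
    using Suc.prems M by (intro S.ideal_length_add ext_ideal) (auto simp: ext_subset_iff)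
  also have "\<dots> = 1 + enat k"
    using ext_ideal_length_1[OF Suc.prems(1) M(1) _ len(1)] Suc.IH[OF M(1) Suc.prems(2) M(3) len(2)] M
    by auto
  finally show ?case by (simp add: one_enat_def)
qed

lemma card_ext: "finite T \<Longrightarrow> card (ext T) = card T * card T"
  unfolding ext_def using inj by (subst card_image) (auto intro: inj_on_subset simp: card_cartesian_product)

end

section \<open>Transport of the data to the extension and iteration\<close>

context quadratic_ext
begin

text \<open>The number of generators and the length of R / yR are unchanged, so the number of
  residues demanded by \<open>principal_reduction\<close> does not grow with the extension.\<close>

lemma ext_hilbert_data:
  fixes as :: "'a list"
  assumes "hilbert_data R \<mm> as y"
  defines "as' \<equiv> map (\<lambda>a. \<delta> (a, \<zero>)) as"
  shows "hilbert_data S (ext \<mm>) as' (\<delta> (y, \<zero>))"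
    and "ideal_length S ((\<otimes>\<^bsub>S\<^esub>) (\<delta> (y, \<zero>)) ` carrier S) (carrier S)
      = ideal_length R ((\<otimes>) y ` carrier R) (carrier R)"
    and "ideal_length S (ideal_pow S (Idl\<^bsub>S\<^esub> (set as')) (Suc n)) (ideal_pow S (Idl\<^bsub>S\<^esub> (set as')) n)
      = ideal_length R (ideal_pow R (Idl (set as)) (Suc n)) (ideal_pow R (Idl (set as)) n)"
proof -
  interpret H: hilbert_data R \<mm> as y by fact
  have yc: "y \<in> carrier R" using H.y_regular by (rule regular_closed)
  have I: "Idl\<^bsub>S\<^esub> (set as') = ext H.I"
    using ext_genideal[OF H.gens_carrier] by (simp add: as'_def)
  have yS: "(\<otimes>\<^bsub>S\<^esub>) (\<delta> (y, \<zero>)) ` carrier S = ext ((\<otimes>) y ` carrier R)"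
    using ext_image_mult[OF yc order_refl] by (simp add: ext_carrier)
  obtain L where L: "ideal_length R ((\<otimes>) y ` carrier R) (carrier R) = enat L"
    using H.y_finite by auto
  have LS: "ideal_length S ((\<otimes>\<^bsub>S\<^esub>) (\<delta> (y, \<zero>)) ` carrier S) (carrier S) = enat L"
    unfolding yS unfolding ext_carrier[symmetric]
    using L yc by (intro ext_ideal_length ideal_image_mult oneideal) auto
  then show "ideal_length S ((\<otimes>\<^bsub>S\<^esub>) (\<delta> (y, \<zero>)) ` carrier S) (carrier S)
      = ideal_length R ((\<otimes>) y ` carrier R) (carrier R)" using L by simp
  show "hilbert_data S (ext \<mm>) as' (\<delta> (y, \<zero>))"
  proof (intro hilbert_data.intro S_local hilbert_data_axioms.intro)
    have "\<zero> \<in> \<mm>" using max_ideal by (simp add: additive_subgroup.zero_closed ideal.axioms(1))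
    then show "set as' \<subseteq> ext \<mm>" using H.gens by (auto simp: as'_def)
    have "\<zero> \<in> H.I" using H.I_ideal by (simp add: additive_subgroup.zero_closed ideal.axioms(1))
    then show "\<delta> (y, \<zero>) \<in> Idl\<^bsub>S\<^esub> (set as')" using H.y_mem by (simp add: I)
    show "S.regular (\<delta> (y, \<zero>))"
    proof (rule S.regularI)
      show "\<delta> (y, \<zero>) \<in> carrier S" using yc by (simp add: S_simps)
      fix z assume "z \<in> carrier S" and z0: "\<delta> (y, \<zero>) \<otimes>\<^bsub>S\<^esub> z = \<zero>\<^bsub>S\<^esub>"
      then obtain u v where z: "z = \<delta> (u, v)" "u \<in> carrier R" "v \<in> carrier R" by (auto simp: S_simps)
      have "y \<otimes> u = \<zero>" "y \<otimes> v = \<zero>"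
        using z0 z(2,3) yc c unfolding z(1) by (simp_all add: S_simps a_minus_def)
      then show "z = \<zero>\<^bsub>S\<^esub>" using z regularD[OF H.y_regular] by (simp add: S_simps)
    qed
    show "ideal_length S ((\<otimes>\<^bsub>S\<^esub>) (\<delta> (y, \<zero>)) ` carrier S) (carrier S) \<noteq> \<infinity>"
      unfolding LS by simp
  qed
  have "H.hilbert n \<le> enat L"
    using H.hilbert_le_length[OF H.y_mem H.y_regular] L by simp
  then obtain h where h: "H.hilbert n = enat h" by (cases "H.hilbert n") auto
  have "ideal_length S (ext (ideal_pow R H.I (Suc n))) (ext (ideal_pow R H.I n)) = enat h"
    by (intro ext_ideal_length ideal_pow_ideal H.I_ideal ideal_pow_Suc_subset h)
  then show "ideal_length S (ideal_pow S (Idl\<^bsub>S\<^esub> (set as')) (Suc n)) (ideal_pow S (Idl\<^bsub>S\<^esub> (set as')) n)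
      = H.hilbert n"
    unfolding I ext_pow[OF H.I_ideal] using h by simp
qed

end

text \<open>One element is added to T at a time. If T misses a residue class, a member of it is
  added; otherwise the residue field is finite, and after a quadratic extension T is replaced by a
  set of elements a + b t with a and b in T.\<close>

lemma exists_extension_with_large_residue_field:
  fixes R :: "('a, 'b) ring_scheme"
  assumes data: "hilbert_data R \<mm> as y" and inf: "infinite (UNIV :: 'a set)"
  shows "\<exists>(S :: ('a, 'b) ring_scheme) \<nn> bs z T. hilbert_data S \<nn> bs z \<and> length bs = length as
    \<and> ideal_length S ((\<otimes>\<^bsub>S\<^esub>) z ` carrier S) (carrier S) = ideal_length R ((\<otimes>\<^bsub>R\<^esub>) y ` carrier R) (carrier R)
    \<and> (\<forall>n. ideal_length S (ideal_pow S (Idl\<^bsub>S\<^esub> (set bs)) (Suc n)) (ideal_pow S (Idl\<^bsub>S\<^esub> (set bs)) n)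
         = ideal_length R (ideal_pow R (Idl\<^bsub>R\<^esub> (set as)) (Suc n)) (ideal_pow R (Idl\<^bsub>R\<^esub> (set as)) n))
    \<and> finite T \<and> T \<subseteq> carrier S \<and> card T = N + 2 \<and> (\<forall>u\<in>T. \<forall>v\<in>T. u \<noteq> v \<longrightarrow> u \<ominus>\<^bsub>S\<^esub> v \<notin> \<nn>)"
    (is "\<exists>S \<nn> bs z T. ?P S \<nn> bs z T N")
proof (induction N)
  case 0
  interpret R: hilbert_data R \<mm> as y by fact
  have ne: "\<zero>\<^bsub>R\<^esub> \<noteq> \<one>\<^bsub>R\<^esub>"
    using R.one_notin R.max_ideal by (metis additive_subgroup.zero_closed ideal.axioms(1))
  have "\<one>\<^bsub>R\<^esub> \<ominus>\<^bsub>R\<^esub> \<zero>\<^bsub>R\<^esub> = \<one>\<^bsub>R\<^esub>" by (simp add: a_minus_def)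
  moreover have "\<zero>\<^bsub>R\<^esub> \<ominus>\<^bsub>R\<^esub> \<one>\<^bsub>R\<^esub> \<notin> \<mm>"
  proof
    assume "\<zero>\<^bsub>R\<^esub> \<ominus>\<^bsub>R\<^esub> \<one>\<^bsub>R\<^esub> \<in> \<mm>"
    then have "\<ominus>\<^bsub>R\<^esub> (\<zero>\<^bsub>R\<^esub> \<ominus>\<^bsub>R\<^esub> \<one>\<^bsub>R\<^esub>) \<in> \<mm>"
      using R.max_ideal by (simp add: additive_subgroup.a_inv_closed ideal.axioms(1))
    then show False using R.one_notin by (simp add: a_minus_def)
  qed
  \<comment> \<open>The count starts at the two residues 0 and 1, which ensures that squaring the
    cardinality strictly increases it.\<close>
  ultimately have "?P R \<mm> as y {\<zero>\<^bsub>R\<^esub>, \<one>\<^bsub>R\<^esub>} 0"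
    using data ne R.one_notin by simp
  then show ?case by blast
next
  case (Suc N)
  then obtain S \<nn> bs z T where S: "hilbert_data (S :: ('a, 'b) ring_scheme) \<nn> bs z" and P: "?P S \<nn> bs z T N" by blast
  interpret S: hilbert_data S \<nn> bs z by (rule S)
  show ?case
  proof (cases "\<exists>z\<in>carrier S. \<forall>e\<in>T. z \<ominus>\<^bsub>S\<^esub> e \<notin> \<nn>")
    case True
    then obtain w where w: "w \<in> carrier S" "\<And>e. e \<in> T \<Longrightarrow> w \<ominus>\<^bsub>S\<^esub> e \<notin> \<nn>" by blast
    have T: "T \<subseteq> carrier S" using P by blast
    have "w \<ominus>\<^bsub>S\<^esub> w \<in> \<nn>"
      using w(1) S.max_ideal by (simp add: a_minus_def S.r_neg additive_subgroup.zero_closed ideal.axioms(1))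
    then have wT: "w \<notin> T" using w(2) by blast
    have w': "e \<ominus>\<^bsub>S\<^esub> w \<notin> \<nn>" if e: "e \<in> T" for e
    proof
      assume "e \<ominus>\<^bsub>S\<^esub> w \<in> \<nn>"
      then have "\<ominus>\<^bsub>S\<^esub> (e \<ominus>\<^bsub>S\<^esub> w) \<in> \<nn>"
        using S.max_ideal by (simp add: additive_subgroup.a_inv_closed ideal.axioms(1))
      moreover have "e \<in> carrier S" using e T by blast
      then have "\<ominus>\<^bsub>S\<^esub> (e \<ominus>\<^bsub>S\<^esub> w) = w \<ominus>\<^bsub>S\<^esub> e" using w(1) by algebra
      ultimately show False using w(2)[OF e] by simp
    qed
    have "?P S \<nn> bs z (insert w T) (Suc N)" using P w w' wT by auto
    then show ?thesis by blast
  next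
    case False
    have "\<exists>c\<in>carrier S. \<forall>t\<in>carrier S. t \<otimes>\<^bsub>S\<^esub> t \<oplus>\<^bsub>S\<^esub> t \<ominus>\<^bsub>S\<^esub> c \<notin> \<nn>"
      using P False by (intro S.exists_irreducible_quadratic[of T]) auto
    then obtain c where c: "c \<in> carrier S" "\<And>t. t \<in> carrier S \<Longrightarrow> t \<otimes>\<^bsub>S\<^esub> t \<oplus>\<^bsub>S\<^esub> t \<ominus>\<^bsub>S\<^esub> c \<notin> \<nn>" by blast
    \<comment> \<open>An infinite type is in bijection with its square, so the extension can live on
      the same type.\<close>
    obtain \<delta> :: "'a \<times> 'a \<Rightarrow> 'a" where "bij_betw \<delta> (UNIV \<times> UNIV) UNIV"
      using card_of_Times_same_infinite[OF inf] card_of_ordIso by blast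
    then have "inj \<delta>" by (simp add: bij_betw_def)
    then interpret Q: quadratic_ext S \<nn> \<delta> c
      by unfold_locales (use c in auto)
    let ?bs = "map (\<lambda>a. \<delta> (a, \<zero>\<^bsub>S\<^esub>)) bs"
    have T: "finite T" "T \<subseteq> carrier S" "card T = N + 2"
      "\<And>u v. u \<in> T \<Longrightarrow> v \<in> T \<Longrightarrow> u \<noteq> v \<Longrightarrow> u \<ominus>\<^bsub>S\<^esub> v \<notin> \<nn>" using P by auto
    have "Suc N + 2 \<le> (N + 2) * (N + 2)" by simp
    also have "\<dots> = card (Q.ext T)" using T by (simp add: Q.card_ext)
    finally obtain U where U: "U \<subseteq> Q.ext T" "card U = Suc N + 2" by (metis obtain_subset_with_card_n)
    have extT: "finite (Q.ext T)" "Q.ext T \<subseteq> carrier Q.S"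
      using T unfolding Q.ext_carrier[symmetric] Q.ext_subset_iff by (simp_all add: Q.ext_def)
    have diff: "u \<ominus>\<^bsub>Q.S\<^esub> v \<notin> Q.ext \<nn>" if "u \<in> U" "v \<in> U" "u \<noteq> v" for u v
    proof -
      have uvT: "u \<in> Q.ext T" "v \<in> Q.ext T" using that U by auto
      obtain a b where ab: "u = \<delta> (a, b)" "a \<in> T" "b \<in> T" using uvT(1) by (rule Q.extE)
      obtain a' b' where ab': "v = \<delta> (a', b')" "a' \<in> T" "b' \<in> T" using uvT(2) by (rule Q.extE)
      have "u \<ominus>\<^bsub>Q.S\<^esub> v = \<delta> (a \<ominus>\<^bsub>S\<^esub> a', b \<ominus>\<^bsub>S\<^esub> b')" using T(2) ab ab' by (simp add: Q.S_minus subset_iff)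
      moreover have "a \<noteq> a' \<or> b \<noteq> b'" using that ab(1) ab'(1) by blast
      ultimately show ?thesis using T(4)[of a a'] T(4)[of b b'] ab ab' by auto
    qed
    have "?P Q.S (Q.ext \<nn>) ?bs (\<delta> (z, \<zero>\<^bsub>S\<^esub>)) U (Suc N)"
    proof (intro conjI)
      show "hilbert_data Q.S (Q.ext \<nn>) ?bs (\<delta> (z, \<zero>\<^bsub>S\<^esub>))" by (rule Q.ext_hilbert_data(1)[OF S])
      show "length ?bs = length as" using P by simp
      show "ideal_length Q.S ((\<otimes>\<^bsub>Q.S\<^esub>) (\<delta> (z, \<zero>\<^bsub>S\<^esub>)) ` carrier Q.S) (carrier Q.S)
          = ideal_length R ((\<otimes>\<^bsub>R\<^esub>) y ` carrier R) (carrier R)"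
        unfolding Q.ext_hilbert_data(2)[OF S] using P by blast
      show "\<forall>n. ideal_length Q.S (ideal_pow Q.S (Idl\<^bsub>Q.S\<^esub> (set ?bs)) (Suc n)) (ideal_pow Q.S (Idl\<^bsub>Q.S\<^esub> (set ?bs)) n)
         = ideal_length R (ideal_pow R (Idl\<^bsub>R\<^esub> (set as)) (Suc n)) (ideal_pow R (Idl\<^bsub>R\<^esub> (set as)) n)"
        unfolding Q.ext_hilbert_data(3)[OF S] using P by blast
      show "finite U" using U(1) extT(1) by (rule finite_subset)
      show "U \<subseteq> carrier Q.S" using U(1) extT(2) by (rule subset_trans)
      show "card U = Suc N + 2" by (rule U(2))
      show "\<forall>u\<in>U. \<forall>v\<in>U. u \<noteq> v \<longrightarrow> u \<ominus>\<^bsub>Q.S\<^esub> v \<notin> Q.ext \<nn>" using diff by blast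
    qed
    then show ?thesis by blast
  qed
qed

text \<open>L and the number of generators are read off from R, and N = L r provides one point more
  than the required L r + 1. The conclusion is proved over the extension and read back, since both
  rings have the same Hilbert function.\<close>

lemma hilbert_function_properties:
  fixes R :: "('a, 'b) ring_scheme"
  assumes data: "hilbert_data R \<mm> as y" and inf: "infinite (UNIV :: 'a set)"
  defines "h \<equiv> \<lambda>n. ideal_length R (ideal_pow R (Idl\<^bsub>R\<^esub> (set as)) (Suc n)) (ideal_pow R (Idl\<^bsub>R\<^esub> (set as)) n)"
  shows "\<exists>e p. (\<forall>n. h n \<le> enat e) \<and> (\<forall>n\<ge>p. h n = enat e) \<and> (\<forall>n. h n = enat e \<longrightarrow> h (Suc n) = enat e)"
proof -
  interpret R: hilbert_data R \<mm> as y by (rule data)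
  obtain L where L: "ideal_length R ((\<otimes>\<^bsub>R\<^esub>) y ` carrier R) (carrier R) = enat L"
    using R.y_finite by auto
  obtain S :: "('a, 'b) ring_scheme" and \<nn> bs z T where S: "hilbert_data S \<nn> bs z"
    and len: "length bs = length as"
    and LS: "ideal_length S ((\<otimes>\<^bsub>S\<^esub>) z ` carrier S) (carrier S) = enat L"
    and hS: "\<And>n. ideal_length S (ideal_pow S (Idl\<^bsub>S\<^esub> (set bs)) (Suc n)) (ideal_pow S (Idl\<^bsub>S\<^esub> (set bs)) n) = h n"
    and T: "finite T" "T \<subseteq> carrier S" "card T = L * length as + 2"
      "\<And>u v. u \<in> T \<Longrightarrow> v \<in> T \<Longrightarrow> u \<noteq> v \<Longrightarrow> u \<ominus>\<^bsub>S\<^esub> v \<notin> \<nn>"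
    using exists_extension_with_large_residue_field[OF data inf, of "L * length as"] L
    unfolding h_def by metis
  interpret S: hilbert_data S \<nn> bs z by (rule S)
  obtain x where "x \<in> S.I" "(\<otimes>\<^bsub>S\<^esub>) x ` ideal_pow S S.I L = ideal_pow S S.I (Suc L)"
    using S.principal_reduction[of L T] LS T len by auto
  from S.hilbert_of_reduction[OF this] show ?thesis unfolding hS by blast
qed

section \<open>One-dimensional Cohen--Macaulay rings\<close>

context noetherian_ring
begin

text \<open>In a noetherian ring a nonempty chain of ideals contains its union, so Zorn's lemma
  applies to any nonempty family of ideals.\<close>

lemma exists_maximal_ideal_in:
  assumes F: "\<And>J. J \<in> F \<Longrightarrow> ideal J R" and ne: "F \<noteq> {}"
  shows "\<exists>M\<in>F. \<forall>P\<in>F. M \<subseteq> P \<longrightarrow> P = M"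
proof (rule subset_Zorn)
  fix C assume C: "subset.chain F C"
  show "\<exists>U\<in>F. \<forall>X\<in>C. X \<subseteq> U"
  proof (cases "C = {}")
    case True
    then show ?thesis using ne by auto
  next
    case False
    have CF: "C \<subseteq> F" using C by (simp add: subset_chain_def)
    have "C \<subseteq> {I. ideal I R}" using CF F by blast
    then have "subset.chain {I. ideal I R} C" using C by (simp add: subset_chain_def)
    then have "\<Union>C \<in> C" using ideal_chain_is_trivial False by blast
    then show ?thesis using CF by (meson Union_upper subsetD)
  qed
qed

text \<open>An ideal P maximal among those above J and disjoint from M is prime: if a and b are
  outside P, then P + aR and P + bR meet M, and with a b in P the product of the two common elements
  would lie in both P and M.\<close>

lemma exists_prime_avoiding:
  assumes R: "cring R" and J: "ideal J R" and one: "\<one> \<in> M" and Mc: "M \<subseteq> carrier R"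
    and mult: "\<And>s t. s \<in> M \<Longrightarrow> t \<in> M \<Longrightarrow> s \<otimes> t \<in> M" and disj: "J \<inter> M = {}"
  shows "\<exists>P. primeideal P R \<and> J \<subseteq> P \<and> P \<inter> M = {}"
proof -
  interpret cring R by (rule R)
  let ?F = "{P. ideal P R \<and> J \<subseteq> P \<and> P \<inter> M = {}}"
  have "J \<in> ?F" using J disj by simp
  then have "\<exists>P\<in>?F. \<forall>Q\<in>?F. P \<subseteq> Q \<longrightarrow> Q = P" by (intro exists_maximal_ideal_in) blast+
  then obtain P where "P \<in> ?F" and "\<forall>Q\<in>?F. P \<subseteq> Q \<longrightarrow> Q = P" by (rule bexE)
  then have P: "ideal P R" "J \<subseteq> P" "P \<inter> M = {}"
    and max: "\<And>Q. ideal Q R \<Longrightarrow> J \<subseteq> Q \<Longrightarrow> Q \<inter> M = {} \<Longrightarrow> P \<subseteq> Q \<Longrightarrow> Q = P" by simp_all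
  have meet: "\<exists>p\<in>P. \<exists>r\<in>carrier R. p \<oplus> a \<otimes> r \<in> M" if a: "a \<in> carrier R" "a \<notin> P" for a
  proof -
    let ?A = "(\<otimes>) a ` carrier R"
    have A: "ideal ?A R" using a by (simp add: ideal_image_mult oneideal)
    have "a \<in> ?A" using a(1) by (metis image_eqI one_closed r_one)
    then have "a \<in> P <+>\<^bsub>R\<^esub> ?A" using subset_ideal_sum(2)[OF P(1) A] by blast
    moreover have "P \<subseteq> P <+>\<^bsub>R\<^esub> ?A" by (rule subset_ideal_sum(1)[OF P(1) A])
    ultimately have "(P <+>\<^bsub>R\<^esub> ?A) \<inter> M \<noteq> {}"
      using max[OF add_ideals[OF P(1) A]] a(2) P(2) by blast
    then show ?thesis unfolding set_add_def' by blast
  qed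
  have "primeideal P R"
  proof (rule primeidealI[OF P(1) R])
    show "carrier R \<noteq> P" using one P(3) Mc by blast
    fix a b assume a: "a \<in> carrier R" and b: "b \<in> carrier R" and ab: "a \<otimes> b \<in> P"
    show "a \<in> P \<or> b \<in> P"
    proof (rule ccontr)
      assume "\<not> ?thesis"
      then obtain p r q t where p: "p \<in> P" "r \<in> carrier R" "p \<oplus> a \<otimes> r \<in> M"
        and q: "q \<in> P" "t \<in> carrier R" "q \<oplus> b \<otimes> t \<in> M" using meet a b by metis
      have c: "p \<in> carrier R" "q \<in> carrier R" using ideal.Icarr[OF P(1)] p q by auto
      have "(p \<oplus> a \<otimes> r) \<otimes> (q \<oplus> b \<otimes> t) = (q \<oplus> b \<otimes> t) \<otimes> p \<oplus> ((a \<otimes> r) \<otimes> q \<oplus> (r \<otimes> t) \<otimes> (a \<otimes> b))"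
        using a b p(2) q(2) c by algebra
      also have "\<dots> \<in> P"
        by (intro additive_subgroup.a_closed[OF ideal.axioms(1)[OF P(1)]]
            ideal.I_l_closed[OF P(1) p(1)] ideal.I_l_closed[OF P(1) q(1)] ideal.I_l_closed[OF P(1) ab])
          (use a b p(2) q(2) c in simp_all)
      finally show False using mult[OF p(3) q(3)] P(3) by blast
    qed
  qed
  then show ?thesis using P by blast
qed

end

locale noetherian_local = local_cring R \<mm> + noetherian_ring R for R (structure) and \<mm>
begin

lemma proper_ideal_subset: "ideal P R \<Longrightarrow> P \<noteq> carrier R \<Longrightarrow> P \<subseteq> \<mm>"
proof
  fix a assume P: "ideal P R" "P \<noteq> carrier R" and a: "a \<in> P"
  have ac: "a \<in> carrier R" using P(1) a by (rule ideal.Icarr)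
  show "a \<in> \<mm>"
  proof (rule ccontr)
    assume "a \<notin> \<mm>"
    then have u: "a \<in> Units R" using ac by (simp add: Units_if_notin)
    then have "inv a \<otimes> a \<in> P" using P(1) a by (simp add: ideal.I_l_closed del: Units_l_inv)
    then show False using u P ideal.one_imp_carrier by fastforce
  qed
qed

lemma max_ideal_primeideal: "primeideal \<mm> R"
proof (rule primeidealI[OF max_ideal is_cring])
  show "carrier R \<noteq> \<mm>" using one_notin by blast
  show "a \<in> \<mm> \<or> b \<in> \<mm>" if "a \<in> carrier R" "b \<in> carrier R" "a \<otimes> b \<in> \<mm>" for a b
    using max_ideal_prime[OF that] by blast
qed

text \<open>The multiplicative set \<open>{s y\<^sup>n. s \<notin> P}\<close> avoids \<open>0\<close> because \<open>y\<close> is regular, so there is a prime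
  avoiding it. This prime lies strictly inside \<open>P\<close>, whence \<open>P \<noteq> \<mm>\<close> would give a chain of length 2.\<close>

lemma prime_containing_regular:
  assumes dim: "krull_dim R = 1" and y: "regular y" "y \<in> P" and P: "primeideal P R"
  shows "P = \<mm>"
proof (rule ccontr)
  assume ne: "P \<noteq> \<mm>"
  interpret P: primeideal P R by (rule P)
  have yc: "y \<in> carrier R" using y(1) by (rule regular_closed)
  have "P \<subset> \<mm>" using proper_ideal_subset[OF P.is_ideal P.I_notcarr[symmetric]] ne by blast
  have oneP: "\<one> \<notin> P" using P.one_imp_carrier P.I_notcarr by blast
  define M where "M = {s \<otimes> y [^] n |s (n :: nat). s \<in> carrier R \<and> s \<notin> P}"
  have "\<exists>Q. primeideal Q R \<and> {\<zero>} \<subseteq> Q \<and> Q \<inter> M = {}"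
  proof (rule exists_prime_avoiding[OF is_cring zeroideal])
    have "\<one> = \<one> \<otimes> y [^] (0::nat)" by simp
    then show "\<one> \<in> M" using oneP unfolding M_def by blast
    show "M \<subseteq> carrier R" using yc by (auto simp: M_def)
    show "s \<otimes> t \<in> M" if st: "s \<in> M" "t \<in> M" for s t
    proof -
      obtain a and n :: nat where a: "s = a \<otimes> y [^] n" "a \<in> carrier R" "a \<notin> P"
        using st(1) unfolding M_def by blast
      obtain b and k :: nat where b: "t = b \<otimes> y [^] k" "b \<in> carrier R" "b \<notin> P"
        using st(2) unfolding M_def by blast
      have "s \<otimes> t = (a \<otimes> b) \<otimes> (y [^] n \<otimes> y [^] k)"
        using a b yc by (simp add: m_ac)
      then have "s \<otimes> t = (a \<otimes> b) \<otimes> y [^] (n + k)" using yc by (simp add: nat_pow_mult)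
      moreover have "a \<otimes> b \<notin> P" using P.I_prime a b by blast
      ultimately show ?thesis using a(2) b(2) unfolding M_def by blast
    qed
    show "{\<zero>} \<inter> M = {}"
    proof -
      have False if "s \<in> carrier R" "s \<notin> P" "\<zero> = s \<otimes> y [^] (n::nat)" for s n
      proof -
        have "y [^] n \<otimes> s = \<zero>" using that yc by (simp add: m_comm)
        then have "s = \<zero>" using regularD[OF regular_pow[OF y(1)]] that(1) by blast
        then show False using that(2) P.zero_closed by blast
      qed
      then show ?thesis unfolding M_def by blast
    qed
  qed
  then obtain Q where Q: "primeideal Q R" "Q \<inter> M = {}" by blast
  \<comment> \<open>M contains the complement of P (take n = 0), so Q lies in P; it also contains y
    (take s = 1, n = 1), so the inclusion is strict.\<close>
  have "a \<in> P" if "a \<in> Q" for a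
  proof (rule ccontr)
    assume "a \<notin> P"
    have ac: "a \<in> carrier R" using Q(1) that by (meson ideal.Icarr primeideal.axioms(1))
    then have "a = a \<otimes> y [^] (0::nat)" by simp
    then have "a \<in> M" unfolding M_def using ac \<open>a \<notin> P\<close> by blast
    then show False using Q(2) that by blast
  qed
  moreover have "y \<notin> Q"
  proof -
    have "y = \<one> \<otimes> y [^] (1::nat)" using yc by simp
    then have "y \<in> M" unfolding M_def using oneP by blast
    then show ?thesis using Q(2) by blast
  qed
  ultimately have "Q \<subset> P" using y(2) by blast
  define N where "N i = (if i = 0 then Q else if i = 1 then P else \<mm>)" for i :: nat
  have "(\<forall>i\<le>2. primeideal (N i) R) \<and> (\<forall>i<2. N i \<subset> N (Suc i))"
    using Q(1) P max_ideal_primeideal \<open>Q \<subset> P\<close> \<open>P \<subset> \<mm>\<close>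
    by (simp add: N_def less_Suc_eq numeral_2_eq_2)
  then have "enat 2 \<le> krull_dim R" unfolding krull_dim_def by (intro Sup_upper) blast
  then show False unfolding dim by (simp add: one_enat_def)
qed

text \<open>J is taken maximal among the ideals of finite length over yR. If J were proper, R / J
  would have an associated prime; it contains y, hence is \<open>\<mm>\<close>, and adjoining the
  corresponding element raises the length by at most one, against maximality.\<close>

lemma finite_length_if_primes_maximal:
  assumes y: "y \<in> carrier R" and primes: "\<And>P. primeideal P R \<Longrightarrow> y \<in> P \<Longrightarrow> P = \<mm>"
  shows "ideal_length R ((\<otimes>) y ` carrier R) (carrier R) \<noteq> \<infinity>"
proof -
  let ?Y = "(\<otimes>) y ` carrier R"
  have Y: "ideal ?Y R" using y by (simp add: ideal_image_mult oneideal)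
  let ?F = "{J. ideal J R \<and> ?Y \<subseteq> J \<and> ideal_length R ?Y J \<noteq> \<infinity>}"
  have "?Y \<in> ?F" using Y by (simp add: zero_enat_def)
  then have "\<exists>J\<in>?F. \<forall>P\<in>?F. J \<subseteq> P \<longrightarrow> P = J" by (intro exists_maximal_ideal_in) blast+
  then obtain J where "J \<in> ?F" and "\<forall>P\<in>?F. J \<subseteq> P \<longrightarrow> P = J" by (rule bexE)
  then have J: "ideal J R" "?Y \<subseteq> J" "ideal_length R ?Y J \<noteq> \<infinity>"
    and Jmax: "\<And>P. ideal P R \<Longrightarrow> ?Y \<subseteq> P \<Longrightarrow> ideal_length R ?Y P \<noteq> \<infinity> \<Longrightarrow> J \<subseteq> P \<Longrightarrow> P = J"
    by simp_all
  show ?thesis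
  proof (cases "J = carrier R")
    case False
    let ?C = "\<lambda>a. {z \<in> carrier R. a \<otimes> z \<in> J}"
    let ?G = "?C ` (carrier R - J)"
    \<comment> \<open>A maximal annihilator of a nonzero element of R / J is prime; this is the
      associated prime.\<close>
    have "\<exists>P\<in>?G. \<forall>Q\<in>?G. P \<subseteq> Q \<longrightarrow> Q = P"
      using False ideal_subset_carrier[OF J(1)] ideal_vimage_mult[OF J(1)]
      by (intro exists_maximal_ideal_in) auto
    then obtain P where "P \<in> ?G" and Pmax: "\<forall>Q\<in>?G. P \<subseteq> Q \<longrightarrow> Q = P" by (rule bexE)
    then obtain a where a: "a \<in> carrier R" "a \<notin> J" and P: "P = ?C a" by blast
    have amax: "?C b = ?C a" if "b \<in> carrier R" "b \<notin> J" "?C a \<subseteq> ?C b" for b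
      using Pmax that unfolding P by simp
    have "primeideal (?C a) R"
    proof (rule primeidealI[OF ideal_vimage_mult[OF J(1) a(1)] is_cring])
      have "\<one> \<notin> ?C a" using a by simp
      then show "carrier R \<noteq> ?C a" using one_closed by blast
      fix u v assume u: "u \<in> carrier R" and v: "v \<in> carrier R" and uv: "u \<otimes> v \<in> ?C a"
      show "u \<in> ?C a \<or> v \<in> ?C a"
      proof (rule ccontr)
        assume n: "\<not> ?thesis"
        have "?C a \<subseteq> ?C (a \<otimes> v)"
        proof
          fix z assume z: "z \<in> ?C a"
          then have zc: "z \<in> carrier R" "a \<otimes> z \<in> J" by simp_all
          have "v \<otimes> (a \<otimes> z) \<in> J" using zc(2) v by (rule ideal.I_l_closed[OF J(1)])
          moreover have "v \<otimes> (a \<otimes> z) = a \<otimes> v \<otimes> z" using zc(1) v a(1) by algebra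
          ultimately show "z \<in> ?C (a \<otimes> v)" using zc(1) by simp
        qed
        moreover have "a \<otimes> v \<notin> J" using n v by blast
        ultimately have "?C (a \<otimes> v) = ?C a" using amax a v by blast
        moreover have "a \<otimes> v \<otimes> u = a \<otimes> (u \<otimes> v)" using a(1) u v by algebra
        then have "u \<in> ?C (a \<otimes> v)" using uv u by simp
        ultimately show False using n by simp
      qed
    qed
    moreover have "y \<in> ?C a"
    proof -
      have "a \<otimes> y = y \<otimes> a" using a(1) y by (rule m_comm)
      then have "a \<otimes> y \<in> ?Y" using a(1) by simp
      then show ?thesis using J(2) y by blast
    qed
    ultimately have Ca: "?C a = \<mm>" by (rule primes)
    let ?A = "(\<otimes>) a ` carrier R"
    let ?P = "J <+>\<^bsub>R\<^esub> ?A"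
    have A: "ideal ?A R" using a by (simp add: ideal_image_mult oneideal)
    have P: "ideal ?P R" using J(1) A by (rule add_ideals)
    have JP: "J \<subseteq> ?P" by (rule subset_ideal_sum(1)[OF J(1) A])
    have "a \<in> ?A" using a(1) by (metis image_eqI one_closed r_one)
    then have aP: "a \<in> ?P" using subset_ideal_sum(2)[OF J(1) A] by blast
    have "ideal_length R J ?P \<le> 1"
      using J(1) P JP aP order_refl by (rule ideal_length_le_1) (use Ca in blast)
    moreover have "ideal_length R ?Y ?P = ideal_length R ?Y J + ideal_length R J ?P"
      using Y J P JP by (intro ideal_length_add)
    ultimately have "ideal_length R ?Y ?P \<noteq> \<infinity>"
      using J(3) by (cases "ideal_length R J ?P") (auto simp: one_enat_def)
    then have "?P = J" using Jmax[OF P] J(2) JP by blast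
    then show ?thesis using aP a by blast
  qed (use J in simp)
qed

end

lemma regular_hd_of_regular_sequence:
  fixes R :: "('a, 'b) ring_scheme" (structure)
  assumes R: "cring R" and xs: "regular_sequence R xs" "xs \<noteq> []"
  shows "cring.regular R (hd xs)"
proof -
  interpret cring R by (rule R)
  have "Idl {} \<subseteq> {\<zero>}" by (rule genideal_minimal[OF zeroideal]) simp
  moreover have "\<zero> \<in> Idl {}"
    using genideal_ideal[of "{}"] by (simp add: additive_subgroup.zero_closed ideal.axioms(1))
  ultimately have Idl: "Idl {} = {\<zero>}" by blast
  have hd: "xs ! 0 = hd xs" "hd xs \<in> set xs" "0 < length xs" using xs(2) by (simp_all add: hd_conv_nth)
  show ?thesis
  proof (rule regularI)
    show "hd xs \<in> carrier R" using xs(1) hd unfolding regular_sequence_def by blast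
    fix z assume z: "z \<in> carrier R" "hd xs \<otimes> z = \<zero>"
    \<comment> \<open>At index 0 the regularity condition is taken modulo \<open>Idl {}\<close>, the
      zero ideal.\<close>
    have "xs ! 0 \<otimes> z \<in> Idl (set (take 0 xs)) \<longrightarrow> z \<in> Idl (set (take 0 xs))"
      using xs(1) hd(3) z(1) unfolding regular_sequence_def by blast
    then show "z = \<zero>" using z by (simp add: hd Idl)
  qed
qed

text \<open>Depth one gives a regular x in \<open>\<mm>\<close>. As \<open>\<mm>\<close> is the
  radical of I, some power y of x lies in I, and in dimension one \<open>\<mm>\<close> is the only
  prime containing y, whence R / yR has finite length.\<close>

lemma hilbert_data_if_cohen_macaulay:
  fixes R :: "('a, 'b) ring_scheme" (structure)
  assumes CM: "cohen_macaulay_local R \<mm>" and dim: "krull_dim R = 1" and prim: "primary_to R \<mm> I"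
  shows "\<exists>as y. hilbert_data R \<mm> as y \<and> I = Idl\<^bsub>R\<^esub> (set as)" and "infinite (UNIV :: 'a set)"
proof -
  have loc: "local_ring R \<mm>" and noeth: "noetherian_ring R" and depth: "ring_depth R \<mm> = 1"
    using CM dim by (simp_all add: cohen_macaulay_local_def)
  have R: "cring R" and max: "maximalideal \<mm> R" and uniq: "\<And>J. maximalideal J R \<Longrightarrow> J = \<mm>"
    using loc by (simp_all add: local_ring_def)
  interpret cring R by (rule R)
  interpret N: noetherian_ring R by (rule noeth)
  have m: "ideal \<mm> R" "carrier R \<noteq> \<mm>"
    using max by (auto simp: maximalideal_def maximalideal_axioms_def)
  have "local_cring R \<mm>"
  proof (intro local_cring.intro local_cring_axioms.intro R m)
    show "\<one> \<notin> \<mm>" using m ideal.one_imp_carrier by blast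
    fix a assume a: "a \<in> carrier R" "a \<notin> \<mm>"
    let ?A = "(\<otimes>) a ` carrier R"
    have A: "ideal ?A R" using a by (simp add: ideal_image_mult oneideal)
    have aA: "a \<in> ?A" using a(1) by (metis image_eqI one_closed r_one)
    show "a \<in> Units R"
    proof (rule ccontr)
      assume "a \<notin> Units R"
      then have "\<one> \<notin> ?A" using a(1) m_comm unfolding Units_def by fastforce
      \<comment> \<open>A nonunit a generates a proper ideal. An ideal maximal in \<open>?F\<close>
        is a maximal ideal of R, so it equals \<open>\<mm>\<close> by uniqueness and contains a,
        contrary to the choice of a.\<close>
      let ?F = "{P. ideal P R \<and> ?A \<subseteq> P \<and> \<one> \<notin> P}"
      have "\<exists>P\<in>?F. \<forall>Q\<in>?F. P \<subseteq> Q \<longrightarrow> Q = P"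
        using A \<open>\<one> \<notin> ?A\<close> by (intro N.exists_maximal_ideal_in) auto
      then obtain P where "P \<in> ?F" and "\<forall>Q\<in>?F. P \<subseteq> Q \<longrightarrow> Q = P" by (rule bexE)
      then have P: "ideal P R" "?A \<subseteq> P" "\<one> \<notin> P"
        and Pmax: "\<And>Q. ideal Q R \<Longrightarrow> ?A \<subseteq> Q \<Longrightarrow> \<one> \<notin> Q \<Longrightarrow> P \<subseteq> Q \<Longrightarrow> Q = P" by simp_all
      have "maximalideal P R"
      proof (rule maximalidealI[OF P(1)])
        show "carrier R \<noteq> P" using P(3) by blast
        fix Q assume Q: "ideal Q R" "P \<subseteq> Q" "Q \<subseteq> carrier R"
        then show "Q = P \<or> Q = carrier R"
          using Pmax[of Q] P(2) ideal.one_imp_carrier[OF Q(1)] by blast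
      qed
      then show False using uniq P(2) aA a(2) by blast
    qed
  qed
  then interpret L: noetherian_local R \<mm> by (intro noetherian_local.intro noeth)
  have "\<exists>xs. set xs \<subseteq> \<mm> \<and> regular_sequence R xs \<and> xs \<noteq> []"
  proof (rule ccontr)
    assume "\<not> ?thesis"
    then have "ring_depth R \<mm> \<le> 0"
      unfolding ring_depth_def by (intro Sup_least) (auto simp: zero_enat_def)
    then show False using depth by simp
  qed
  then obtain xs where xs: "set xs \<subseteq> \<mm>" "regular_sequence R xs" "xs \<noteq> []" by blast
  define x where "x = hd xs"
  have xm: "x \<in> \<mm>" using xs by (auto simp: x_def)
  have xreg: "regular x" unfolding x_def using R xs(2,3) by (rule regular_hd_of_regular_sequence)
  have xc: "x \<in> carrier R" using xreg by (rule regular_closed)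
  have I: "ideal I R" "I \<noteq> carrier R" and rad: "ideal_radical R I = \<mm>"
    using prim by (simp_all add: primary_to_def primary_ideal_def)
  have Im: "I \<subseteq> \<mm>" using L.proper_ideal_subset I by blast
  obtain n :: nat where n: "x [^] n \<in> I" using xm rad unfolding ideal_radical_def by blast
  define y where "y = x [^] n"
  have y: "regular y" "y \<in> I" "y \<in> carrier R" unfolding y_def using regular_pow[OF xreg] n xc by simp_all
  have fin: "ideal_length R ((\<otimes>) y ` carrier R) (carrier R) \<noteq> \<infinity>"
    using y L.prime_containing_regular[OF dim] by (intro L.finite_length_if_primes_maximal) auto
  obtain A where A: "A \<subseteq> carrier R" "finite A" "I = Idl A" using N.finetely_gen[OF I(1)] by blast
  then obtain as where as: "set as = A" using finite_list by blast
  have "hilbert_data R \<mm> as y"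
    using y fin A(3) as Im genideal_self[OF A(1)]
    by (intro hilbert_data.intro hilbert_data_axioms.intro L.local_cring_axioms) auto
  then show "\<exists>as y. hilbert_data R \<mm> as y \<and> I = Idl (set as)" using A as by blast
  \<comment> \<open>On a finite carrier the injective multiplication by x would be onto, and 1 = x z
    would lie in \<open>\<mm>\<close>.\<close>
  show "infinite (UNIV :: 'a set)"
  proof
    assume "finite (UNIV :: 'a set)"
    then have "finite (carrier R)" by (rule finite_subset[OF subset_UNIV])
    moreover have "inj_on ((\<otimes>) x) (carrier R)" by (intro inj_onI) (rule regular_cancel[OF xreg])
    moreover have "(\<otimes>) x ` carrier R \<subseteq> carrier R" using xc by auto
    ultimately have "(\<otimes>) x ` carrier R = carrier R" by (intro endo_inj_surj)
    then obtain z where "z \<in> carrier R" "\<one> = x \<otimes> z" using one_closed by blast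
    then have "\<one> \<in> \<mm>" using ideal.I_r_closed[OF m(1) xm] by simp
    then show False using L.one_notin by blast
  qed
qed

section \<open>Length of quotient modules and Hilbert coefficients\<close>

context cring
begin

lemma ideal_quot_simps:
  "carrier (ideal_quot R J K) = (+>) K ` J"
  "\<zero>\<^bsub>ideal_quot R J K\<^esub> = K"
  "X \<oplus>\<^bsub>ideal_quot R J K\<^esub> Y = X <+>\<^bsub>R\<^esub> Y"
  "a \<odot>\<^bsub>ideal_quot R J K\<^esub> X = (\<Union>x\<in>X. K +> a \<otimes> x)"
  by (auto simp: ideal_quot_def quot_module_def regular_module_def A_RCOSETS_def' a_r_coset_def'
      set_add_def' fun_eq_iff)

lemma coset_eq_iff:
  assumes K: "ideal K R" and xz: "x \<in> carrier R" "z \<in> carrier R"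
  shows "K +> x = K +> z \<longleftrightarrow> x \<ominus> z \<in> K"
  using quotient_eq_iff_same_a_r_cos[OF K xz] by simp

lemma mem_coset_self: "ideal K R \<Longrightarrow> x \<in> carrier R \<Longrightarrow> x \<in> K +> x"
  using abelian_subgroup.a_rcos_self[OF abelian_subgroupI3[OF ideal.axioms(1) is_abelian_group]] .

text \<open>\<open>quot_module\<close> defines scalar multiplication by a union over all
  representatives; the cosets in this union coincide.\<close>

lemma coset_smult:
  assumes K: "ideal K R" and a: "a \<in> carrier R" and x: "x \<in> carrier R"
  shows "(\<Union>w\<in>K +> x. K +> a \<otimes> w) = K +> a \<otimes> x"
proof -
  have "K +> a \<otimes> w = K +> a \<otimes> x" if "w \<in> K +> x" for w
  proof -
    obtain k where k: "k \<in> K" "w = k \<oplus> x" using \<open>w \<in> K +> x\<close> by (auto simp: a_r_coset_def')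
    have kc: "k \<in> carrier R" using ideal.Icarr[OF K k(1)] .
    have "a \<otimes> w \<ominus> a \<otimes> x = a \<otimes> k" unfolding k(2) using a x kc by algebra
    moreover have "a \<otimes> k \<in> K" using K k(1) a by (rule ideal.I_l_closed)
    ultimately show ?thesis using a x kc k by (simp add: coset_eq_iff[OF K])
  qed
  then show ?thesis using mem_coset_self[OF K x] by blast
qed

lemma submodule_image_coset:
  assumes K: "ideal K R" and J: "ideal J R" and P: "ideal P R" and KP: "K \<subseteq> P" and PJ: "P \<subseteq> J"
  shows "submodule ((+>) K ` P) R (ideal_quot R J K)"
proof (intro submodule.intro subgroup.intro submodule_axioms.intro)
  let ?Q = "ideal_quot R J K"
  have Jc: "j \<in> carrier R" if "j \<in> J" for j using J that by (rule ideal.Icarr)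
  have Pc: "p \<in> carrier R" if "p \<in> P" for p using P that by (rule ideal.Icarr)
  have Kz: "K +> \<zero> = K" using K by (intro a_coset_add_zero ideal_subset_carrier)
  have z: "\<zero> \<in> P" using P by (simp add: additive_subgroup.zero_closed ideal.axioms(1))
  show "(+>) K ` P \<subseteq> carrier (add_monoid ?Q)" using PJ by (auto simp: ideal_quot_simps)
  show "\<one>\<^bsub>add_monoid ?Q\<^esub> \<in> (+>) K ` P" using Kz z by (force simp: ideal_quot_simps)
  have sum: "(K +> x) <+>\<^bsub>R\<^esub> (K +> y) = K +> (x \<oplus> y)" if "x \<in> carrier R" "y \<in> carrier R" for x y
    using K that by (rule ideal.a_rcos_sum)
  fix X assume "X \<in> (+>) K ` P"
  then obtain x where x: "x \<in> P" "X = K +> x" by blast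
  then have xc: "x \<in> carrier R" by (simp add: Pc)
  show "X \<otimes>\<^bsub>add_monoid ?Q\<^esub> Y \<in> (+>) K ` P" if Y: "Y \<in> (+>) K ` P" for Y
  proof -
    obtain y where y: "y \<in> P" "Y = K +> y" using Y by blast
    have "x \<oplus> y \<in> P" using P x(1) y(1) by (simp add: additive_subgroup.a_closed ideal.axioms(1))
    then show ?thesis using sum[OF xc Pc[OF y(1)]] x(2) y(2) by (simp add: ideal_quot_simps)
  qed
  show "inv\<^bsub>add_monoid ?Q\<^esub> X \<in> (+>) K ` P"
  proof -
    have nx: "\<ominus> x \<in> P" using P x(1) by (simp add: additive_subgroup.a_inv_closed ideal.axioms(1))
    \<comment> \<open>The group laws of the quotient have not been established, so the inverse is
      evaluated directly from its definite description.\<close>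
    have "inv\<^bsub>add_monoid ?Q\<^esub> X = K +> \<ominus> x"
      unfolding m_inv_def
    proof (rule the_equality)
      show "K +> \<ominus> x \<in> carrier (add_monoid ?Q) \<and>
          X \<otimes>\<^bsub>add_monoid ?Q\<^esub> (K +> \<ominus> x) = \<one>\<^bsub>add_monoid ?Q\<^esub> \<and>
          (K +> \<ominus> x) \<otimes>\<^bsub>add_monoid ?Q\<^esub> X = \<one>\<^bsub>add_monoid ?Q\<^esub>"
        using nx PJ xc Kz by (auto simp: ideal_quot_simps x(2) sum r_neg l_neg)
      fix Y assume Y: "Y \<in> carrier (add_monoid ?Q) \<and>
          X \<otimes>\<^bsub>add_monoid ?Q\<^esub> Y = \<one>\<^bsub>add_monoid ?Q\<^esub> \<and> Y \<otimes>\<^bsub>add_monoid ?Q\<^esub> X = \<one>\<^bsub>add_monoid ?Q\<^esub>"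
      then obtain y where y: "y \<in> J" "Y = K +> y" by (auto simp: ideal_quot_simps)
      have yc: "y \<in> carrier R" using y(1) by (rule Jc)
      have "K +> (x \<oplus> y) = K +> \<zero>" using Y sum[OF xc yc] Kz by (simp add: ideal_quot_simps x(2) y(2))
      then have "(x \<oplus> y) \<ominus> \<zero> \<in> K" using coset_eq_iff[OF K] xc yc by simp
      moreover have "(x \<oplus> y) \<ominus> \<zero> = y \<ominus> \<ominus> x" using xc yc by algebra
      ultimately show "Y = K +> \<ominus> x" using coset_eq_iff[OF K yc] xc y(2) by simp
    qed
    then show ?thesis using nx by blast
  qed
  show "a \<odot>\<^bsub>?Q\<^esub> X \<in> (+>) K ` P" if a: "a \<in> carrier R" for a
    using coset_smult[OF K a xc] ideal.I_l_closed[OF P x(1) a] by (simp add: ideal_quot_simps x(2))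
qed

text \<open>A submodule of J / K is a set of cosets, and its union is its preimage in J: one
  direction of the correspondence between submodules and intermediate ideals.\<close>

lemma ideal_Union_submodule:
  assumes K: "ideal K R" and J: "ideal J R" and KJ: "K \<subseteq> J" and N: "submodule N R (ideal_quot R J K)"
  shows "ideal (\<Union>N) R" "K \<subseteq> \<Union>N" "\<Union>N \<subseteq> J" "(+>) K ` \<Union>N = N"
proof -
  let ?Q = "ideal_quot R J K"
  have Jc: "j \<in> carrier R" if "j \<in> J" for j using J that by (rule ideal.Icarr)
  have NQ: "N \<subseteq> (+>) K ` J" and KN: "K \<in> N"
    and add: "\<And>X Y. X \<in> N \<Longrightarrow> Y \<in> N \<Longrightarrow> X <+>\<^bsub>R\<^esub> Y \<in> N"
    using subgroup.subset[OF submodule.axioms(1)[OF N]] subgroup.one_closed[OF submodule.axioms(1)[OF N]]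
      subgroup.m_closed[OF submodule.axioms(1)[OF N]]
    by (simp_all add: ideal_quot_simps)
  have smult: "(\<Union>x\<in>X. K +> a \<otimes> x) \<in> N" if "a \<in> carrier R" "X \<in> N" for a X
    using submodule.smult_closed[OF N that] by (simp add: ideal_quot_simps)
  have coset: "x \<in> J \<and> X = K +> x" if X: "X \<in> N" and x: "x \<in> X" for X x
  proof -
    obtain j where j: "j \<in> J" "X = K +> j" using X NQ by blast
    then obtain k where k: "k \<in> K" "x = k \<oplus> j" using x by (auto simp: a_r_coset_def')
    have c: "j \<in> carrier R" "k \<in> carrier R" using Jc[OF j(1)] ideal.Icarr[OF K k(1)] by auto
    have "x \<ominus> j = k" unfolding k(2) using c by algebra
    then have "K +> x = K +> j" using coset_eq_iff[OF K] c k by simp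
    moreover have "x \<in> J" using k j KJ J by (auto intro: additive_subgroup.a_closed[OF ideal.axioms(1)])
    ultimately show ?thesis using j by simp
  qed
  have mem: "x \<in> \<Union>N \<longleftrightarrow> x \<in> J \<and> K +> x \<in> N" for x
    using coset mem_coset_self[OF K] Jc by (metis UnionE UnionI)
  show sub: "\<Union>N \<subseteq> J" using mem by blast
  show "K \<subseteq> \<Union>N" using KN by blast
  show "(+>) K ` \<Union>N = N"
  proof
    show "(+>) K ` \<Union>N \<subseteq> N" using mem by blast
    show "N \<subseteq> (+>) K ` \<Union>N"
    proof
      fix X assume X: "X \<in> N"
      then obtain j where j: "j \<in> J" "X = K +> j" using NQ by blast
      then have "j \<in> \<Union>N" using X mem by blast
      then show "X \<in> (+>) K ` \<Union>N" using j by blast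
    qed
  qed
  have mult: "a \<otimes> x \<in> \<Union>N" if a: "a \<in> carrier R" and x: "x \<in> \<Union>N" for a x
  proof -
    have xJ: "x \<in> J" "K +> x \<in> N" using x mem by auto
    have "K +> a \<otimes> x \<in> N" using smult[OF a xJ(2)] coset_smult[OF K a Jc[OF xJ(1)]] by simp
    moreover have "a \<otimes> x \<in> J" using J xJ(1) a by (rule ideal.I_l_closed)
    ultimately show ?thesis using mem by blast
  qed
  show "ideal (\<Union>N) R"
  proof (rule idealI)
    show "ring R" by (rule ring_axioms)
    show "subgroup (\<Union>N) (add_monoid R)"
    proof (rule group.subgroupI[OF add.is_group], goal_cases)
      case 1
      show ?case using sub Jc by auto
    next
      case 2
      show ?case using KN additive_subgroup.zero_closed[OF ideal.axioms(1)[OF K]] by blast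
    next
      case (3 x)
      then have xc: "x \<in> carrier R" using sub Jc by blast
      \<comment> \<open>Closure under negation is obtained from scalar multiplication by -1, which
        avoids inverses in the quotient.\<close>
      then have "\<ominus> x = \<ominus> \<one> \<otimes> x" by (simp add: l_minus)
      then show ?case using mult[OF _ 3, of "\<ominus> \<one>"] by (simp flip: a_inv_def)
    next
      case (4 x y)
      then have xy: "x \<in> J" "y \<in> J" "K +> x \<in> N" "K +> y \<in> N" using mem by auto
      have "(K +> x) <+>\<^bsub>R\<^esub> (K +> y) = K +> (x \<oplus> y)"
        using K Jc[OF xy(1)] Jc[OF xy(2)] by (rule ideal.a_rcos_sum)
      then have "K +> (x \<oplus> y) \<in> N" using add[OF xy(3,4)] by simp
      moreover have "x \<oplus> y \<in> J" using J xy by (simp add: additive_subgroup.a_closed ideal.axioms(1))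
      ultimately have "x \<oplus> y \<in> \<Union>N" using mem by blast
      then show ?case by simp
    qed
    fix x a assume x: "x \<in> \<Union>N" and a: "a \<in> carrier R"
    show "a \<otimes> x \<in> \<Union>N" using a x by (rule mult)
    moreover have "x \<otimes> a = a \<otimes> x" using x sub Jc a by (intro m_comm) auto
    ultimately show "x \<otimes> a \<in> \<Union>N" by simp
  qed
qed

lemma coset_image_subset_iff:
  assumes K: "ideal K R" and P: "ideal P R" and Q: "ideal Q R" and KP: "K \<subseteq> P" and KQ: "K \<subseteq> Q"
  shows "(+>) K ` P \<subseteq> (+>) K ` Q \<longleftrightarrow> P \<subseteq> Q"
proof
  assume s: "(+>) K ` P \<subseteq> (+>) K ` Q"
  show "P \<subseteq> Q"
  proof
    fix p assume p: "p \<in> P"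
    then obtain q where q: "q \<in> Q" "K +> p = K +> q" using s by blast
    have c: "p \<in> carrier R" "q \<in> carrier R" using ideal.Icarr[OF P p] ideal.Icarr[OF Q q(1)] by auto
    then have "p \<ominus> q \<in> Q" using coset_eq_iff[OF K] q KQ by blast
    then have "(p \<ominus> q) \<oplus> q \<in> Q" using q(1) by (rule additive_subgroup.a_closed[OF ideal.axioms(1)[OF Q]])
    moreover have "(p \<ominus> q) \<oplus> q = p" using c by algebra
    ultimately show "p \<in> Q" by simp
  qed
qed blast

text \<open>The correspondence P -> P / K, with inverse N -> union of N, preserves strict inclusions
  in both directions and hence chains.\<close>

lemma module_length_ideal_quot:
  assumes K: "ideal K R" and J: "ideal J R" and KJ: "K \<subseteq> J"
  shows "module_length R (ideal_quot R J K) = ideal_length R K J"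
proof -
  let ?Q = "ideal_quot R J K"
  have "(\<exists>N. (\<forall>i\<le>k. submodule (N i) R ?Q) \<and> (\<forall>i<k. N i \<subset> N (Suc i))) \<longleftrightarrow> (\<exists>N. ideal_chain R K J k N)" for k
  proof
    assume "\<exists>N. (\<forall>i\<le>k. submodule (N i) R ?Q) \<and> (\<forall>i<k. N i \<subset> N (Suc i))"
    then obtain N where "(\<forall>i\<le>k. submodule (N i) R ?Q) \<and> (\<forall>i<k. N i \<subset> N (Suc i))" by (rule exE)
    then have N: "\<And>i. i \<le> k \<Longrightarrow> submodule (N i) R ?Q"
      and psub: "\<And>i. i < k \<Longrightarrow> N i \<subset> N (Suc i)"
      by simp_all
    note U = ideal_Union_submodule[OF K J KJ N]
    have "ideal_chain R K J k (\<lambda>i. \<Union>(N i))"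
      unfolding ideal_chain_def
    proof (intro conjI allI impI)
      fix i assume i: "i < k"
      then have "\<Union>(N i) \<noteq> \<Union>(N (Suc i))"
        using U(4)[of i] U(4)[of "Suc i"] psub[OF i] by (metis Suc_leI less_imp_le psubset_eq)
      moreover have "\<Union>(N i) \<subseteq> \<Union>(N (Suc i))" using psub[OF i] by (intro Union_mono) simp
      ultimately show "\<Union>(N i) \<subset> \<Union>(N (Suc i))" by (rule psubsetI[rotated])
    qed (rule U(1) U(2) U(3), assumption)+
    then show "\<exists>N. ideal_chain R K J k N" by (rule exI[of _ "\<lambda>i. \<Union>(N i)"])
  next
    assume "\<exists>N. ideal_chain R K J k N"
    then obtain N where N: "ideal_chain R K J k N" by (rule exE)
    have Ni: "ideal (N i) R" "K \<subseteq> N i" "N i \<subseteq> J" if "i \<le> k" for i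
      using N that by (simp_all add: ideal_chain_def)
    have "(+>) K ` N i \<subset> (+>) K ` N (Suc i)" if i: "i < k" for i
    proof -
      have "N i \<subset> N (Suc i)" using N i by (simp add: ideal_chain_def)
      then show ?thesis
        using coset_image_subset_iff[OF K Ni(1) Ni(1) Ni(2) Ni(2), of i "Suc i"]
          coset_image_subset_iff[OF K Ni(1) Ni(1) Ni(2) Ni(2), of "Suc i" i] i
        unfolding less_le_not_le by simp
    qed
    moreover have "submodule ((+>) K ` N i) R ?Q" if "i \<le> k" for i
      using K J Ni[OF that] by (rule submodule_image_coset)
    ultimately show "\<exists>N. (\<forall>i\<le>k. submodule (N i) R ?Q) \<and> (\<forall>i<k. N i \<subset> N (Suc i))"
      by (intro exI[of _ "\<lambda>i. (+>) K ` N i"]) blast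
  qed
  then show ?thesis unfolding module_length_def ideal_length_def by simp
qed

end

lemma hilb0_properties:
  fixes R :: "('a, 'b) ring_scheme"
  assumes CM: "cohen_macaulay_local R \<mm>" and dim: "krull_dim R = 1" and prim: "primary_to R \<mm> I"
  shows "\<exists>e p. (\<forall>n. hilb0 R I n \<le> e) \<and> (\<forall>n\<ge>p. hilb0 R I n = e)
    \<and> (\<forall>n. hilb0 R I n = e \<longrightarrow> hilb0 R I (Suc n) = e)"
    and "colength R I = int (hilb0 R I 0)" and "hilb_b R I = int (hilb0 R I 1)"
proof -
  obtain as y where data: "hilbert_data R \<mm> as y" and I: "I = Idl\<^bsub>R\<^esub> (set as)"
    using hilbert_data_if_cohen_macaulay(1)[OF assms] by blast
  interpret H: hilbert_data R \<mm> as y by (rule data)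
  note P = H.ideal_pow_ideal[OF H.I_ideal]
  have hilb0: "hilb0 R I n = the_enat (H.hilbert n)" for n
    using H.module_length_ideal_quot[OF P P H.ideal_pow_Suc_subset[OF H.I_ideal], of n]
    by (simp add: hilb0_def ideal_quot_length_def I)
  obtain e p where e: "\<And>n. H.hilbert n \<le> enat e" "\<And>n. n \<ge> p \<Longrightarrow> H.hilbert n = enat e"
    "\<And>n. H.hilbert n = enat e \<Longrightarrow> H.hilbert (Suc n) = enat e"
    using hilbert_function_properties[OF data hilbert_data_if_cohen_macaulay(2)[OF assms]] by blast
  \<comment> \<open>The bound by e makes the lengths finite, so \<open>the_enat\<close> in the
    definition of \<open>hilb0\<close> returns the true value.\<close>
  have hilbert: "H.hilbert n = enat (hilb0 R I n)" for n
    unfolding hilb0 using e(1)[of n] by (cases "H.hilbert n") auto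
  show "\<exists>e p. (\<forall>n. hilb0 R I n \<le> e) \<and> (\<forall>n\<ge>p. hilb0 R I n = e)
    \<and> (\<forall>n. hilb0 R I n = e \<longrightarrow> hilb0 R I (Suc n) = e)"
    using e unfolding hilbert enat_ord_simps enat.inject by blast
  show "colength R I = int (hilb0 R I 0)"
    using H.ideal_pow_1[OF H.I_ideal] by (simp add: colength_def hilb0_def I)
  show "hilb_b R I = int (hilb0 R I 1)"
    using H.ideal_pow_1[OF H.I_ideal] by (simp add: hilb_b_def hilb0_def I numeral_2_eq_2)
qed

section \<open>Hilbert coefficients and the coefficients of the generating function\<close>

lemma hilb_coefficients:
  assumes p: "\<And>n. n \<ge> p \<Longrightarrow> hilb0 R I n = e"
  shows "hilb_e0 R I = int e"
    and "n \<ge> p \<Longrightarrow> hilb_e1 R I = (\<Sum>j\<le>n. int e - int (hilb0 R I j))"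
proof -
  have "hilb_e0 R I = int e"
    unfolding hilb_e0_def
  proof (rule the_equality)
    show ev: "\<forall>\<^sub>F n in sequentially. int (hilb0 R I n) = int e"
      using p by (auto simp: eventually_sequentially)
    show "f = int e" if f: "\<forall>\<^sub>F n in sequentially. int (hilb0 R I n) = f" for f
    proof -
      have "\<forall>\<^sub>F n :: nat in sequentially. f = int e" using eventually_conj[OF ev f] by (rule eventually_mono) simp
      then show ?thesis by simp
    qed
  qed
  then show e0: "hilb_e0 R I = int e" .
  assume n: "n \<ge> p"
  define s where "s = (\<Sum>j\<le>n. int e - int (hilb0 R I j))"
  have "(\<Sum>j\<le>m. int e - int (hilb0 R I j)) = s" if "m \<ge> n" for m
    using that by (induction rule: dec_induct) (use p n in \<open>simp_all add: s_def\<close>)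
  moreover have "int (hilb1 R I m) = int e * (int m + 1) - (\<Sum>j\<le>m. int e - int (hilb0 R I j))" for m
    by (simp add: hilb1_def sum_subtractf atLeast0AtMost algebra_simps)
  ultimately have h1: "int (hilb1 R I m) = hilb_e0 R I * (int m + 1) - s" if "m \<ge> n" for m
    using that e0 by simp
  have "hilb_e1 R I = s"
    unfolding hilb_e1_def
  proof (rule the_equality)
    show ev: "\<forall>\<^sub>F n in sequentially. int (hilb1 R I n) = hilb_e0 R I * (int n + 1) - s"
      using h1 by (auto simp: eventually_sequentially)
    show "f = s" if f: "\<forall>\<^sub>F n in sequentially. int (hilb1 R I n) = hilb_e0 R I * (int n + 1) - f" for f
    proof -
      have "\<forall>\<^sub>F n :: nat in sequentially. f = s" using eventually_conj[OF ev f] by (rule eventually_mono) simp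
      then show ?thesis by simp
    qed
  qed
  then show "hilb_e1 R I = (\<Sum>j\<le>n. int e - int (hilb0 R I j))" by (simp add: s_def)
qed

text \<open>Multiplying the series with coefficients n + 1 by 1 - T gives the geometric series, and
  once more gives 1; inverses are unique.\<close>

lemma inv_one_minus_T_sq_eq: "inv_one_minus_T_sq = Abs_fps (\<lambda>n. int n + 1)"
proof -
  let ?A = "Abs_fps (\<lambda>n. int n + 1)" and ?B = "Abs_fps (\<lambda>n. 1 :: int)"
  have "(1 - fps_X) * ?A = ?B" by (rule fps_ext) (simp add: left_diff_distrib of_nat_diff)
  moreover have "(1 - fps_X) * ?B = 1" by (rule fps_ext) (simp add: left_diff_distrib)
  ultimately have A: "(1 - fps_X) ^ 2 * ?A = 1" by (simp add: power2_eq_square mult.assoc)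
  have "inv_one_minus_T_sq = inv_one_minus_T_sq * ((1 - fps_X) ^ 2 * ?A)" by (simp add: A)
  also have "\<dots> = ((1 - fps_X) ^ 2 * inv_one_minus_T_sq) * ?A" by (simp only: ac_simps)
  finally show ?thesis by (simp add: one_minus_T_sq_inverse)
qed

lemma fps_nth_X_power_inv_one_minus_T_sq:
  "fps_nth (fps_X ^ k * inv_one_minus_T_sq) n = (if n < k then 0 else int n - int k + 1)"
  by (simp add: inv_one_minus_T_sq_eq fps_X_power_mult_nth of_nat_diff)

theorem theorem2p3:
  fixes R :: "('a, 'b) ring_scheme" and \<mm> I :: "'a set"
  assumes "cohen_macaulay_local R \<mm>"
    and "krull_dim R = 1"
    and "primary_to R \<mm> I"
  shows "(hilb_beta R I = 0 \<longrightarrow>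
            hilb1_series R I = fps_const (colength R I) * inv_one_minus_T_sq)
       \<and> (hilb_beta R I = 1 \<longrightarrow>
            hilb1_series R I =
              (fps_const (colength R I) + fps_const (hilb_b R I - colength R I) * fps_X)
                * inv_one_minus_T_sq)
       \<and> (hilb_beta R I \<ge> 2 \<longrightarrow>
            hilb1_series R I \<le>\<^sub>c
              (fps_const (colength R I) + fps_const (hilb_b R I - colength R I) * fps_X
                + fps_const (hilb_e0 R I - hilb_b R I - 1) * fps_X ^ 2
                + fps_X ^ nat (hilb_beta R I))
                * inv_one_minus_T_sq)"
proof -
  obtain e p where le: "\<And>n. hilb0 R I n \<le> e" and p: "\<And>n. n \<ge> p \<Longrightarrow> hilb0 R I n = e"
    and step: "\<And>n. hilb0 R I n = e \<Longrightarrow> hilb0 R I (Suc n) = e"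
    using hilb0_properties(1)[OF assms] by blast
  \<comment> \<open>d is the defect e_0 - H(n). Its partial sums D increase, are constant after the
    first zero of d, and end at e_1.\<close>
  define d where "d n = int e - int (hilb0 R I n)" for n
  define D where "D n = (\<Sum>j\<le>n. d j)" for n
  have d_nonneg: "0 \<le> d n" for n using le[of n] by (simp add: d_def)
  have d_zero: "d m = 0" if "d n = 0" "n \<le> m" for m n
    using that(2,1) by (induction rule: dec_induct) (use step in \<open>simp_all add: d_def\<close>)
  have D_mono: "D m \<le> D n" if "m \<le> n" for m n
    unfolding D_def using that d_nonneg by (intro sum_mono2) auto
  have D_const: "D m = D n" if "d n = 0" "n \<le> m" for m n
    using that(2,1) by (induction rule: dec_induct) (use d_zero in \<open>auto simp: D_def\<close>)
  have lam: "colength R I = int e - d 0" and b: "hilb_b R I = int e - d 1"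
    using hilb0_properties(2,3)[OF assms] by (simp_all add: d_def)
  have e0: "hilb_e0 R I = int e" using hilb_coefficients(1)[OF p] .
  have e1: "hilb_e1 R I = D n" if "p \<le> n" for n
    using hilb_coefficients(2)[OF p that] by (simp add: D_def d_def)
  have e1_ge: "D n \<le> hilb_e1 R I" for n
    using e1[of "max p n"] D_mono[of n "max p n"] by simp
  have D1: "D 1 = d 0 + d 1" by (simp add: D_def)
  have H1: "int (hilb1 R I n) = int e * (int n + 1) - D n" for n
    by (simp add: hilb1_def D_def d_def sum_subtractf atLeast0AtMost algebra_simps)
  \<comment> \<open>By \<open>lam\<close> and \<open>b\<close> the conditions on e_0 say that d 0 or
    d 1 vanishes, and - 2 e_0 + colength + b = - (d 0 + d 1) = - D 1. Nonnegativity of d 1 rules out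
    the undefined branch.\<close>
  have beta: "hilb_beta R I = (if d 0 = 0 then 0 else if d 1 = 0 then 1 else hilb_e1 R I - D 1 + 2)"
    using d_nonneg[of 1] D1 unfolding hilb_beta_def e0 lam b by auto
  have coeff: "fps_nth ((fps_const c0 + fps_const c1 * fps_X) * inv_one_minus_T_sq) n
      = c0 * (int n + 1) + c1 * int n" for c0 c1 n
    using fps_nth_X_power_inv_one_minus_T_sq[of 0 n] fps_nth_X_power_inv_one_minus_T_sq[of 1 n]
    by (simp add: distrib_right mult.assoc)
  have "hilb1_series R I = fps_const (colength R I) * inv_one_minus_T_sq" if "hilb_beta R I = 0"
  proof (rule fps_ext)
    fix n
    \<comment> \<open>The third branch of beta has value at least 2 because D 1 is at most e_1, and
      the second has value 1; so beta = 0 comes from the first branch.\<close>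
    have "d 0 = 0" using that e1_ge[of 1] by (auto simp: beta split: if_splits)
    then have "D n = 0" using D_const[of 0 n] by (simp add: D_def)
    then show "fps_nth (hilb1_series R I) n = fps_nth (fps_const (colength R I) * inv_one_minus_T_sq) n"
      using \<open>d 0 = 0\<close> fps_nth_X_power_inv_one_minus_T_sq[of 0 n] by (simp add: hilb1_series_def H1 lam)
  qed
  moreover have "hilb1_series R I =
      (fps_const (colength R I) + fps_const (hilb_b R I - colength R I) * fps_X) * inv_one_minus_T_sq"
    if "hilb_beta R I = 1"
  proof (rule fps_ext)
    fix n
    have d1: "d 1 = 0" using that e1_ge[of 1] by (auto simp: beta split: if_splits)
    have "D n = d 0"
    proof (cases "n = 0")
      case False
      then show ?thesis using D_const[OF d1, of n] d1 by (simp add: D_def)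
    qed (simp add: D_def)
    then show "fps_nth (hilb1_series R I) n = fps_nth ((fps_const (colength R I)
        + fps_const (hilb_b R I - colength R I) * fps_X) * inv_one_minus_T_sq) n"
      unfolding coeff by (simp add: hilb1_series_def H1 lam b d1[unfolded One_nat_def] algebra_simps)
  qed
  moreover have "hilb1_series R I \<le>\<^sub>c
      (fps_const (colength R I) + fps_const (hilb_b R I - colength R I) * fps_X
        + fps_const (hilb_e0 R I - hilb_b R I - 1) * fps_X ^ 2 + fps_X ^ nat (hilb_beta R I))
        * inv_one_minus_T_sq"
    if ge: "hilb_beta R I \<ge> 2"
    unfolding fps_coeff_le_def
  proof
    fix n
    define B where "B = nat (hilb_beta R I)"
    have B: "int B = hilb_e1 R I - D 1 + 2"
      using ge by (auto simp: B_def beta split: if_splits)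
    have B2: "2 \<le> B" using ge by (simp add: B_def)
    have rhs: "fps_nth ((fps_const (colength R I) + fps_const (hilb_b R I - colength R I) * fps_X
        + fps_const (hilb_e0 R I - hilb_b R I - 1) * fps_X ^ 2 + fps_X ^ B) * inv_one_minus_T_sq) n
      = colength R I * (int n + 1) + (hilb_b R I - colength R I) * int n
        + (hilb_e0 R I - hilb_b R I - 1) * (if n < 2 then 0 else int n - 1)
        + (if n < B then 0 else int n - int B + 1)"
      unfolding distrib_right[of "_ + _" _ inv_one_minus_T_sq] fps_add_nth
      using coeff[of "colength R I" "hilb_b R I - colength R I" n]
        fps_nth_X_power_inv_one_minus_T_sq[of 2 n] fps_nth_X_power_inv_one_minus_T_sq[of B n]
      by (simp add: distrib_right mult.assoc)
    have key: "int e * (int n + 1) - D n \<le> colength R I * (int n + 1) + (hilb_b R I - colength R I) * int n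
        + (hilb_e0 R I - hilb_b R I - 1) * (if n < 2 then 0 else int n - 1)
        + (if n < B then 0 else int n - int B + 1)"
    proof (cases "n < 2")
      case True
      then have "n = 0 \<or> n = 1" by auto
      then show ?thesis using B2 by (auto simp: lam b D_def algebra_simps)
    next
      case False
      \<comment> \<open>This is the bound after cancelling the terms with e, lambda and b. The left
        side is D 1 + (n - 1) for n < B and D 1 + B - 2 = e_1 for n >= B, so it never exceeds
        e_1.\<close>
      have "D 1 + (int n - 1) - (if n < B then 0 else int n - int B + 1) \<le> D n"
      proof (cases "\<exists>j\<le>n. d j = 0")
        case True
        then obtain j where j: "j \<le> n" "d j = 0" by blast
        then have "d n = 0" using d_zero by blast
        then have "D n = D (max p n)" using D_const[of n "max p n"] by simp
        then have "D n = hilb_e1 R I" using e1[of "max p n"] by simp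
        then show ?thesis using B by auto
      next
        case nz: False
        \<comment> \<open>While no defect has vanished, each is a positive integer and adds at least
          1 to D.\<close>
        have "D 1 + (int m - 1) \<le> D m" if "1 \<le> m" "m \<le> n" for m
          using that
        proof (induction rule: dec_induct)
          case (step m)
          have "1 \<le> d (Suc m)" using nz step d_nonneg[of "Suc m"] by force
          then show ?case using step by (simp add: D_def)
        qed simp
        then have "D 1 + (int n - 1) \<le> D n" using False by simp
        then show ?thesis by auto
      qed
      then show ?thesis using False by (simp add: lam b e0 D1[unfolded One_nat_def] algebra_simps)
    qed
    show "fps_nth (hilb1_series R I) n \<le> fps_nth ((fps_const (colength R I)
        + fps_const (hilb_b R I - colength R I) * fps_X
        + fps_const (hilb_e0 R I - hilb_b R I - 1) * fps_X ^ 2 + fps_X ^ nat (hilb_beta R I))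
        * inv_one_minus_T_sq) n"
      using key unfolding B_def[symmetric] rhs by (simp add: hilb1_series_def H1)
  qed
  ultimately show ?thesis by blast
qed

end
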